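(* Let $F$ be any probability distribution on the real line, and let $F_0:=F-F(\{0\})\,1_0$, where $1_0$ is Dirac measure at $0$. Then $\mathcal{I}_{\rm s1}(F)$ is finite if and only if (i) $F_0$ is absolutely continuous (with respect to Lebesgue measure $\lambda$) with a density $f$ such that (ii) the function $x\mapsto x\,f(x)$ is absolutely continuous, and (iii) the function $x\mapsto\Lambda(x):=-[\,x f(x)]'/f(x)$ belongs to $L_2(F_0)$. In this case, $$\mathcal{I}_{\rm s1}(F)=\int\Lambda^2\,dF_0=\int_{x\neq0}\Bigl[\,1+x\,\frac{f'(x)}{f(x)}\Bigr]^2\,F(dx).$$
   Context: Let $\mathcal{C}_{\rm c1}$ denote the set of all differentiable functions $\phi\colon\mathbb{R}\to\mathbb{R}$ whose derivative $\phi'$ is continuous and of compact support (the function $\phi$ itself need not have compact support). For any probability distribution $F$ on the Borel $\sigma$-algebra of $\mathbb{R}$, the Fisher information of scale is $$\mathcal{I}_{\rm s1}(F):=\sup_{\phi\in\mathcal{C}_{\rm c1}}\frac{\bigl(\int x\,\phi'(x)\,F(dx)\bigr)^2}{\int\phi^2(x)\,F(dx)}\in[0,\infty],$$ where by convention $0/0:=0$, and $c/0:=\infty$ for $c>0$. The measure $F_0$ is the (possibly substochastic) measure obtained from $F$ by removing its mass at zero. A function $g\colon\mathbb{R}\to\mathbb{R}$ is called absolutely continuous if for every $\varepsilon>0$ there is a $\delta>0$ such that for any finite collection of disjoint segments $(a_i,b_i]$ of total Lebesgue measure less than $\delta$ one has $\sum_i|g(b_i)-g(a_i)|<\varepsilon$.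 Such a function is differentiable $\lambda$-almost everywhere. The derivatives $[xf(x)]'$ and $f'(x)$ (for $x\neq0$) are the $\lambda$-a.e. existing ones, and the quotients by $f$ are considered $F_0$-almost everywhere. *)

theory Defs
  imports "HOL-Probability.Probability"
begin

definition C_c1 :: "(real \<Rightarrow> real) set" where
  "C_c1 = {\<phi>. (\<forall>x. \<phi> differentiable (at x)) \<and> continuous_on UNIV (deriv \<phi>) \<and>
                compact (closure {x. deriv \<phi> x \<noteq> 0})}"

(* Division in ennreal satisfies 0 / 0 = 0 and c / 0 = \<infinity> for c > 0.  Both integrals are
   finite when F is a probability measure: x * deriv \<phi> x and \<phi> are bounded and continuous. *)
definition fisher_scale :: "real measure \<Rightarrow> ennreal" where
  "fisher_scale F =
    (SUP \<phi>\<in>C_c1. ennreal ((\<integral>x. x * deriv \<phi> x \<partial>F)\<^sup>2) / ennreal (\<integral>x. (\<phi> x)\<^sup>2 \<partial>F))"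

definition remove_zero_mass :: "real measure \<Rightarrow> real measure" where
  "remove_zero_mass F = diff_measure F (scale_measure (emeasure F {0}) (return borel 0))"

definition abs_continuous_fun :: "(real \<Rightarrow> real) \<Rightarrow> bool" where
  "abs_continuous_fun g \<longleftrightarrow>
    (\<forall>\<epsilon>>0. \<exists>\<delta>>0. \<forall>S :: (real \<times> real) set.
       finite S \<and> (\<forall>(a, b)\<in>S. a \<le> b) \<and> disjoint_family_on (\<lambda>(a, b). {a<..b}) S \<and>
       (\<Sum>(a, b)\<in>S. b - a) < \<delta> \<longrightarrow> (\<Sum>(a, b)\<in>S. \<bar>g b - g a\<bar>) < \<epsilon>)"

definition is_lebesgue_density :: "real measure \<Rightarrow> (real \<Rightarrow> real) \<Rightarrow> bool" where
  "is_lebesgue_density M f \<longleftrightarrow>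
    f \<in> borel_measurable borel \<and> (\<forall>x. 0 \<le> f x) \<and> M = density lborel (\<lambda>x. ennreal (f x))"

(* If x * f x is absolutely continuous, then it is differentiable lborel-almost everywhere.
   The value of deriv at the other points, and that of the quotient where f vanishes, only
   affect Lambda on a null set of the measure with density f. *)
definition Lambda :: "(real \<Rightarrow> real) \<Rightarrow> real \<Rightarrow> real" where
  "Lambda f x = - deriv (\<lambda>y. y * f y) x / f x"

definition in_L2 :: "real measure \<Rightarrow> (real \<Rightarrow> real) \<Rightarrow> bool" where
  "in_L2 M g \<longleftrightarrow> g \<in> borel_measurable M \<and> integrable M (\<lambda>x. (g x)\<^sup>2)"

definition scale_regular_density :: "real measure \<Rightarrow> (real \<Rightarrow> real) \<Rightarrow> bool" where
  "scale_regular_density F f \<longleftrightarrow>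
    is_lebesgue_density (remove_zero_mass F) f \<and>
    abs_continuous_fun (\<lambda>x. x * f x) \<and>
    in_L2 (remove_zero_mass F) (Lambda f)"

end

theory Submission
  imports Defs
begin

text \<open>
  Write \<open>T \<phi> = \<integral>x. x * \<phi>' x \<partial>F\<close>. If the information is finite, \<open>T\<close> is bounded in the
  norm of \<open>L\<^sup>2(F)\<close>, so \<open>T \<phi> = \<integral>w * \<phi> \<partial>F\<close> for some \<open>w\<close> whose squared norm is the information. Testing
  with smoothed ramps and exchanging integrals shows that \<open>x F(dx)\<close> has the Lebesgue density
  \<open>H y = \<integral>\<^bsub>{y<..}\<^esub> w \<partial>F\<close>. Comparing both sides on small intervals next to \<open>0\<close> gives \<open>H 0 = 0\<close> and
  shows that \<open>w\<close> puts no mass at \<open>0\<close>; hence \<open>f y = H y / y\<close> is a density of the measure off \<open>0\<close>, and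
  \<open>y * f y = H y\<close> is an indefinite integral of \<open>- w * f\<close>, which identifies \<open>w\<close> with \<open>\<Lambda>\<close>.

  Conversely, if \<open>g y = y * f y\<close> is absolutely continuous, then it is an indefinite integral of
  \<open>- \<Lambda> * f\<close>. It vanishes at both infinities, because its averages over \<open>{n<..2 * n}\<close> are controlled by
  the tails of \<open>F\<close>. Integration by parts then gives \<open>T \<phi> = \<integral>\<Lambda> * \<phi> \<partial>F\<^sub>0\<close>, and the Cauchy--Schwarz
  inequality bounds the information. The two values agree because two continuous functions that
  coincide almost everywhere are equal.
\<close>

section \<open>Differentiation of indefinite integrals almost everywhere\<close>

text \<open>The information controls integrals, whereas \<open>Lambda\<close> is made from pointwise
  derivatives; Lebesgue differentiation and the integral representation of absolutely continuous
  functions translate between the two. The obstacle is the point 0, where F may have an atom. T does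
  not see it, because x * \<phi>' x vanishes there, but the norm of L2(F) does, so w might charge
  it. It does not: over a one-sided interval within distance d of 0 and of length of order d, the
  integral of x is at most d times a mass tending to 0, while the integral of H is about the length
  times a one-sided limit of H. Hence both one-sided limits of H at 0 vanish; the right one is H 0,
  and the left one exceeds it by \<open>w 0 * measure F {0}\<close>. Test functions need not decay.
  The constant 1 forces w to have mean 0, and the converse has to recover this, since \<phi>'
  determines \<phi> only up to a constant. This is why minus infinity matters there as well: the
  limit of x f(x) at that end is the mean of \<Lambda>.\<close>

lemma non_differentiation_points_cover:
  fixes \<nu> :: "real measure"
  assumes fin: "finite_measure \<nu>" and sets: "sets \<nu> = sets borel" and A: "A \<in> null_sets \<nu>"
    and t: "t > 0" and e: "e > 0"
  shows "\<exists>T\<in>sets lborel. {x \<in> A. \<not> (\<forall>\<^sub>F s in at_right 0. measure \<nu> (ball x s) \<le> t * s)} \<subseteq> T \<and>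
           emeasure lborel T \<le> ennreal e"
proof -
  interpret finite_measure \<nu> by fact
  define S where "S = {x \<in> A. \<not> (\<forall>\<^sub>F s in at_right 0. measure \<nu> (ball x s) \<le> t * s)}"
  have Ab: "A \<in> sets borel" using A sets by auto
  have "emeasure \<nu> A = (INF U \<in> {U. A \<subseteq> U \<and> open U}. emeasure \<nu> U)"
    by (rule outer_regular[OF sets _ Ab]) (use emeasure_finite in auto)
  moreover have "emeasure \<nu> A = 0" using A by auto
  \<comment> \<open>The radius of a bad ball is below its \<nu>-measure divided by \<open>t\<close>,
    and the fivefold enlargement has length 10 times the radius; \<open>e * t / 10\<close> makes the
    total length at most \<open>e\<close>.\<close>
  ultimately have "(INF U \<in> {U. A \<subseteq> U \<and> open U}. emeasure \<nu> U) < ennreal (e * t / 10)"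
    using e t by simp
  then obtain U where U: "A \<subseteq> U" "open U" "emeasure \<nu> U < ennreal (e * t / 10)"
    by (auto simp: INF_less_iff)
  have mU: "measure \<nu> U \<le> e * t / 10"
    using U(3) e t by (simp add: emeasure_eq_measure ennreal_less_iff)
  have "\<forall>x\<in>S. \<exists>s. 0 < s \<and> s \<le> 1 \<and> ball x s \<subseteq> U \<and> measure \<nu> (ball x s) > t * s"
  proof
    fix x assume x: "x \<in> S"
    then have "x \<in> U" using U by (auto simp: S_def)
    then obtain d where d: "d > 0" "ball x d \<subseteq> U" using U(2) openE by blast
    \<comment> \<open>Failure of the eventual bound yields violating radii below any threshold:
      below \<open>d\<close> to stay inside \<open>U\<close>, below 1 because the covering lemma
      wants bounded radii.\<close>
    have "\<not> (\<forall>s>0. s < min 1 d \<longrightarrow> measure \<nu> (ball x s) \<le> t * s)"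
      using x d unfolding S_def eventually_at_right_field mem_Collect_eq
      by (metis less_numeral_extra(1) min_less_iff_conj)
    then obtain s where s: "s > 0" "s < min 1 d" "measure \<nu> (ball x s) > t * s" by force
    then show "\<exists>s. 0 < s \<and> s \<le> 1 \<and> ball x s \<subseteq> U \<and> measure \<nu> (ball x s) > t * s"
      using d by (intro exI[of _ s]) auto
  qed
  then obtain r where r: "\<And>x. x \<in> S \<Longrightarrow> 0 < r x \<and> r x \<le> 1 \<and> ball x (r x) \<subseteq> U \<and> measure \<nu> (ball x (r x)) > t * r x"
    by metis
  obtain C where C: "countable C" "C \<subseteq> S"
     "pairwise (\<lambda>i j. disjnt (ball i (r i)) (ball j (r j))) C"
     "S \<subseteq> (\<Union>i\<in>C. ball i (5 * r i))"
    by (rule Vitali_covering_lemma_balls[where S = S and K = S and a = "\<lambda>x. x" and r = r and B = 1]) (use r in force)+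
  \<comment> \<open>The countable family is reindexed by natural numbers, with empty sets off
    \<open>N\<close>, so that countable additivity for sequences applies.\<close>
  define N where "N = to_nat_on C ` C"
  define p where "p = from_nat_into C"
  have p: "p n \<in> C" if "n \<in> N" for n
    using that C(1) by (auto simp: p_def N_def)
  have pN: "p ` N = C" using C(1) by (force simp: p_def N_def)
  have inj: "inj_on p N" using C(1) by (auto simp: p_def N_def inj_on_def)
  define B where "B = (\<lambda>n. if n \<in> N then ball (p n) (r (p n)) else {})"
  define B5 where "B5 = (\<lambda>n. if n \<in> N then ball (p n) (5 * r (p n)) else {})"
  have disj: "disjoint_family B"
    unfolding disjoint_family_on_def
  proof (intro ballI impI)
    fix m n :: nat assume mn: "m \<noteq> n"
    show "B m \<inter> B n = {}"
    proof (cases "m \<in> N \<and> n \<in> N")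
      case True
      then have "p m \<noteq> p n" using inj mn by (auto dest: inj_onD)
      then show ?thesis using True p pairwiseD[OF C(3), of "p m" "p n"] by (auto simp: B_def disjnt_def)
    qed (auto simp: B_def)
  qed
  have S: "S \<subseteq> (\<Union>n. B5 n)"
  proof
    fix x assume "x \<in> S"
    then obtain i where i: "i \<in> C" "x \<in> ball i (5 * r i)" using C(4) by auto
    then obtain n where "n \<in> N" "i = p n" using pN by auto
    then show "x \<in> (\<Union>n. B5 n)" using i by (auto simp: B5_def intro!: exI[of _ n])
  qed
  have term_le: "emeasure lborel (B5 n) \<le> ennreal (10 / t) * emeasure \<nu> (B n)" for n
  proof (cases "n \<in> N")
    case True
    then have i: "p n \<in> S" using p C by auto
    have "emeasure lborel (ball (p n) (5 * r (p n))) = ennreal (10 * r (p n))"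
      using r[OF i] by (simp add: ball_eq_greaterThanLessThan)
    also have "\<dots> \<le> ennreal (10 / t * measure \<nu> (ball (p n) (r (p n))))"
      using r[OF i] t by (intro ennreal_leI) (simp add: field_simps)
    also have "\<dots> = ennreal (10 / t) * ennreal (measure \<nu> (ball (p n) (r (p n))))"
      using t by (intro ennreal_mult) auto
    finally show ?thesis
      using True by (simp add: emeasure_eq_measure B_def B5_def)
  qed (simp add: B5_def)
  have BU: "(\<Union>n. B n) \<subseteq> U" using r p C by (force simp: B_def split: if_splits)
  show ?thesis
  proof (intro bexI conjI)
    show "{x \<in> A. \<not> (\<forall>\<^sub>F s in at_right 0. measure \<nu> (ball x s) \<le> t * s)} \<subseteq> (\<Union>n. B5 n)"
      using S by (simp add: S_def)
    show "(\<Union>n. B5 n) \<in> sets lborel" by (auto simp: B5_def)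
    have "emeasure lborel (\<Union>n. B5 n) \<le> (\<Sum>n. emeasure lborel (B5 n))"
      by (rule emeasure_subadditive_countably) (auto simp: B5_def)
    also have "\<dots> \<le> (\<Sum>n. ennreal (10 / t) * emeasure \<nu> (B n))"
      by (intro suminf_le term_le) auto
    also have "\<dots> = ennreal (10 / t) * emeasure \<nu> (\<Union>n. B n)"
      using disj by (subst suminf_emeasure[symmetric]) (auto simp: sets B_def)
    also have "\<dots> \<le> ennreal (10 / t) * emeasure \<nu> U"
      using BU U by (intro mult_left_mono emeasure_mono) (auto simp: sets)
    also have "\<dots> \<le> ennreal (10 / t) * ennreal (e * t / 10)"
      using U by (intro mult_left_mono) auto
    also have "\<dots> = ennreal e" using e t by (simp add: ennreal_mult'[symmetric])
    finally show "emeasure lborel (\<Union>n. B5 n) \<le> ennreal e" .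
  qed
qed

text \<open>The exceptional set is not shown to be measurable; it is caught in the intersection of
  measurable covers of length at most 1 / (n + 1). The bound weakens as \<open>t\<close> grows, so
  countably many \<open>t\<close> suffice.\<close>

lemma AE_lborel_measure_ball_small:
  fixes \<nu> :: "real measure"
  assumes fin: "finite_measure \<nu>" and sets: "sets \<nu> = sets borel" and A: "A \<in> null_sets \<nu>"
  shows "AE x in lborel. x \<in> A \<longrightarrow> (\<forall>t>0. \<forall>\<^sub>F s in at_right 0. measure \<nu> (ball x s) \<le> t * s)"
proof -
  have "AE x in lborel. x \<in> A \<longrightarrow> (\<forall>\<^sub>F s in at_right 0. measure \<nu> (ball x s) \<le> t * s)" if t: "t > 0" for t
  proof -
    let ?S = "{x \<in> A. \<not> (\<forall>\<^sub>F s in at_right 0. measure \<nu> (ball x s) \<le> t * s)}"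
    have ex: "\<forall>n::nat. \<exists>T. T \<in> sets lborel \<and> ?S \<subseteq> T \<and> emeasure lborel T \<le> ennreal (inverse (Suc n))"
      using non_differentiation_points_cover[OF fin sets A t] unfolding Bex_def by simp
    obtain T where "\<forall>n. T n \<in> sets lborel \<and> ?S \<subseteq> T n \<and> emeasure lborel (T n) \<le> ennreal (inverse (Suc n))"
      using choice[OF ex] by (rule exE)
    then have T: "\<And>n::nat. T n \<in> sets lborel" "\<And>n. ?S \<subseteq> T n"
      "\<And>n. emeasure lborel (T n) \<le> ennreal (inverse (Suc n))" by blast+
    have "emeasure lborel (\<Inter>n. T n) \<le> ennreal (inverse (Suc n))" for n
      by (rule order_trans[OF emeasure_mono T(3)]) (use T in auto)
    moreover have "(\<lambda>n. ennreal (inverse (real (Suc n)))) \<longlonglongrightarrow> ennreal 0"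
      by (intro tendsto_ennrealI LIMSEQ_inverse_real_of_nat)
    ultimately have "emeasure lborel (\<Inter>n. T n) \<le> ennreal 0"
      by (intro LIMSEQ_le_const) auto
    then have "(\<Inter>n. T n) \<in> null_sets lborel" using T by auto
    then show ?thesis by (rule AE_I') (use T(2) in auto)
  qed
  then have "AE x in lborel. \<forall>n. x \<in> A \<longrightarrow> (\<forall>\<^sub>F s in at_right 0. measure \<nu> (ball x s) \<le> inverse (real (Suc n)) * s)"
    by (subst AE_all_countable) simp
  then show ?thesis
  proof (rule AE_mp, intro AE_I2 impI allI)
    fix x t :: real assume H: "\<forall>n. x \<in> A \<longrightarrow> (\<forall>\<^sub>F s in at_right 0. measure \<nu> (ball x s) \<le> inverse (real (Suc n)) * s)"
      and x: "x \<in> A" and t: "0 < t"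
    obtain n where n: "inverse (real (Suc n)) < t" using reals_Archimedean[OF t] by auto
    have "\<forall>\<^sub>F s in at_right 0. measure \<nu> (ball x s) \<le> inverse (real (Suc n)) * s" using H x by blast
    then show "\<forall>\<^sub>F s in at_right 0. measure \<nu> (ball x s) \<le> t * s"
      using eventually_at_right_less[of 0]
    proof eventually_elim
      case (elim s)
      then show ?case using mult_right_mono[of "inverse (real (Suc n))" t s] n by linarith
    qed
  qed
qed

text \<open>\<open>G\<close> exceeds slope \<open>r\<close> only through the measure with density
  \<open>max 0 (h x - r)\<close>, which does not charge the set where \<open>h x < r\<close>. At
  almost every point of that set its small balls therefore have measure o(s).\<close>

lemma AE_upper_derivative_le:
  fixes h G :: "real \<Rightarrow> real"
  assumes h: "integrable lborel h"
    and G: "\<And>a b. c \<le> a \<Longrightarrow> a \<le> b \<Longrightarrow> b \<le> d \<Longrightarrow> G b - G a = (LINT x:{a<..b}|lborel. h x)"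
  shows "AE x in lborel. c < x \<and> x < d \<and> h x < r \<longrightarrow>
           (\<forall>t>0. \<forall>\<^sub>F s in at 0. (G (x + s) - G x) / s \<le> r + t)"
proof -
  have [measurable]: "h \<in> borel_measurable borel" using h by auto
  \<comment> \<open>Restricting to \<open>{c..d}\<close> keeps this integrable for negative
    \<open>r\<close>.\<close>
  let ?k = "\<lambda>x. max 0 (h x - r) * indicator {c..d} x"
  have ki: "integrable lborel ?k"
  proof (rule Bochner_Integration.integrable_bound)
    show "integrable lborel (\<lambda>x. \<bar>h x\<bar> + \<bar>r\<bar> * indicator {c..d} x)"
      using h by (intro Bochner_Integration.integrable_add integrable_abs integrable_mult_right
          integrable_real_indicator) (auto simp: emeasure_lborel_Icc_eq)
  qed (auto simp: indicator_def)
  define \<nu> where "\<nu> = density lborel ?k"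
  have \<nu>: "sets \<nu> = sets borel" by (simp add: \<nu>_def)
  have em\<nu>: "emeasure \<nu> B = ennreal (LINT x:B|lborel. ?k x)" if [measurable]: "B \<in> sets borel" for B
  proof -
    have "emeasure \<nu> B = (\<integral>\<^sup>+x. ennreal (?k x * indicator B x) \<partial>lborel)"
      unfolding \<nu>_def by (subst emeasure_density) (auto simp: indicator_def intro!: nn_integral_cong)
    also have "\<dots> = ennreal (\<integral>x. ?k x * indicator B x \<partial>lborel)"
      by (intro nn_integral_eq_integral integrable_real_mult_indicator ki) auto
    finally show ?thesis by (simp add: set_lebesgue_integral_def mult.commute)
  qed
  have fin: "finite_measure \<nu>"
    by (rule finite_measureI) (use em\<nu>[of UNIV] in \<open>simp add: \<nu>_def\<close>)
  then interpret \<nu>: finite_measure \<nu> .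
  have m\<nu>: "measure \<nu> B = (LINT x:B|lborel. ?k x)" if [measurable]: "B \<in> sets borel" for B
    using em\<nu>[OF that] by (simp add: measure_def set_lebesgue_integral_def integral_nonneg)
  let ?A = "{x. h x < r}"
  have A: "?A \<in> null_sets \<nu>"
  proof -
    have [measurable]: "?A \<in> sets borel" by measurable
    have "emeasure \<nu> ?A = ennreal (LINT x:?A|lborel. ?k x)" by (rule em\<nu>) measurable
    also have "(LINT x:?A|lborel. ?k x) = (LINT x:?A|lborel. 0)"
      by (intro set_lebesgue_integral_cong) auto
    finally show ?thesis by (auto simp: \<nu>)
  qed
  have step: "G b - G a \<le> r * (b - a) + measure \<nu> {a<..b}" if "c \<le> a" "a \<le> b" "b \<le> d" for a b
  proof -
    have i1: "set_integrable lborel {a<..b} (\<lambda>x. r)"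
      using that by (simp add: set_integrable_def emeasure_lborel_Ioc)
    have i2: "set_integrable lborel {a<..b} ?k"
      unfolding set_integrable_def by (intro integrable_mult_indicator ki) auto
    have i3: "set_integrable lborel {a<..b} h"
      unfolding set_integrable_def by (intro integrable_mult_indicator h) auto
    have "G b - G a = (LINT x:{a<..b}|lborel. h x)" using G that by simp
    also have "\<dots> \<le> (LINT x:{a<..b}|lborel. r + ?k x)"
      using that by (intro set_integral_mono i3 set_integral_add i1 i2) (auto simp: indicator_def)
    also have "\<dots> = (LINT x:{a<..b}|lborel. r) + (LINT x:{a<..b}|lborel. ?k x)"
      by (intro set_integral_add i1 i2)
    also have "\<dots> = r * (b - a) + measure \<nu> {a<..b}"
      using that by (subst m\<nu>) (auto simp: set_lebesgue_integral_def)
    finally show ?thesis .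
  qed
  show ?thesis
    using AE_lborel_measure_ball_small[OF fin \<nu> A]
  proof (rule AE_mp, intro AE_I2 impI allI)
    fix x t :: real
    assume H: "x \<in> ?A \<longrightarrow> (\<forall>t>0. \<forall>\<^sub>F s in at_right 0. measure \<nu> (ball x s) \<le> t * s)"
      and x: "c < x \<and> x < d \<and> h x < r" and t: "0 < t"
    \<comment> \<open>The half-open interval between \<open>x\<close> and \<open>x + s\<close> is
      placed in a ball of twice the radius, since the open ball of radius \<bar>s\<bar> misses the
      endpoint; \<open>t / 2\<close> pays for the factor 2.\<close>
    have "t / 2 > 0" using t by simp
    then have "\<forall>\<^sub>F s in at_right 0. measure \<nu> (ball x s) \<le> t / 2 * s" using H x by blast
    then obtain b where b: "b > 0" "\<And>s. 0 < s \<Longrightarrow> s < b \<Longrightarrow> measure \<nu> (ball x s) \<le> t / 2 * s"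
      unfolding eventually_at_right_field by auto
    have "(G (x + s) - G x) / s \<le> r + t"
      if s: "s \<noteq> 0" "\<bar>s\<bar> < b / 2" "\<bar>s\<bar> < x - c" "\<bar>s\<bar> < d - x" for s
    proof -
      have ball: "measure \<nu> (ball x (2 * \<bar>s\<bar>)) \<le> t * \<bar>s\<bar>" using b(2)[of "2 * \<bar>s\<bar>"] s by simp
      show ?thesis
      proof (cases "s > 0")
        case True
        have "measure \<nu> {x<..x+s} \<le> measure \<nu> (ball x (2 * \<bar>s\<bar>))"
          using True by (intro \<nu>.finite_measure_mono) (auto simp: \<nu> dist_real_def)
        then have "G (x + s) - G x \<le> (r + t) * s"
          using step[of x "x + s"] s True ball by (simp add: algebra_simps)
        then show ?thesis using True by (simp add: divide_le_eq)
      next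
        case False
        have "measure \<nu> {x+s<..x} \<le> measure \<nu> (ball x (2 * \<bar>s\<bar>))"
          using False s by (intro \<nu>.finite_measure_mono) (auto simp: \<nu> dist_real_def)
        then have "G x - G (x + s) \<le> (r + t) * (- s)"
          using step[of "x + s" x] s False ball by (simp add: algebra_simps)
        then show ?thesis using False s by (simp add: divide_le_eq algebra_simps)
      qed
    qed
    then show "\<forall>\<^sub>F s in at 0. (G (x + s) - G x) / s \<le> r + t"
      unfolding eventually_at
      using b x by (intro exI[of _ "min (b / 2) (min (x - c) (d - x))"]) auto
  qed
qed

text \<open>Upper bounds for \<open>h\<close> and for \<open>- h\<close> squeeze the difference
  quotient. Rational \<open>r\<close> keep the number of exceptional null sets countable.\<close>

theorem AE_has_derivative_of_integral:
  fixes h G :: "real \<Rightarrow> real"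
  assumes h: "integrable lborel h"
    and G: "\<And>a b. c \<le> a \<Longrightarrow> a \<le> b \<Longrightarrow> b \<le> d \<Longrightarrow> G b - G a = (LINT x:{a<..b}|lborel. h x)"
  shows "AE x in lborel. c < x \<and> x < d \<longrightarrow> (G has_real_derivative h x) (at x)"
proof -
  have hm: "integrable lborel (\<lambda>x. - h x)" using h by simp
  have Gm: "- G b - - G a = (LINT x:{a<..b}|lborel. - h x)" if "c \<le> a" "a \<le> b" "b \<le> d" for a b
    using G[OF that] by (simp add: set_lebesgue_integral_def)
  have "AE x in lborel. \<forall>r\<in>\<rat>. c < x \<and> x < d \<and> h x < r \<longrightarrow>
           (\<forall>t>0. \<forall>\<^sub>F s in at 0. (G (x + s) - G x) / s \<le> r + t)"
    by (rule AE_ball_countable') (use AE_upper_derivative_le[OF h G] countable_rat in auto)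
  moreover have "AE x in lborel. \<forall>r\<in>\<rat>. c < x \<and> x < d \<and> - h x < r \<longrightarrow>
           (\<forall>t>0. \<forall>\<^sub>F s in at 0. (- G (x + s) - - G x) / s \<le> r + t)"
    by (rule AE_ball_countable') (use AE_upper_derivative_le[OF hm Gm] countable_rat in auto)
  ultimately show ?thesis
  proof eventually_elim
    case (elim x)
    show ?case
    proof
      assume x: "c < x \<and> x < d"
      have "\<forall>\<^sub>F s in at 0. dist ((G (x + s) - G x) / s) (h x) < e" if e: "e > 0" for e
      proof -
        obtain r1 where r1: "r1 \<in> \<rat>" "h x < r1" "r1 < h x + e / 2"
          using Rats_dense_in_real[of "h x" "h x + e / 2"] e by auto
        obtain r2 where r2: "r2 \<in> \<rat>" "- h x < r2" "r2 < - h x + e / 2"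
          using Rats_dense_in_real[of "- h x" "- h x + e / 2"] e by auto
        have "\<forall>\<^sub>F s in at 0. (G (x + s) - G x) / s \<le> r1 + e / 2" using elim(1) r1 x e by auto
        moreover have "\<forall>\<^sub>F s in at 0. (- G (x + s) - - G x) / s \<le> r2 + e / 2"
          using elim(2) r2 x e by (auto simp del: minus_diff_eq)
        ultimately show ?thesis
        proof eventually_elim
          case (elim s)
          have "(- G (x + s) - - G x) / s = - ((G (x + s) - G x) / s)"
            by (metis minus_diff_minus minus_divide_left)
          then show ?case using elim r1 r2 by (simp add: dist_real_def abs_less_iff)
        qed
      qed
      then show "(G has_real_derivative h x) (at x)"
        unfolding DERIV_def by (rule tendstoI)
    qed
  qed
qed

section \<open>Borel measurability of pointwise derivatives\<close>

lemma differentiable_iff_Cauchy_quotient: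
  fixes g :: "real \<Rightarrow> real"
  shows "g differentiable (at x) \<longleftrightarrow>
    (\<forall>k::nat. \<exists>m::nat. \<forall>s t. 0 < \<bar>s\<bar> \<and> \<bar>s\<bar> < inverse (Suc m) \<and> 0 < \<bar>t\<bar> \<and> \<bar>t\<bar> < inverse (Suc m) \<longrightarrow>
       \<bar>(g (x + s) - g x) / s - (g (x + t) - g x) / t\<bar> \<le> inverse (Suc k))" (is "?L \<longleftrightarrow> ?R")
proof
  assume ?L
  then obtain D where "(g has_real_derivative D) (at x)"
    by (auto simp: real_differentiable_def)
  then have lim: "((\<lambda>s. (g (x + s) - g x) / s) \<longlongrightarrow> D) (at 0)" by (simp add: DERIV_def)
  show ?R
  proof
    fix k :: nat
    have "\<forall>\<^sub>F s in at 0. dist ((g (x + s) - g x) / s) D < inverse (Suc k) / 2"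
      using lim by (rule tendstoD) simp
    then obtain d where d: "d > 0" "\<And>s. s \<noteq> 0 \<Longrightarrow> \<bar>s\<bar> < d \<Longrightarrow> \<bar>(g (x + s) - g x) / s - D\<bar> < inverse (Suc k) / 2"
      by (auto simp: eventually_at dist_real_def)
    obtain m where m: "inverse (real (Suc m)) < d" using reals_Archimedean[OF d(1)] by auto
    show "\<exists>m::nat. \<forall>s t. 0 < \<bar>s\<bar> \<and> \<bar>s\<bar> < inverse (Suc m) \<and> 0 < \<bar>t\<bar> \<and> \<bar>t\<bar> < inverse (Suc m) \<longrightarrow>
       \<bar>(g (x + s) - g x) / s - (g (x + t) - g x) / t\<bar> \<le> inverse (Suc k)"
    proof (intro exI allI impI)
      fix s t assume "0 < \<bar>s\<bar> \<and> \<bar>s\<bar> < inverse (Suc m) \<and> 0 < \<bar>t\<bar> \<and> \<bar>t\<bar> < inverse (Suc m)"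
      then have "\<bar>(g (x + s) - g x) / s - D\<bar> < inverse (Suc k) / 2" "\<bar>(g (x + t) - g x) / t - D\<bar> < inverse (Suc k) / 2"
        using d(2)[of s] d(2)[of t] m by force+
      then show "\<bar>(g (x + s) - g x) / s - (g (x + t) - g x) / t\<bar> \<le> inverse (Suc k)" by linarith
    qed
  qed
next
  assume R: ?R
  define q where "q = (\<lambda>s. (g (x + s) - g x) / s)"
  have R: "\<exists>d>0. \<forall>s t. 0 < \<bar>s\<bar> \<and> \<bar>s\<bar> < d \<and> 0 < \<bar>t\<bar> \<and> \<bar>t\<bar> < d \<longrightarrow> \<bar>q s - q t\<bar> \<le> e" if "e > 0" for e
  proof -
    obtain k where k: "inverse (real (Suc k)) < e" using reals_Archimedean[OF \<open>e > 0\<close>] by auto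
    obtain m where m: "\<forall>s t. 0 < \<bar>s\<bar> \<and> \<bar>s\<bar> < inverse (Suc m) \<and> 0 < \<bar>t\<bar> \<and> \<bar>t\<bar> < inverse (Suc m) \<longrightarrow>
       \<bar>q s - q t\<bar> \<le> inverse (Suc k)"
      unfolding q_def using spec[OF R, of k] by (rule exE)
    show ?thesis
    proof (intro exI[of _ "inverse (real (Suc m))"] conjI allI impI)
      fix s t :: real
      assume "0 < \<bar>s\<bar> \<and> \<bar>s\<bar> < inverse (Suc m) \<and> 0 < \<bar>t\<bar> \<and> \<bar>t\<bar> < inverse (Suc m)"
      then have "\<bar>q s - q t\<bar> \<le> inverse (Suc k)" using m[THEN spec, THEN spec, of s t] by (rule mp[rotated])
      then show "\<bar>q s - q t\<bar> \<le> e" using k by linarith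
    qed simp
  qed
  have small: "\<exists>M. \<forall>n\<ge>M. inverse (real (Suc n)) < d" if "d > 0" for d
  proof -
    have "\<forall>\<^sub>F n in sequentially. inverse (real (Suc n)) < d"
      using LIMSEQ_inverse_real_of_nat that by (rule order_tendstoD)
    then show ?thesis by (simp add: eventually_sequentially)
  qed
  have "Cauchy (\<lambda>n. q (inverse (Suc n)))"
  proof (rule metric_CauchyI)
    fix e :: real assume "e > 0"
    then obtain d where d: "d > 0" "\<And>s t. 0 < \<bar>s\<bar> \<Longrightarrow> \<bar>s\<bar> < d \<Longrightarrow> 0 < \<bar>t\<bar> \<Longrightarrow> \<bar>t\<bar> < d \<Longrightarrow> \<bar>q s - q t\<bar> \<le> e / 2"
      using R[of "e / 2"] by auto
    obtain M where M: "\<And>n. n \<ge> M \<Longrightarrow> inverse (real (Suc n)) < d" using small[OF d(1)] by auto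
    have "dist (q (inverse (Suc m))) (q (inverse (Suc n))) < e" if "m \<ge> M" "n \<ge> M" for m n
      using d(2)[of "inverse (Suc m)" "inverse (Suc n)"] M[OF that(1)] M[OF that(2)] \<open>e > 0\<close>
      by (simp add: dist_real_def)
    then show "\<exists>M. \<forall>m\<ge>M. \<forall>n\<ge>M. dist (q (inverse (Suc m))) (q (inverse (Suc n))) < e" by blast
  qed
  \<comment> \<open>Completeness gives the limit along 1 / (n + 1); the Cauchy condition then
    carries it to all \<open>s\<close> tending to 0.\<close>
  then obtain D where D: "(\<lambda>n. q (inverse (Suc n))) \<longlonglongrightarrow> D"
    using Cauchy_convergent convergent_def by blast
  have "(q \<longlongrightarrow> D) (at 0)"
  proof (rule tendstoI)
    fix e :: real assume "e > 0"
    then obtain d where d: "d > 0" "\<And>s t. 0 < \<bar>s\<bar> \<Longrightarrow> \<bar>s\<bar> < d \<Longrightarrow> 0 < \<bar>t\<bar> \<Longrightarrow> \<bar>t\<bar> < d \<Longrightarrow> \<bar>q s - q t\<bar> \<le> e / 2"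
      using R[of "e / 2"] by auto
    obtain M where M: "\<And>n. n \<ge> M \<Longrightarrow> inverse (real (Suc n)) < d" using small[OF d(1)] by auto
    have "dist (q s) D < e" if s: "s \<noteq> 0" "\<bar>s\<bar> < d" for s
    proof -
      have "\<bar>q s - D\<bar> \<le> e / 2"
      proof (rule LIMSEQ_le_const2)
        show "(\<lambda>n. \<bar>q s - q (inverse (Suc n))\<bar>) \<longlonglongrightarrow> \<bar>q s - D\<bar>" by (intro tendsto_intros D)
        show "\<exists>M. \<forall>n\<ge>M. \<bar>q s - q (inverse (Suc n))\<bar> \<le> e / 2" 
        proof (intro exI allI impI)
          fix n assume "n \<ge> M"
          then show "\<bar>q s - q (inverse (Suc n))\<bar> \<le> e / 2" 
            using d(2)[of s "inverse (Suc n)"] M[of n] s by simp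
        qed
      qed
      then show ?thesis using \<open>e > 0\<close> by (simp add: dist_real_def)
    qed
    then show "\<forall>\<^sub>F s in at 0. dist (q s) D < e"
      unfolding eventually_at using d(1) by (intro exI[of _ d]) auto
  qed
  then have "(g has_real_derivative D) (at x)" by (simp add: DERIV_def q_def)
  then show ?L by (auto simp: real_differentiable_def)
qed

text \<open>The outer quantifiers of the Cauchy criterion are countable, and for continuous
  \<open>g\<close> the inner condition, over uncountably many \<open>s\<close> and \<open>t\<close>,
  defines an intersection of closed sets.\<close>

lemma borel_measurable_deriv_of_continuous:
  fixes g :: "real \<Rightarrow> real"
  assumes g: "continuous_on UNIV g"
  shows "deriv g \<in> borel_measurable borel"
proof -
  let ?C = "\<lambda>k m :: nat. {x. \<forall>s t. 0 < \<bar>s\<bar> \<and> \<bar>s\<bar> < inverse (Suc m) \<and> 0 < \<bar>t\<bar> \<and> \<bar>t\<bar> < inverse (Suc m) \<longrightarrow>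
       \<bar>(g (x + s) - g x) / s - (g (x + t) - g x) / t\<bar> \<le> inverse (Suc k)}"
  have cg[continuous_intros]: "continuous_on A (\<lambda>x. g (h x))" if "continuous_on A h" for A :: "real set" and h
    using continuous_on_compose2[OF g that] by simp
  have "closed (?C k m)" for k m
  proof -
    let ?I = "{s. 0 < \<bar>s\<bar> \<and> \<bar>s\<bar> < inverse (real (Suc m))}"
    have "?C k m = (\<Inter>s\<in>?I. \<Inter>t\<in>?I. {x. \<bar>(g (x + s) - g x) / s - (g (x + t) - g x) / t\<bar> \<le> inverse (Suc k)})"
      by auto
    also have "closed \<dots>"
      by (intro closed_INT ballI closed_Collect_le continuous_intros) auto
    finally show ?thesis .
  qed
  then have [measurable]: "?C k m \<in> sets borel" for k m by (rule borel_closed)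
  have "{x. g differentiable (at x)} = (\<Inter>k. \<Union>m. ?C k m)"
    unfolding differentiable_iff_Cauchy_quotient by blast
  also have "\<dots> \<in> sets borel" by measurable
  finally have D[measurable]: "{x. g differentiable (at x)} \<in> sets borel" .
  have gb[measurable]: "g \<in> borel_measurable borel" using g by (rule borel_measurable_continuous_onI)
  \<comment> \<open>\<open>deriv\<close> is a choice among the possible derivatives. Where none
    exists the predicate is constantly false, so the chosen value is the same at all those
    points.\<close>
  have eq: "deriv g = (\<lambda>x. if x \<in> {x. g differentiable (at x)}
      then lim (\<lambda>n. (g (x + inverse (Suc n)) - g x) / inverse (Suc n)) else (SOME D. False))"
  proof
    fix x
    show "deriv g x = (if x \<in> {x. g differentiable (at x)}
      then lim (\<lambda>n. (g (x + inverse (Suc n)) - g x) / inverse (Suc n)) else (SOME D. False))"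
    proof (cases "g differentiable (at x)")
      case True
      then have "(g has_real_derivative deriv g x) (at x)"
        using DERIV_deriv_iff_real_differentiable by blast
      then have "((\<lambda>s. (g (x + s) - g x) / s) \<longlongrightarrow> deriv g x) (at 0)" by (simp add: DERIV_def)
      moreover have "filterlim (\<lambda>n. inverse (real (Suc n))) (at 0) sequentially"
        using LIMSEQ_inverse_real_of_nat by (rule filterlim_atI) simp
      ultimately have "(\<lambda>n. (g (x + inverse (Suc n)) - g x) / inverse (Suc n)) \<longlonglongrightarrow> deriv g x"
        by (rule filterlim_compose)
      then show ?thesis using True by (simp add: limI)
    next
      case False
      then have "\<And>D. (g has_real_derivative D) (at x) \<longleftrightarrow> False" by (auto simp: real_differentiable_def)
      then show ?thesis using False by (simp add: deriv_def)
    qed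
  qed
  show ?thesis unfolding eq by measurable
qed

section \<open>Absolutely continuous functions are indefinite integrals\<close>

text \<open>Degenerate pairs are allowed, as in \<open>abs_continuous_fun\<close>, so that monotone
  maps that collapse segments stay inside the class.\<close>

definition segments :: "(real \<times> real) set \<Rightarrow> bool" where
  "segments S \<longleftrightarrow> finite S \<and> (\<forall>(a, b)\<in>S. a \<le> b) \<and> disjoint_family_on (\<lambda>(a, b). {a<..b}) S"

lemma abs_continuous_fun_iff:
  "abs_continuous_fun g \<longleftrightarrow> (\<forall>\<epsilon>>0. \<exists>\<delta>>0. \<forall>S. segments S \<longrightarrow> (\<Sum>(a, b)\<in>S. b - a) < \<delta> \<longrightarrow>
     (\<Sum>(a, b)\<in>S. \<bar>g b - g a\<bar>) < \<epsilon>)"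
  unfolding abs_continuous_fun_def segments_def by (simp only: imp_conjL)

lemma abs_continuous_funD:
  assumes "abs_continuous_fun g" "\<epsilon> > 0"
  obtains \<delta> where "\<delta> > 0"
    "\<And>S. segments S \<Longrightarrow> (\<Sum>(a, b)\<in>S. b - a) < \<delta> \<Longrightarrow> (\<Sum>(a, b)\<in>S. \<bar>g b - g a\<bar>) < \<epsilon>"
  using assms unfolding abs_continuous_fun_iff by blast

lemma abs_continuous_funI:
  assumes "\<And>\<epsilon>. \<epsilon> > 0 \<Longrightarrow> \<exists>\<delta>>0. \<forall>S. segments S \<longrightarrow> (\<Sum>(a, b)\<in>S. b - a) < \<delta> \<longrightarrow> (\<Sum>(a, b)\<in>S. \<bar>g b - g a\<bar>) < \<epsilon>"
  shows "abs_continuous_fun g"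
  using assms unfolding abs_continuous_fun_iff by blast

lemma segments_ordered:
  assumes "segments S" "(a, b) \<in> S" "(c, d) \<in> S" "(a, b) \<noteq> (c, d)" "a < b" "c < d"
  shows "b \<le> c \<or> d \<le> a"
proof -
  have "{a<..b} \<inter> {c<..d} = {}"
    using assms(1-4) unfolding segments_def disjoint_family_on_def by fastforce
  \<comment> \<open>Overlapping nonempty intervals of this form both contain the smaller right
    endpoint.\<close>
  then have "min b d \<notin> {a<..b} \<inter> {c<..d}" by blast
  then show ?thesis using assms(5,6) by (auto simp: min_def split: if_splits)
qed

lemma segments_le: "segments S \<Longrightarrow> (a, b) \<in> S \<Longrightarrow> a \<le> b"
  by (auto simp: segments_def)

lemma segments_finite: "segments S \<Longrightarrow> finite S"
  by (simp add: segments_def)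

lemma segments_subset: "segments S \<Longrightarrow> T \<subseteq> S \<Longrightarrow> segments T"
  unfolding segments_def by (blast intro: finite_subset disjoint_family_on_mono)

lemma segments_image:
  assumes "mono k" "segments S"
  shows "segments ((\<lambda>(a, b). (k a, k b)) ` S)"
  unfolding segments_def
proof (intro conjI)
  show "finite ((\<lambda>(a, b). (k a, k b)) ` S)" using segments_finite[OF assms(2)] by simp
  show "\<forall>(a, b)\<in>(\<lambda>(a, b). (k a, k b)) ` S. a \<le> b"
    using segments_le[OF assms(2)] assms(1) by (auto dest: monoD)
  show "disjoint_family_on (\<lambda>(a, b). {a<..b}) ((\<lambda>(a, b). (k a, k b)) ` S)"
    unfolding disjoint_family_on_def
  proof (intro ballI impI)
    fix p q assume pq: "p \<in> (\<lambda>(a, b). (k a, k b)) ` S" "q \<in> (\<lambda>(a, b). (k a, k b)) ` S" "p \<noteq> q"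
    then obtain a b c d where S: "(a, b) \<in> S" "(c, d) \<in> S" and [simp]: "p = (k a, k b)" "q = (k c, k d)"
      by auto
    have ne: "k a = k c \<longrightarrow> k b \<noteq> k d" using pq(3) by auto
    show "(case p of (a, b) \<Rightarrow> {a<..b}) \<inter> (case q of (a, b) \<Rightarrow> {a<..b}) = {}"
    proof (cases "a < b \<and> c < d")
      case True
      then have "b \<le> c \<or> d \<le> a" using segments_ordered[OF assms(2) S] ne by auto
      then have "k b \<le> k c \<or> k d \<le> k a" using monoD[OF assms(1)] by blast
      then show ?thesis by auto
    next
      case False
      then have "a = b \<or> c = d" using segments_le[OF assms(2)] S by force
      then show ?thesis by auto
    qed
  qed
qed

text \<open>A monotone map can send two distinct pairs to the same pair, but then this pair is
  degenerate, so the terms lost in the image have weight 0.\<close>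

lemma sum_segments_image:
  fixes F :: "real \<Rightarrow> real \<Rightarrow> real"
  assumes "mono k" "segments S" "\<And>x. F x x = 0"
  shows "(\<Sum>(a, b)\<in>(\<lambda>(a, b). (k a, k b)) ` S. F a b) = (\<Sum>(a, b)\<in>S. F (k a) (k b))"
proof -
  have "(\<Sum>(a, b)\<in>(\<lambda>(a, b). (k a, k b)) ` S. F a b) = sum ((\<lambda>(a, b). F a b) \<circ> (\<lambda>(a, b). (k a, k b))) S"
  proof (rule sum.reindex_nontrivial)
    show "finite S" using segments_finite[OF assms(2)] .
    fix p q assume pq: "p \<in> S" "q \<in> S" "p \<noteq> q" "(case p of (a, b) \<Rightarrow> (k a, k b)) = (case q of (a, b) \<Rightarrow> (k a, k b))"
    obtain a b c d where [simp]: "p = (a, b)" "q = (c, d)" by (meson surj_pair)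
    have eq: "k a = k c" "k b = k d" using pq by auto
    have "k a = k b"
    proof (cases "a < b \<and> c < d")
      case True
      then have "b \<le> c \<or> d \<le> a"
        using segments_ordered[OF assms(2), of a b c d] pq(1-3) by simp
      then have "k b \<le> k c \<or> k d \<le> k a" using monoD[OF assms(1)] by blast
      moreover have "k a \<le> k b" using True monoD[OF assms(1), of a b] by simp
      ultimately show ?thesis using eq by linarith
    next
      case False
      then have "a = b \<or> c = d" using segments_le[OF assms(2)] pq by force
      then show ?thesis using eq by auto
    qed
    then show "(case (case p of (a, b) \<Rightarrow> (k a, k b)) of (a, b) \<Rightarrow> F a b) = 0"
      using assms(3) by simp
  qed
  then show ?thesis by (simp add: comp_def case_prod_unfold)
qed

text \<open>Made for the clamp onto a compact interval, which is monotone and does not lengthen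
  segments.\<close>

lemma abs_continuous_fun_compose:
  assumes g: "abs_continuous_fun g" and k: "mono k" and lip: "\<And>x y. x \<le> y \<Longrightarrow> k y - k x \<le> y - x"
  shows "abs_continuous_fun (\<lambda>x. g (k x))"
proof (rule abs_continuous_funI)
  fix \<epsilon> :: real assume "\<epsilon> > 0"
  obtain \<delta> where \<delta>: "\<delta> > 0" "\<And>S. segments S \<Longrightarrow> (\<Sum>(a, b)\<in>S. b - a) < \<delta> \<Longrightarrow> (\<Sum>(a, b)\<in>S. \<bar>g b - g a\<bar>) < \<epsilon>"
    using abs_continuous_funD[OF g \<open>\<epsilon> > 0\<close>] by blast
  have main: "(\<Sum>(a, b)\<in>S. \<bar>g (k b) - g (k a)\<bar>) < \<epsilon>" if S: "segments S" "(\<Sum>(a, b)\<in>S. b - a) < \<delta>" for S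
  proof -
    have "(\<Sum>(a, b)\<in>(\<lambda>(a, b). (k a, k b)) ` S. b - a) = (\<Sum>(a, b)\<in>S. k b - k a)"
      by (rule sum_segments_image[OF k S(1)]) simp
    also have "\<dots> \<le> (\<Sum>(a, b)\<in>S. b - a)"
      by (rule sum_mono) (use lip segments_le[OF S(1)] in auto)
    finally have "(\<Sum>(a, b)\<in>(\<lambda>(a, b). (k a, k b)) ` S. \<bar>g b - g a\<bar>) < \<epsilon>"
      using S(2) by (intro \<delta>(2) segments_image k S(1)) simp
    also have "(\<Sum>(a, b)\<in>(\<lambda>(a, b). (k a, k b)) ` S. \<bar>g b - g a\<bar>) = (\<Sum>(a, b)\<in>S. \<bar>g (k b) - g (k a)\<bar>)"
      by (rule sum_segments_image[OF k S(1)]) simp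
    finally show ?thesis .
  qed
  show "\<exists>\<delta>>0. \<forall>S. segments S \<longrightarrow> (\<Sum>(a, b)\<in>S. b - a) < \<delta> \<longrightarrow> (\<Sum>(a, b)\<in>S. \<bar>g (k b) - g (k a)\<bar>) < \<epsilon>"
    by (intro exI[of _ \<delta>] conjI allI impI main \<delta>(1))
qed

lemma abs_continuous_fun_diff:
  assumes f: "abs_continuous_fun f" and g: "abs_continuous_fun g"
  shows "abs_continuous_fun (\<lambda>x. f x - g x)"
proof (rule abs_continuous_funI)
  fix \<epsilon> :: real assume "\<epsilon> > 0"
  then have e: "\<epsilon> / 2 > 0" by simp
  obtain d1 where d1: "d1 > 0" "\<And>S. segments S \<Longrightarrow> (\<Sum>(a, b)\<in>S. b - a) < d1 \<Longrightarrow> (\<Sum>(a, b)\<in>S. \<bar>f b - f a\<bar>) < \<epsilon> / 2"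
    using abs_continuous_funD[OF f e] by blast
  obtain d2 where d2: "d2 > 0" "\<And>S. segments S \<Longrightarrow> (\<Sum>(a, b)\<in>S. b - a) < d2 \<Longrightarrow> (\<Sum>(a, b)\<in>S. \<bar>g b - g a\<bar>) < \<epsilon> / 2"
    using abs_continuous_funD[OF g e] by blast
  have main: "(\<Sum>(a, b)\<in>S. \<bar>(f b - g b) - (f a - g a)\<bar>) < \<epsilon>"
    if S: "segments S" "(\<Sum>(a, b)\<in>S. b - a) < min d1 d2" for S
  proof -
    have "(\<Sum>(a, b)\<in>S. \<bar>(f b - g b) - (f a - g a)\<bar>) \<le> (\<Sum>(a, b)\<in>S. \<bar>f b - f a\<bar> + \<bar>g b - g a\<bar>)"
      by (rule sum_mono) auto
    also have "\<dots> = (\<Sum>(a, b)\<in>S. \<bar>f b - f a\<bar>) + (\<Sum>(a, b)\<in>S. \<bar>g b - g a\<bar>)"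
      by (simp add: case_prod_unfold sum.distrib)
    finally show ?thesis using d1(2)[OF S(1)] d2(2)[OF S(1)] S(2) by simp
  qed
  have "min d1 d2 > 0" using d1(1) d2(1) by simp
  then show "\<exists>\<delta>>0. \<forall>S. segments S \<longrightarrow> (\<Sum>(a, b)\<in>S. b - a) < \<delta> \<longrightarrow> (\<Sum>(a, b)\<in>S. \<bar>(f b - g b) - (f a - g a)\<bar>) < \<epsilon>"
    by (intro exI[of _ "min d1 d2"] conjI allI impI main)
qed

lemma abs_continuous_fun_imp_continuous:
  assumes g: "abs_continuous_fun g"
  shows "continuous_on UNIV g"
  unfolding continuous_on_iff
proof (intro ballI allI impI)
  fix x \<epsilon> :: real assume "\<epsilon> > 0"
  obtain \<delta> where \<delta>: "\<delta> > 0" "\<And>S. segments S \<Longrightarrow> (\<Sum>(a, b)\<in>S. b - a) < \<delta> \<Longrightarrow> (\<Sum>(a, b)\<in>S. \<bar>g b - g a\<bar>) < \<epsilon>"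
    using abs_continuous_funD[OF g \<open>\<epsilon> > 0\<close>] by blast
  have *: "\<bar>g v - g u\<bar> < \<epsilon>" if "u \<le> v" "v - u < \<delta>" for u v
    using \<delta>(2)[of "{(u, v)}"] that by (simp add: segments_def disjoint_family_on_def)
  have "dist (g y) (g x) < \<epsilon>" if "dist y x < \<delta>" for y
    using *[of x y] *[of y x] that by (cases "x \<le> y") (auto simp: dist_real_def abs_minus_commute)
  with \<delta>(1) show "\<exists>d>0. \<forall>x'\<in>UNIV. dist x' x < d \<longrightarrow> dist (g x') (g x) < \<epsilon>" by blast
qed

section \<open>Lengths and variation on compact intervals\<close>

lemma sum_length_segments:
  assumes S: "segments S" and A: "A \<in> sets lborel" "emeasure lborel A < \<infinity>" "\<And>a b. (a, b) \<in> S \<Longrightarrow> {a<..b} \<subseteq> A"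
  shows "(\<Sum>(a, b)\<in>S. b - a) \<le> measure lborel A"
proof -
  have "(\<Sum>(a, b)\<in>S. b - a) = (\<Sum>p\<in>S. measure lborel (case p of (a, b) \<Rightarrow> {a<..b}))"
    by (rule sum.cong) (use segments_le[OF S] in auto)
  also have "\<dots> = measure lborel (\<Union>p\<in>S. case p of (a, b) \<Rightarrow> {a<..b})"
    using S by (intro measure_finite_Union[symmetric]) (auto simp: segments_def emeasure_lborel_Ioc)
  also have "\<dots> \<le> measure lborel A"
    using A by (intro measure_mono_fmeasurable) (auto simp: fmeasurable_def intro!: sets.finite_UN segments_finite[OF S])
  finally show ?thesis .
qed

text \<open>Clamping the endpoints replaces cutting the family: a family anywhere on the line is
  tested on \<open>{c..d}\<close> without being changed. A piece shorter than \<delta> contributes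
  at most 1, and finitely many pieces fill the interval.\<close>

lemma abs_continuous_fun_bounded_variation:
  assumes g: "abs_continuous_fun g" and cd: "c \<le> d"
  shows "\<exists>B. \<forall>S. segments S \<longrightarrow> (\<Sum>(a, b)\<in>S. \<bar>g (max c (min b d)) - g (max c (min a d))\<bar>) \<le> B"
proof -
  let ?k = "\<lambda>c d x. max c (min x d) :: real"
  have k: "mono (?k c d)" for c d by (intro monoI) auto
  obtain \<delta> where \<delta>: "\<delta> > 0" "\<And>S. segments S \<Longrightarrow> (\<Sum>(a, b)\<in>S. b - a) < \<delta> \<Longrightarrow> (\<Sum>(a, b)\<in>S. \<bar>g b - g a\<bar>) < 1"
    using abs_continuous_funD[OF g, of 1] by auto
  have short: "(\<Sum>(a, b)\<in>S. \<bar>g (?k u v b) - g (?k u v a)\<bar>) \<le> 1" if uv: "u \<le> v" "v - u < \<delta>" and S: "segments S" for u v S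
  proof -
    let ?S = "(\<lambda>(a, b). (?k u v a, ?k u v b)) ` S"
    have "(\<Sum>(a, b)\<in>?S. b - a) \<le> measure lborel {u<..v}"
      by (rule sum_length_segments) (use segments_image[OF k S] uv in \<open>auto simp: emeasure_lborel_Ioc\<close>)
    then have "(\<Sum>(a, b)\<in>?S. \<bar>g b - g a\<bar>) < 1"
      using uv by (intro \<delta>(2) segments_image[OF k S]) simp
    then show ?thesis using sum_segments_image[OF k S, of "\<lambda>a b. \<bar>g b - g a\<bar>" u v] by simp
  qed
  have main: "\<exists>B. \<forall>S. segments S \<longrightarrow> (\<Sum>(a, b)\<in>S. \<bar>g (?k c d b) - g (?k c d a)\<bar>) \<le> B"
    if "c \<le> d" "d \<le> c + real n * (\<delta> / 2)" for n d
    using that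
  proof (induction n arbitrary: d)
    case 0
    then have "d = c" by simp
    then show ?case by (intro exI[of _ 0]) (auto intro: sum_nonpos)
  next
    case (Suc n)
    \<comment> \<open>Half of \<delta> keeps the last piece strictly shorter than \<delta>; the
      maximum handles a remainder shorter than that half.\<close>
    define e where "e = max c (d - \<delta> / 2)"
    have e: "c \<le> e" "e \<le> d" "d - e < \<delta>" "e \<le> c + real n * (\<delta> / 2)"
      using Suc.prems \<delta>(1) by (auto simp: e_def max_def field_simps)
    obtain B where B: "\<And>S. segments S \<Longrightarrow> (\<Sum>(a, b)\<in>S. \<bar>g (?k c e b) - g (?k c e a)\<bar>) \<le> B"
      using Suc.IH[OF e(1,4)] by blast
    \<comment> \<open>At any \<open>x\<close>, one of the two clamps on the right sits at
      \<open>e\<close>, so clamped increments add up.\<close>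
    have gk: "g (?k c d x) = g (?k c e x) + g (?k e d x) - g e" for x
      using e(1,2) by (auto simp: max_def min_def)
    have "(\<Sum>(a, b)\<in>S. \<bar>g (?k c d b) - g (?k c d a)\<bar>) \<le> B + 1" if S: "segments S" for S
    proof -
      have "(\<Sum>(a, b)\<in>S. \<bar>g (?k c d b) - g (?k c d a)\<bar>)
          \<le> (\<Sum>(a, b)\<in>S. \<bar>g (?k c e b) - g (?k c e a)\<bar> + \<bar>g (?k e d b) - g (?k e d a)\<bar>)"
        unfolding gk by (rule sum_mono) (clarsimp, linarith)
      also have "\<dots> = (\<Sum>(a, b)\<in>S. \<bar>g (?k c e b) - g (?k c e a)\<bar>) + (\<Sum>(a, b)\<in>S. \<bar>g (?k e d b) - g (?k e d a)\<bar>)"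
        by (simp add: case_prod_unfold sum.distrib)
      finally show ?thesis using B[OF S] short[OF e(2,3) S] by simp
    qed
    then show ?case by blast
  qed
  obtain n :: nat where "d - c < real n * (\<delta> / 2)"
    using ex_less_of_nat_mult[of "\<delta> / 2" "d - c"] \<delta>(1) by auto
  then show ?thesis by (intro main[OF cd, of n]) simp
qed

text \<open>The family may lie anywhere to the left of \<open>x\<close>, so this is only meaningful for functions of
  bounded variation on the whole line; absolutely continuous functions are first frozen outside a
  compact interval.\<close>

definition pos_variation :: "(real \<Rightarrow> real) \<Rightarrow> real \<Rightarrow> real" where
  "pos_variation g x = (SUP S\<in>{S. segments S \<and> (\<forall>(a, b)\<in>S. b \<le> x)}. (\<Sum>(a, b)\<in>S. g b - g a))"

context
  fixes g :: "real \<Rightarrow> real" and B :: real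
  assumes bdd: "\<And>S. segments S \<Longrightarrow> (\<Sum>(a, b)\<in>S. \<bar>g b - g a\<bar>) \<le> B"
begin

lemma sum_le_pos_variation:
  assumes "segments S" "\<And>a b. (a, b) \<in> S \<Longrightarrow> b \<le> x"
  shows "(\<Sum>(a, b)\<in>S. g b - g a) \<le> pos_variation g x"
  unfolding pos_variation_def
proof (rule cSUP_upper)
  have "(\<Sum>(a, b)\<in>S. g b - g a) \<le> B" if "segments S" for S
    by (rule order_trans[OF sum_mono bdd[OF that]]) auto
  then show "bdd_above ((\<lambda>S. \<Sum>(a, b)\<in>S. g b - g a) ` {S. segments S \<and> (\<forall>(a, b)\<in>S. b \<le> x)})"
    by (intro bdd_aboveI[of _ B]) auto
qed (use assms in auto)

lemma pos_variation_approx: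
  assumes "e > 0"
  obtains S where "segments S" "\<And>a b. (a, b) \<in> S \<Longrightarrow> b \<le> x" "pos_variation g x - e < (\<Sum>(a, b)\<in>S. g b - g a)"
proof -
  have le: "(\<Sum>(a, b)\<in>S. g b - g a) \<le> B" if "segments S" for S
    by (rule order_trans[OF sum_mono bdd[OF that]]) auto
  let ?X = "{S. segments S \<and> (\<forall>(a, b)\<in>S. b \<le> x)}"
  have "{} \<in> ?X" by (simp add: segments_def disjoint_family_on_def)
  moreover have "bdd_above ((\<lambda>S. \<Sum>(a, b)\<in>S. g b - g a) ` ?X)"
    using le by (intro bdd_aboveI[of _ B]) auto
  moreover have "pos_variation g x - e < (SUP S\<in>?X. \<Sum>(a, b)\<in>S. g b - g a)"
    using assms by (simp add: pos_variation_def)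
  ultimately have "\<exists>S\<in>?X. pos_variation g x - e < (\<Sum>(a, b)\<in>S. g b - g a)"
    by (subst less_cSUP_iff[symmetric]) auto
  then show ?thesis using that by blast
qed

lemma pos_variation_bounds: "0 \<le> pos_variation g x" "pos_variation g x \<le> B"
proof -
  show "0 \<le> pos_variation g x"
    using sum_le_pos_variation[of "{}" x] by (simp add: segments_def disjoint_family_on_def)
  show "pos_variation g x \<le> B"
  proof (rule field_le_epsilon)
    fix e :: real assume "e > 0"
    then obtain S where S: "segments S" "pos_variation g x - e < (\<Sum>(a, b)\<in>S. g b - g a)"
      using pos_variation_approx by blast
    have "(\<Sum>(a, b)\<in>S. g b - g a) \<le> B"
      by (rule order_trans[OF sum_mono bdd[OF S(1)]]) auto
    then show "pos_variation g x \<le> B + e" using S(2) by simp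
  qed
qed

text \<open>The two alternatives of the maximum make \<open>pos_variation g\<close> and its
  difference with \<open>g\<close> monotone, which is the Jordan decomposition.\<close>

lemma pos_variation_increment:
  assumes "x < y"
  shows "pos_variation g x + max 0 (g y - g x) \<le> pos_variation g y"
proof (rule field_le_epsilon)
  fix e :: real assume "e > 0"
  then obtain S where S: "segments S" "\<And>a b. (a, b) \<in> S \<Longrightarrow> b \<le> x" "pos_variation g x - e < (\<Sum>(a, b)\<in>S. g b - g a)"
    using pos_variation_approx by blast
  have new: "(x, y) \<notin> S" using S(2) assms by force
  have "segments (insert (x, y) S)"
    using S(1) assms unfolding segments_def disjoint_family_on_def by (auto dest!: S(2))
  then have "(\<Sum>(a, b)\<in>insert (x, y) S. g b - g a) \<le> pos_variation g y"
    using S(2) assms by (intro sum_le_pos_variation) force+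
  then have "g y - g x + (\<Sum>(a, b)\<in>S. g b - g a) \<le> pos_variation g y"
    using new segments_finite[OF S(1)] by simp
  moreover have "(\<Sum>(a, b)\<in>S. g b - g a) \<le> pos_variation g y"
    using S assms by (intro sum_le_pos_variation) force+
  ultimately show "pos_variation g x + max 0 (g y - g x) \<le> pos_variation g y + e"
    using S(3) by (auto simp: max_def)
qed

text \<open>A nearly optimal family below \<open>y\<close> is cut at \<open>x\<close>; the left
  parts compete for \<open>pos_variation g x\<close>, so the right parts carry the increment up to
  \<open>e\<close>.\<close>

lemma pos_variation_local:
  assumes "x \<le> y" "e > 0"
  shows "\<exists>S. segments S \<and> (\<forall>(a, b)\<in>S. x \<le> a \<and> a < b \<and> b \<le> y) \<and>
           pos_variation g y - pos_variation g x - e \<le> (\<Sum>(a, b)\<in>S. g b - g a)"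
proof -
  obtain S where S: "segments S" "\<And>a b. (a, b) \<in> S \<Longrightarrow> b \<le> y" "pos_variation g y - e < (\<Sum>(a, b)\<in>S. g b - g a)"
    using pos_variation_approx[OF assms(2)] by blast
  let ?L = "(\<lambda>(a, b). (min a x, min b x)) ` S" and ?R = "(\<lambda>(a, b). (max a x, max b x)) ` S"
  have mono: "mono (\<lambda>a. min a x)" "mono (\<lambda>a. max a x)" by (auto intro!: monoI)
  note L = segments_image[OF mono(1) S(1)] and R = segments_image[OF mono(2) S(1)]
  have "(\<Sum>(a, b)\<in>S. g b - g a) = (\<Sum>(a, b)\<in>S. (g (min b x) - g (min a x)) + (g (max b x) - g (max a x)))"
    by (rule sum.cong) (auto simp: min_def max_def)
  also have "\<dots> = (\<Sum>(a, b)\<in>S. g (min b x) - g (min a x)) + (\<Sum>(a, b)\<in>S. g (max b x) - g (max a x))"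
    by (simp add: case_prod_unfold sum.distrib)
  also have "(\<Sum>(a, b)\<in>S. g (min b x) - g (min a x)) = (\<Sum>(a, b)\<in>?L. g b - g a)"
    by (rule sum_segments_image[OF mono(1) S(1), symmetric]) simp
  also have "(\<Sum>(a, b)\<in>S. g (max b x) - g (max a x)) = (\<Sum>(a, b)\<in>?R. g b - g a)"
    by (rule sum_segments_image[OF mono(2) S(1), symmetric]) simp
  \<comment> \<open>Degenerate pairs are dropped because families chosen in different segments must
    later be disjoint as sets of pairs, and a pair \<open>(a, a)\<close> at a common endpoint could
    belong to two of them.\<close>
  also have "(\<Sum>(a, b)\<in>?R. g b - g a) = (\<Sum>(a, b)\<in>{(a, b). (a, b) \<in> ?R \<and> a < b}. g b - g a)"
  proof (rule sum.mono_neutral_right)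
    show "finite ?R" by (rule segments_finite[OF R])
    show "\<forall>p\<in>?R - {(a, b). (a, b) \<in> ?R \<and> a < b}. (case p of (a, b) \<Rightarrow> g b - g a) = 0"
    proof
      fix p assume p: "p \<in> ?R - {(a, b). (a, b) \<in> ?R \<and> a < b}"
      obtain a b where [simp]: "p = (a, b)" by (cases p)
      have "(a, b) \<in> ?R" "\<not> a < b" using p by simp_all
      then have "a = b" using segments_le[OF R, of a b] by linarith
      then show "(case p of (a, b) \<Rightarrow> g b - g a) = 0" by simp
    qed
  qed blast
  also have "(\<Sum>(a, b)\<in>?L. g b - g a) \<le> pos_variation g x"
    by (rule sum_le_pos_variation[OF L]) auto
  finally have "pos_variation g y - pos_variation g x - e \<le> (\<Sum>(a, b)\<in>{(a, b). (a, b) \<in> ?R \<and> a < b}. g b - g a)"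
    using S(3) by simp
  moreover have "segments {(a, b). (a, b) \<in> ?R \<and> a < b}" by (rule segments_subset[OF R]) auto
  moreover have "\<forall>(a, b)\<in>{(a, b). (a, b) \<in> ?R \<and> a < b}. x \<le> a \<and> a < b \<and> b \<le> y"
    using S(2) assms(1) by auto
  ultimately show ?thesis by blast
qed

text \<open>Increments over \<open>S\<close> are nearly attained by finer families inside its
  segments. Their union is again a disjoint family with total length at most that of
  \<open>S\<close>, so the \<delta> that \<open>g\<close> has for \<epsilon> / 2 serves.\<close>

lemma abs_continuous_fun_pos_variation:
  assumes g: "abs_continuous_fun g"
  shows "abs_continuous_fun (pos_variation g)"
proof (rule abs_continuous_funI)
  fix \<epsilon> :: real assume \<epsilon>: "\<epsilon> > 0"
  then have "\<epsilon> / 2 > 0" by simp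
  obtain \<delta> where \<delta>: "\<delta> > 0" "\<And>S. segments S \<Longrightarrow> (\<Sum>(a, b)\<in>S. b - a) < \<delta> \<Longrightarrow> (\<Sum>(a, b)\<in>S. \<bar>g b - g a\<bar>) < \<epsilon> / 2"
    using abs_continuous_funD[OF g \<open>\<epsilon> / 2 > 0\<close>] by blast
  have main: "(\<Sum>(a, b)\<in>S. \<bar>pos_variation g b - pos_variation g a\<bar>) < \<epsilon>"
    if S: "segments S" "(\<Sum>(a, b)\<in>S. b - a) < \<delta>" for S
  proof -
    \<comment> \<open>One error \<open>e\<close> per segment adds up to less than \<epsilon> / 2;
      the added 1 covers an empty \<open>S\<close>.\<close>
    define e where "e = \<epsilon> / (2 * (real (card S) + 1))"
    have e: "e > 0" using \<epsilon> by (simp add: e_def)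
    have ecard: "real (card S) * e < \<epsilon> / 2" using \<epsilon> by (simp add: e_def field_simps)
    have "\<exists>T. segments T \<and> (\<forall>(a, b)\<in>T. fst p \<le> a \<and> a < b \<and> b \<le> snd p) \<and>
           pos_variation g (snd p) - pos_variation g (fst p) - e \<le> (\<Sum>(a, b)\<in>T. g b - g a)" if "p \<in> S" for p
      using that segments_le[OF S(1)] by (intro pos_variation_local e) (cases p; auto)
    then have "\<exists>T. \<forall>p\<in>S. segments (T p) \<and> (\<forall>(a, b)\<in>T p. fst p \<le> a \<and> a < b \<and> b \<le> snd p) \<and>
           pos_variation g (snd p) - pos_variation g (fst p) - e \<le> (\<Sum>(a, b)\<in>T p. g b - g a)"
      by (intro bchoice) blast
    then obtain T where T: "\<And>p. p \<in> S \<Longrightarrow> segments (T p)"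
      "\<And>p a b. p \<in> S \<Longrightarrow> (a, b) \<in> T p \<Longrightarrow> fst p \<le> a \<and> a < b \<and> b \<le> snd p"
      "\<And>p. p \<in> S \<Longrightarrow> pos_variation g (snd p) - pos_variation g (fst p) - e \<le> (\<Sum>(a, b)\<in>T p. g b - g a)"
      by fast
    have disj: "{a<..b} \<inter> {c<..d} = {}" if "p \<in> S" "q \<in> S" "p \<noteq> q" "(a, b) \<in> T p" "(c, d) \<in> T q" for p q a b c d
    proof -
      have "{fst p<..snd p} \<inter> {fst q<..snd q} = {}"
        using S(1) that(1-3) unfolding segments_def disjoint_family_on_def by (auto simp: case_prod_unfold)
      moreover have "{a<..b} \<subseteq> {fst p<..snd p}" using T(2)[OF that(1,4)] by auto
      moreover have "{c<..d} \<subseteq> {fst q<..snd q}" using T(2)[OF that(2,5)] by auto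
      ultimately show ?thesis by blast
    qed
    have TT: "T p \<inter> T q = {}" if pq: "p \<in> S" "q \<in> S" "p \<noteq> q" for p q
    proof (rule ccontr)
      assume "T p \<inter> T q \<noteq> {}"
      then obtain a b where ab: "(a, b) \<in> T p" "(a, b) \<in> T q" by auto
      then show False using disj[OF pq ab] T(2)[OF pq(1) ab(1)] by auto
    qed
    let ?U = "\<Union>p\<in>S. T p"
    have sumU: "(\<Sum>(a, b)\<in>?U. F a b) = (\<Sum>p\<in>S. \<Sum>(a, b)\<in>T p. F a b)" for F :: "real \<Rightarrow> real \<Rightarrow> real"
      by (rule sum.UNION_disjoint) (use S T TT segments_finite in auto)
    have U: "segments ?U"
      unfolding segments_def
    proof (intro conjI)
      show "finite ?U" using S T segments_finite by auto
      show "\<forall>(a, b)\<in>?U. a \<le> b" using T(1) segments_le by fastforce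
      show "disjoint_family_on (\<lambda>(a, b). {a<..b}) ?U"
        unfolding disjoint_family_on_def
      proof (intro ballI impI)
        fix u v assume uv: "u \<in> ?U" "v \<in> ?U" "u \<noteq> v"
        obtain p q where p: "p \<in> S" "u \<in> T p" and q: "q \<in> S" "v \<in> T q" using uv by auto
        obtain a b c d where [simp]: "u = (a, b)" "v = (c, d)" by (meson surj_pair)
        show "(case u of (a, b) \<Rightarrow> {a<..b}) \<inter> (case v of (a, b) \<Rightarrow> {a<..b}) = {}"
        proof (cases "p = q")
          case True
          then show ?thesis using T(1)[OF p(1)] p q uv(3) unfolding segments_def disjoint_family_on_def by blast
        next
          case False
          then show ?thesis using disj[OF p(1) q(1) False, of a b c d] p q by simp
        qed
      qed
    qed
    have "(\<Sum>(a, b)\<in>?U. b - a) = (\<Sum>p\<in>S. \<Sum>(a, b)\<in>T p. b - a)" by (rule sumU)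
    also have "\<dots> \<le> (\<Sum>p\<in>S. snd p - fst p)"
    proof (rule sum_mono)
      fix p assume p: "p \<in> S"
      have le: "fst p \<le> snd p" using segments_le[OF S(1), of "fst p" "snd p"] p by simp
      have "(\<Sum>(a, b)\<in>T p. b - a) \<le> measure lborel {fst p<..snd p}"
        by (rule sum_length_segments[OF T(1)[OF p]]) (use T(2)[OF p] le in \<open>force simp: emeasure_lborel_Ioc\<close>)+
      then show "(\<Sum>(a, b)\<in>T p. b - a) \<le> snd p - fst p" using le by simp
    qed
    also have "\<dots> < \<delta>" using S(2) by (simp add: case_prod_unfold)
    finally have small: "(\<Sum>(a, b)\<in>?U. \<bar>g b - g a\<bar>) < \<epsilon> / 2" by (rule \<delta>(2)[OF U])
    have mono: "pos_variation g a \<le> pos_variation g b" if "a \<le> b" for a b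
      using pos_variation_increment[of a b] that by (cases "a = b") (auto simp: max_def split: if_splits)
    have "(\<Sum>(a, b)\<in>S. \<bar>pos_variation g b - pos_variation g a\<bar>)
        \<le> (\<Sum>p\<in>S. (\<Sum>(a, b)\<in>T p. \<bar>g b - g a\<bar>) + e)"
    proof (rule sum_mono)
      fix p assume p: "p \<in> S"
      obtain a b where ab: "p = (a, b)" by (cases p)
      have "\<bar>pos_variation g b - pos_variation g a\<bar> = pos_variation g b - pos_variation g a"
        using mono[of a b] segments_le[OF S(1), of a b] p ab by simp
      also have "\<dots> \<le> (\<Sum>(a, b)\<in>T p. g b - g a) + e" using T(3)[OF p] ab by simp
      also have "(\<Sum>(a, b)\<in>T p. g b - g a) \<le> (\<Sum>(a, b)\<in>T p. \<bar>g b - g a\<bar>)" by (rule sum_mono) auto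
      finally show "(case p of (a, b) \<Rightarrow> \<bar>pos_variation g b - pos_variation g a\<bar>) \<le> (\<Sum>(a, b)\<in>T p. \<bar>g b - g a\<bar>) + e"
        using ab by simp
    qed
    also have "\<dots> = (\<Sum>(a, b)\<in>?U. \<bar>g b - g a\<bar>) + real (card S) * e"
      by (simp add: sum.distrib sumU)
    finally show ?thesis using small ecard by simp
  qed
  show "\<exists>\<delta>>0. \<forall>S. segments S \<longrightarrow> (\<Sum>(a, b)\<in>S. b - a) < \<delta> \<longrightarrow>
      (\<Sum>(a, b)\<in>S. \<bar>pos_variation g b - pos_variation g a\<bar>) < \<epsilon>"
    by (intro exI[of _ \<delta>] conjI allI impI main \<delta>(1))
qed

end

section \<open>From monotone absolutely continuous functions to Lebesgue densities\<close>

lemma integrable_imp_set_integrable: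
  fixes f :: "'a \<Rightarrow> real"
  shows "integrable M f \<Longrightarrow> A \<in> sets M \<Longrightarrow> set_integrable M A f"
  unfolding set_integrable_def by (rule integrable_mult_indicator)

text \<open>Absolute continuity speaks of finite families only; each stage is therefore finite, and
  a point of \<open>U\<close> belongs to every sufficiently late stage.\<close>

lemma open_dyadic_exhaustion:
  fixes U :: "real set"
  assumes U: "open U"
  shows "\<exists>J :: nat \<Rightarrow> int set. (\<forall>n. finite (J n)) \<and>
    (\<forall>n. \<forall>j\<in>J n. {of_int j / 2 ^ n..(of_int j + 1) / 2 ^ n} \<subseteq> U) \<and>
    (\<forall>x\<in>U. \<exists>N. \<forall>n\<ge>N. \<exists>j\<in>J n. x \<in> {of_int j / 2 ^ n<..(of_int j + 1) / 2 ^ n})"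
proof -
  \<comment> \<open>Indices up to \<open>4 ^ n\<close> at mesh \<open>1 / 2 ^ n\<close> reach out to
    about \<open>2 ^ n\<close>: finitely many cells, yet every point is eventually covered.\<close>
  let ?J = "\<lambda>n::nat. {j. \<bar>j\<bar> \<le> 4 ^ n \<and> {of_int j / 2 ^ n..(of_int j + 1) / 2 ^ n} \<subseteq> U}"
  have fin: "finite (?J n)" for n
    by (rule finite_subset[of _ "{- (4 ^ n)..4 ^ n}"]) auto
  have sub: "{of_int j / 2 ^ n..(of_int j + 1) / 2 ^ n} \<subseteq> U" if "j \<in> ?J n" for n j using that by blast
  have ex: "\<exists>N. \<forall>n\<ge>N. \<exists>j\<in>?J n. x \<in> {of_int j / 2 ^ n<..(of_int j + 1) / 2 ^ n}" if x: "x \<in> U" for x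
  proof -
  obtain d where d: "d > 0" "ball x d \<subseteq> U" using U openE[OF U x] by blast
  obtain N1 :: nat where N1: "(1/2) ^ N1 < d" using real_arch_pow_inv[OF d(1), of "1/2"] by auto
  obtain N2 :: nat where N2: "\<bar>x\<bar> + 1 < 2 ^ N2" using real_arch_pow[of 2 "\<bar>x\<bar> + 1"] by auto
  show ?thesis
  proof (intro exI allI impI)
    fix n assume n: "max N1 N2 \<le> n"
    have dn: "1 / 2 ^ n < d"
    proof -
      have "(1/2::real) ^ n \<le> (1/2) ^ N1" using n by (intro power_decreasing) auto
      then show ?thesis using N1 by (simp add: power_one_over)
    qed
    have xn: "\<bar>x\<bar> + 1 < 2 ^ n"
    proof -
      have "(2::real) ^ N2 \<le> 2 ^ n" using n by (intro power_increasing) auto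
      then show ?thesis using N2 by (rule less_le_trans[rotated])
    qed
    define j where "j = \<lceil>x * 2 ^ n\<rceil> - 1"
    have j: "of_int j < x * 2 ^ n" "x * 2 ^ n \<le> of_int j + 1"
      by (auto simp: j_def) linarith
    have cell: "x \<in> {of_int j / 2 ^ n<..(of_int j + 1) / 2 ^ n}"
      using j by (simp add: field_simps)
    have "\<bar>of_int j\<bar> \<le> \<bar>x * 2 ^ n\<bar> + 1" using j by linarith
    also have "\<dots> = \<bar>x\<bar> * 2 ^ n + 1" by (simp add: abs_mult)
    also have "\<dots> \<le> (\<bar>x\<bar> + 1) * 2 ^ n" by (simp add: algebra_simps)
    also have "\<dots> \<le> 2 ^ n * 2 ^ n" using xn by (intro mult_right_mono) auto
    also have "\<dots> = (4::real) ^ n" by (simp add: power_mult_distrib[symmetric])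
    finally have "of_int \<bar>j\<bar> \<le> (of_int (4 ^ n) :: real)" by simp
    then have "\<bar>j\<bar> \<le> 4 ^ n" by (simp only: of_int_le_iff)
    moreover have "{of_int j / 2 ^ n..(of_int j + 1) / 2 ^ n} \<subseteq> ball x d"
    proof
      fix y :: real assume "y \<in> {of_int j / 2 ^ n..(of_int j + 1) / 2 ^ n}"
      then have "\<bar>x - y\<bar> \<le> 1 / 2 ^ n" using cell by (auto simp: abs_le_iff add_divide_distrib)
      then show "y \<in> ball x d" using dn by (simp add: dist_real_def)
    qed
    ultimately have "j \<in> ?J n" using d(2) by blast
    then show "\<exists>j\<in>?J n. x \<in> {of_int j / 2 ^ n<..(of_int j + 1) / 2 ^ n}" using cell by blast
  qed
  qed
  show ?thesis by (rule exI[of _ ?J], intro conjI allI ballI fin sub ex)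
qed

text \<open>Finite unions of disjoint cells inside \<open>U\<close> have total length below
  \<delta>, so the hypothesis bounds their measure by \<epsilon> at every stage.\<close>

lemma interval_measure_open_le:
  fixes W :: "real \<Rightarrow> real"
  assumes mono: "mono W" and cont: "continuous_on UNIV W"
    and \<delta>: "\<And>S. segments S \<Longrightarrow> (\<Sum>(a, b)\<in>S. b - a) < \<delta> \<Longrightarrow> (\<Sum>(a, b)\<in>S. \<bar>W b - W a\<bar>) < \<epsilon>"
    and U: "open U" "emeasure lborel U < ennreal \<delta>"
  shows "emeasure (interval_measure W) U \<le> ennreal \<epsilon>"
proof -
  let ?\<mu> = "interval_measure W"
  have mIoc: "emeasure ?\<mu> {a<..b} = ennreal (W b - W a)" if "a \<le> b" for a b
    using mono cont that by (intro emeasure_interval_measure_Ioc)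
      (auto dest: monoD simp: continuous_on_eq_continuous_at intro: continuous_at_imp_continuous_at_within)
  obtain J :: "nat \<Rightarrow> int set" where J: "\<And>n. finite (J n)"
    "\<And>n j. j \<in> J n \<Longrightarrow> {of_int j / 2 ^ n..(of_int j + 1) / 2 ^ n} \<subseteq> U"
    "\<And>x. x \<in> U \<Longrightarrow> \<exists>N. \<forall>n\<ge>N. \<exists>j\<in>J n. x \<in> {of_int j / 2 ^ n<..(of_int j + 1) / 2 ^ n}"
    using open_dyadic_exhaustion[OF U(1)] by blast
  define c where "c = (\<lambda>(n::nat) (j::int). (of_int j / 2 ^ n, (of_int j + 1) / 2 ^ n) :: real \<times> real)"
  define V where "V n = (\<Union>j\<in>J n. {of_int j / 2 ^ n<..(of_int j + 1) / (2 ^ n :: real)})" for n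
  have Vb[measurable]: "V n \<in> sets borel" for n unfolding V_def using J(1) by auto
  have inj: "inj_on (c n) (J n)" for n by (auto simp: inj_on_def c_def)
  have cells: "{of_int i / 2 ^ n<..(of_int i + 1) / 2 ^ n} \<inter> {of_int j / 2 ^ n<..(of_int j + 1) / (2 ^ n :: real)} = {}"
    if "i \<noteq> j" for i j :: int and n :: nat
  proof -
    have "i + 1 \<le> j \<or> j + 1 \<le> i" using that by linarith
    then have "(of_int i + 1 :: real) \<le> of_int j \<or> (of_int j + 1 :: real) \<le> of_int i"
      by (metis of_int_1 of_int_add of_int_le_iff)
    then have "(of_int i + 1) / (2 ^ n :: real) \<le> of_int j / 2 ^ n \<or> (of_int j + 1) / (2 ^ n :: real) \<le> of_int i / 2 ^ n"
      by (auto intro: divide_right_mono)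
    then show ?thesis by auto
  qed
  have seg: "segments (c n ` J n)" for n
    unfolding segments_def
  proof (intro conjI)
    show "finite (c n ` J n)" using J(1) by simp
    show "\<forall>(a, b)\<in>c n ` J n. a \<le> b" by (auto simp: c_def intro: divide_right_mono)
    show "disjoint_family_on (\<lambda>(a, b). {a<..b}) (c n ` J n)"
      unfolding disjoint_family_on_def
    proof (intro ballI impI)
      fix p q assume pq: "p \<in> c n ` J n" "q \<in> c n ` J n" "p \<noteq> q"
      then obtain i j where "p = c n i" "q = c n j" "i \<noteq> j" by blast
      then show "(case p of (a, b) \<Rightarrow> {a<..b}) \<inter> (case q of (a, b) \<Rightarrow> {a<..b}) = {}"
        using cells[of i j n] by (simp add: c_def)
    qed
  qed
  have VU: "V n \<subseteq> U" for n using J(2) unfolding V_def by fastforce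
  have fU: "emeasure lborel U < \<infinity>" using U(2) by (rule order.strict_trans) simp
  have Ub: "U \<in> sets lborel" using U(1) by simp
  have Vle: "emeasure ?\<mu> (V n) \<le> ennreal \<epsilon>" for n
  proof -
    have "(\<Sum>(a, b)\<in>c n ` J n. b - a) \<le> measure lborel U"
      by (rule sum_length_segments[OF seg Ub fU]) (use VU in \<open>auto simp: V_def c_def\<close>)
    also have "measure lborel U < \<delta>"
      using U(2) fU by (simp add: emeasure_eq_ennreal_measure ennreal_less_iff)
    finally have "(\<Sum>(a, b)\<in>c n ` J n. \<bar>W b - W a\<bar>) < \<epsilon>" by (rule \<delta>[OF seg])
    then have sm: "(\<Sum>j\<in>J n. \<bar>W ((of_int j + 1) / 2 ^ n) - W (of_int j / 2 ^ n)\<bar>) < \<epsilon>"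
      by (subst (asm) sum.reindex[OF inj]) (simp add: c_def)
    have "emeasure ?\<mu> (V n) = (\<Sum>j\<in>J n. emeasure ?\<mu> {of_int j / 2 ^ n<..(of_int j + 1) / (2 ^ n :: real)})"
      unfolding V_def
      by (rule sum_emeasure[symmetric]) (use J(1) cells in \<open>auto simp: disjoint_family_on_def\<close>)
    also have "\<dots> = (\<Sum>j\<in>J n. ennreal \<bar>W ((of_int j + 1) / 2 ^ n) - W (of_int j / 2 ^ n)\<bar>)"
    proof (rule sum.cong)
      fix j
      have le: "of_int j / 2 ^ n \<le> (of_int j + 1) / (2 ^ n :: real)" by (intro divide_right_mono) auto
      show "emeasure ?\<mu> {of_int j / 2 ^ n<..(of_int j + 1) / (2 ^ n :: real)} = ennreal \<bar>W ((of_int j + 1) / 2 ^ n) - W (of_int j / 2 ^ n)\<bar>"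
        using mIoc[OF le] monoD[OF mono le] by simp
    qed simp
    also have "\<dots> \<le> ennreal \<epsilon>" using sm by (subst sum_ennreal) (auto intro: ennreal_leI)
    finally show ?thesis .
  qed
  \<comment> \<open>Intersections of the tails increase by construction and contain each point of
    \<open>U\<close> from some index on, so continuity from below applies.\<close>
  define D where "D n = (\<Inter>m\<in>{n..}. V m)" for n
  have Db[measurable]: "D n \<in> sets borel" for n unfolding D_def by auto
  have "U \<subseteq> (\<Union>n. D n)"
  proof
    fix x assume "x \<in> U"
    then obtain N where "\<forall>n\<ge>N. \<exists>j\<in>J n. x \<in> {of_int j / 2 ^ n<..(of_int j + 1) / 2 ^ n}" using J(3) by blast
    then have "x \<in> D N" unfolding D_def V_def by blast
    then show "x \<in> (\<Union>n. D n)" by blast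
  qed
  then have "emeasure ?\<mu> U \<le> emeasure ?\<mu> (\<Union>n. D n)" by (intro emeasure_mono) auto
  also have "\<dots> = (SUP n. emeasure ?\<mu> (D n))"
    by (intro SUP_emeasure_incseq[symmetric]) (auto simp: incseq_def D_def)
  also have "\<dots> \<le> ennreal \<epsilon>"
  proof (rule SUP_least)
    fix n
    have "emeasure ?\<mu> (D n) \<le> emeasure ?\<mu> (V n)" by (intro emeasure_mono) (auto simp: D_def)
    then show "emeasure ?\<mu> (D n) \<le> ennreal \<epsilon>" using Vle[of n] by (rule order_trans)
  qed
  finally show ?thesis .
qed

text \<open>\<open>W\<close> induces a finite Stieltjes measure. A Lebesgue null set is caught in an
  open set of small length, hence of small Stieltjes measure; \<open>h\<close> is the resulting
  Radon--Nikodym derivative.\<close>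

lemma mono_abs_continuous_fun_integral:
  fixes W :: "real \<Rightarrow> real"
  assumes mono: "mono W" and ac: "abs_continuous_fun W" and bdd: "\<And>x. \<bar>W x\<bar> \<le> K"
  shows "\<exists>h. integrable lborel h \<and> (\<forall>a b. a \<le> b \<longrightarrow> W b - W a = (LINT x:{a<..b}|lborel. h x))"
proof -
  let ?\<mu> = "interval_measure W"
  note cont = abs_continuous_fun_imp_continuous[OF ac]
  have mIoc: "emeasure ?\<mu> {a<..b} = ennreal (W b - W a)" if "a \<le> b" for a b
    using mono cont that by (intro emeasure_interval_measure_Ioc)
      (auto dest: monoD simp: continuous_on_eq_continuous_at intro: continuous_at_imp_continuous_at_within)
  \<comment> \<open>Finite total mass makes the density finite almost everywhere and
    integrable.\<close>
  have fin: "emeasure ?\<mu> UNIV \<le> ennreal (2 * K)"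
  proof -
    have "(\<Union>n::nat. {- real n<..real n}) = UNIV"
    proof -
      have "x \<in> (\<Union>n::nat. {- real n<..real n})" for x :: real
      proof -
        obtain n :: nat where "\<bar>x\<bar> < real n" using reals_Archimedean2 by blast
        then show ?thesis by (auto intro!: exI[of _ n])
      qed
      then show ?thesis by blast
    qed
    then have "emeasure ?\<mu> UNIV = emeasure ?\<mu> (\<Union>n::nat. {- real n<..real n})" by simp
    also have "\<dots> = (SUP n::nat. emeasure ?\<mu> {- real n<..real n})"
      by (rule SUP_emeasure_incseq[symmetric]) (auto simp: incseq_def)
    also have "\<dots> \<le> ennreal (2 * K)"
    proof (rule SUP_least)
      fix n :: nat
      show "emeasure ?\<mu> {- real n<..real n} \<le> ennreal (2 * K)"
        using bdd[of "real n"] bdd[of "- real n"] by (subst mIoc) (auto intro!: ennreal_leI)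
    qed
    finally show ?thesis .
  qed
  have acm: "absolutely_continuous lborel ?\<mu>"
    unfolding absolutely_continuous_def
  proof
    fix E :: "real set" assume E: "E \<in> null_sets lborel"
    have eps: "emeasure ?\<mu> E \<le> 0 + ennreal \<epsilon>" if "\<epsilon> > 0" for \<epsilon>
    proof -
      obtain \<delta> where \<delta>: "\<delta> > 0" "\<And>S. segments S \<Longrightarrow> (\<Sum>(a, b)\<in>S. b - a) < \<delta> \<Longrightarrow> (\<Sum>(a, b)\<in>S. \<bar>W b - W a\<bar>) < \<epsilon>"
        using abs_continuous_funD[OF ac \<open>\<epsilon> > 0\<close>] by blast
      obtain U where U: "open U" "E \<subseteq> U" "emeasure lborel (U - E) < ennreal \<delta>"
        using outer_regular_lborel[of E \<delta>] null_setsD2[OF E] \<delta>(1) by auto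
      have "emeasure lborel U \<le> emeasure lborel ((U - E) \<union> E)"
        using U E by (intro emeasure_mono) auto
      also have "\<dots> = emeasure lborel (U - E)"
        using U E by (intro emeasure_Un_null_set) auto
      finally have "emeasure ?\<mu> U \<le> ennreal \<epsilon>"
        using U by (intro interval_measure_open_le[OF mono cont \<delta>(2)]) auto
      moreover have "emeasure ?\<mu> E \<le> emeasure ?\<mu> U" using U by (intro emeasure_mono) auto
      ultimately show ?thesis by (simp add: order_trans)
    qed
    have "emeasure ?\<mu> E \<le> 0" by (rule ennreal_le_epsilon) (rule eps)
    then show "E \<in> null_sets ?\<mu>" using E by (auto intro!: null_setsI)
  qed
  obtain f where f: "f \<in> borel_measurable lborel" "density lborel f = ?\<mu>"
    using sigma_finite_measure.Radon_Nikodym[OF sigma_finite_lborel acm] by auto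
  have fm[measurable]: "f \<in> borel_measurable borel" using f(1) by simp
  have "(\<integral>\<^sup>+x. f x \<partial>lborel) = emeasure ?\<mu> UNIV"
    unfolding f(2)[symmetric] by (simp add: emeasure_density)
  then have ffin: "(\<integral>\<^sup>+x. f x \<partial>lborel) < \<infinity>" using fin by (simp add: order_le_less_trans)
  have fAE: "AE x in lborel. f x \<noteq> \<infinity>" using ffin by (intro nn_integral_PInf_AE) auto
  define h where "h x = enn2real (f x)" for x
  have hm[measurable]: "h \<in> borel_measurable borel" by (simp add: h_def[abs_def])
  have hI: "integrable lborel h"
  proof (rule integrableI_nonneg)
    have "(\<integral>\<^sup>+x. ennreal (h x) \<partial>lborel) = (\<integral>\<^sup>+x. f x \<partial>lborel)"
      by (rule nn_integral_cong_AE) (use fAE in \<open>eventually_elim, auto simp: h_def ennreal_enn2real_if\<close>)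
    then show "(\<integral>\<^sup>+x. ennreal (h x) \<partial>lborel) < \<infinity>" using ffin by simp
  qed (auto simp: h_def)
  have "W b - W a = (LINT x:{a<..b}|lborel. h x)" if ab: "a \<le> b" for a b
  proof -
    have "ennreal (W b - W a) = emeasure ?\<mu> {a<..b}" using mIoc[OF ab] by simp
    also have "\<dots> = (\<integral>\<^sup>+x. f x * indicator {a<..b} x \<partial>lborel)"
      unfolding f(2)[symmetric] by (subst emeasure_density) auto
    also have "\<dots> = (\<integral>\<^sup>+x. ennreal (indicator {a<..b} x * h x) \<partial>lborel)"
      by (rule nn_integral_cong_AE) (use fAE in \<open>eventually_elim, auto simp: h_def ennreal_enn2real_if indicator_def\<close>)
    also have "\<dots> = ennreal (\<integral>x. indicator {a<..b} x * h x \<partial>lborel)"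
    proof (rule nn_integral_eq_integral)
      show "integrable lborel (\<lambda>x. indicator {a<..b} x * h x)"
        using integrable_imp_set_integrable[OF hI, of "{a<..b}"] by (simp add: set_integrable_def)
    qed (simp add: h_def)
    finally show ?thesis
      using monoD[OF mono ab] by (simp add: set_lebesgue_integral_def ennreal_inj h_def integral_nonneg)
  qed
  with hI show ?thesis by blast
qed

text \<open>Freezing \<open>g\<close> outside \<open>{c..d}\<close> gives a function
  \<open>G\<close> of bounded variation on the line. It is the difference of the bounded monotone
  functions \<open>P\<close> and \<open>P - G\<close>, both absolutely continuous.\<close>

theorem abs_continuous_fun_integral:
  fixes g :: "real \<Rightarrow> real"
  assumes g: "abs_continuous_fun g" and cd: "c \<le> d"
  shows "\<exists>h. integrable lborel h \<and>
    (\<forall>a b. c \<le> a \<longrightarrow> a \<le> b \<longrightarrow> b \<le> d \<longrightarrow> g b - g a = (LINT x:{a<..b}|lborel. h x))"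
proof -
  define k where "k x = max c (min x d)" for x
  define G where "G x = g (k x)" for x
  have ac: "abs_continuous_fun G"
    unfolding G_def[abs_def] by (rule abs_continuous_fun_compose[OF g]) (auto simp: k_def intro!: monoI)
  obtain B where B: "\<And>S. segments S \<Longrightarrow> (\<Sum>(a, b)\<in>S. \<bar>G b - G a\<bar>) \<le> B"
    using abs_continuous_fun_bounded_variation[OF g cd] unfolding G_def k_def by blast
  define P where "P = pos_variation G"
  have incr: "P x + max 0 (G y - G x) \<le> P y" if "x \<le> y" for x y
    using pos_variation_increment[OF B, of x y] that by (cases "x = y") (auto simp: P_def)
  have P0: "0 \<le> P x" "P x \<le> B" for x
    using pos_variation_bounds[OF B] by (auto simp: P_def)
  have Gb: "\<bar>G x - G c\<bar> \<le> B" for x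
  proof -
    have "\<bar>G (max x c) - G (min x c)\<bar> \<le> B"
      using B[of "{(min x c, max x c)}"] by (auto simp: segments_def disjoint_family_on_def)
    then show ?thesis by (auto simp: max_def min_def abs_minus_commute split: if_splits)
  qed
  have acP: "abs_continuous_fun P"
    unfolding P_def by (rule abs_continuous_fun_pos_variation[OF B ac])
  have mP: "mono P" using incr by (intro monoI) (smt (verit))
  have mQ: "mono (\<lambda>x. P x - G x)" using incr by (intro monoI) (smt (verit))
  have "\<bar>P x\<bar> \<le> B" for x using P0[of x] by simp
  from mono_abs_continuous_fun_integral[OF mP acP this]
  obtain h1 where h1: "integrable lborel h1" "\<And>a b. a \<le> b \<Longrightarrow> P b - P a = (LINT x:{a<..b}|lborel. h1 x)" by blast
  have "\<bar>P x - G x\<bar> \<le> 2 * B + \<bar>G c\<bar>" for x using P0[of x] Gb[of x] by linarith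
  from mono_abs_continuous_fun_integral[OF mQ abs_continuous_fun_diff[OF acP ac] this]
  obtain h2 where h2: "integrable lborel h2"
    "\<And>a b. a \<le> b \<Longrightarrow> (P b - G b) - (P a - G a) = (LINT x:{a<..b}|lborel. h2 x)" by blast
  have "g b - g a = (LINT x:{a<..b}|lborel. h1 x - h2 x)" if "c \<le> a" "a \<le> b" "b \<le> d" for a b
  proof -
    have "(LINT x:{a<..b}|lborel. h1 x - h2 x) = (LINT x:{a<..b}|lborel. h1 x) - (LINT x:{a<..b}|lborel. h2 x)"
      by (intro set_integral_diff integrable_imp_set_integrable h1(1) h2(1)) auto
    also have "\<dots> = G b - G a" using h1(2)[OF that(2)] h2(2)[OF that(2)] by simp
    finally show ?thesis using that by (simp add: G_def k_def)
  qed
  then show ?thesis using h1(1) h2(1) by (intro exI[of _ "\<lambda>x. h1 x - h2 x"]) auto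
qed

section \<open>Bounded functionals on subspaces of square integrable functions\<close>

lemma Cauchy_Schwarz_integral:
  fixes f g :: "'a \<Rightarrow> real"
  assumes f[measurable]: "f \<in> borel_measurable M" "integrable M (\<lambda>x. (f x)\<^sup>2)"
    and g[measurable]: "g \<in> borel_measurable M" "integrable M (\<lambda>x. (g x)\<^sup>2)"
  shows "integrable M (\<lambda>x. f x * g x)"
    and "(\<integral>x. f x * g x \<partial>M)\<^sup>2 \<le> (\<integral>x. (f x)\<^sup>2 \<partial>M) * (\<integral>x. (g x)\<^sup>2 \<partial>M)"
proof -
  show int: "integrable M (\<lambda>x. f x * g x)"
  proof (rule Bochner_Integration.integrable_bound)
    show "integrable M (\<lambda>x. (f x)\<^sup>2 + (g x)\<^sup>2)" using f g by simp
    have "\<bar>a * b\<bar> \<le> a\<^sup>2 + b\<^sup>2" for a b :: real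
      using sum_squares_bound[of "\<bar>a\<bar>" "\<bar>b\<bar>"] abs_ge_zero[of "a * b"]
      unfolding abs_mult power2_abs by linarith
    then show "AE x in M. norm (f x * g x) \<le> norm ((f x)\<^sup>2 + (g x)\<^sup>2)" by simp
  qed simp
  have "ennreal ((\<integral>x. \<bar>f x * g x\<bar> \<partial>M)\<^sup>2) = (ennreal (\<integral>x. \<bar>f x * g x\<bar> \<partial>M))\<^sup>2"
    by (simp add: ennreal_power)
  also have "ennreal (\<integral>x. \<bar>f x * g x\<bar> \<partial>M) = (\<integral>\<^sup>+x. ennreal \<bar>f x\<bar> * ennreal \<bar>g x\<bar> \<partial>M)"
    by (subst nn_integral_eq_integral[symmetric]) (use integrable_abs[OF int] in \<open>auto simp: abs_mult ennreal_mult\<close>)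
  also have "\<dots>\<^sup>2 \<le> (\<integral>\<^sup>+x. ennreal \<bar>f x\<bar> ^ 2 \<partial>M) * (\<integral>\<^sup>+x. ennreal \<bar>g x\<bar> ^ 2 \<partial>M)"
    by (rule Cauchy_Schwarz_nn_integral) auto
  also have "\<dots> = ennreal (\<integral>x. (f x)\<^sup>2 \<partial>M) * ennreal (\<integral>x. (g x)\<^sup>2 \<partial>M)"
    using f g by (simp add: ennreal_power nn_integral_eq_integral)
  also have "\<dots> = ennreal ((\<integral>x. (f x)\<^sup>2 \<partial>M) * (\<integral>x. (g x)\<^sup>2 \<partial>M))"
    by (simp add: ennreal_mult)
  finally have "(\<integral>x. \<bar>f x * g x\<bar> \<partial>M)\<^sup>2 \<le> (\<integral>x. (f x)\<^sup>2 \<partial>M) * (\<integral>x. (g x)\<^sup>2 \<partial>M)"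
    by (subst (asm) ennreal_le_iff) auto
  moreover have "(\<integral>x. f x * g x \<partial>M)\<^sup>2 \<le> (\<integral>x. \<bar>f x * g x\<bar> \<partial>M)\<^sup>2"
    using integral_abs_bound[of M "\<lambda>x. f x * g x"] by (simp add: abs_le_square_iff[symmetric])
  ultimately show "(\<integral>x. f x * g x \<partial>M)\<^sup>2 \<le> (\<integral>x. (f x)\<^sup>2 \<partial>M) * (\<integral>x. (g x)\<^sup>2 \<partial>M)" by linarith
qed

lemma square_integrable_lincomb:
  fixes f g :: "'a \<Rightarrow> real"
  assumes f[measurable]: "f \<in> borel_measurable M" "integrable M (\<lambda>x. (f x)\<^sup>2)"
    and g[measurable]: "g \<in> borel_measurable M" "integrable M (\<lambda>x. (g x)\<^sup>2)"
  shows "integrable M (\<lambda>x. (a * f x + b * g x)\<^sup>2)"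
    and "(\<integral>x. (a * f x + b * g x)\<^sup>2 \<partial>M) =
      a\<^sup>2 * (\<integral>x. (f x)\<^sup>2 \<partial>M) + 2 * a * b * (\<integral>x. f x * g x \<partial>M) + b\<^sup>2 * (\<integral>x. (g x)\<^sup>2 \<partial>M)"
proof -
  note fg = Cauchy_Schwarz_integral(1)[OF f g]
  have eq: "(\<lambda>x. (a * f x + b * g x)\<^sup>2) = (\<lambda>x. a\<^sup>2 * (f x)\<^sup>2 + 2 * a * b * (f x * g x) + b\<^sup>2 * (g x)\<^sup>2)"
    by (auto simp: power2_eq_square algebra_simps)
  show "integrable M (\<lambda>x. (a * f x + b * g x)\<^sup>2)" unfolding eq using f(2) g(2) fg by simp
  show "(\<integral>x. (a * f x + b * g x)\<^sup>2 \<partial>M) =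
      a\<^sup>2 * (\<integral>x. (f x)\<^sup>2 \<partial>M) + 2 * a * b * (\<integral>x. f x * g x \<partial>M) + b\<^sup>2 * (\<integral>x. (g x)\<^sup>2 \<partial>M)"
    unfolding eq using f(2) g(2) fg by simp
qed

text \<open>The fast rate avoids passing to a subsequence: the L1 norms of the increments decay like
  \<open>(1/4) ^ n\<close>, hence the sequence converges almost everywhere, and Fatou's lemma
  transfers the bounds to the limit.\<close>

lemma L2_Cauchy_limit:
  fixes v :: "nat \<Rightarrow> 'a \<Rightarrow> real"
  assumes fin: "finite_measure M"
    and v[measurable]: "\<And>n. v n \<in> borel_measurable M" "\<And>n. integrable M (\<lambda>x. (v n x)\<^sup>2)"
    and C: "\<And>m n. m \<le> n \<Longrightarrow> (\<integral>x. (v m x - v n x)\<^sup>2 \<partial>M) \<le> K / 16 ^ m"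
  shows "\<exists>w. w \<in> borel_measurable M \<and> integrable M (\<lambda>x. (w x)\<^sup>2) \<and>
    (\<forall>n. integrable M (\<lambda>x. (v n x - w x)\<^sup>2) \<and> (\<integral>x. (v n x - w x)\<^sup>2 \<partial>M) \<le> K / 16 ^ n)"
proof -
  interpret finite_measure M by fact
  have i2: "integrable M (\<lambda>x. (v m x - v n x)\<^sup>2)" for m n
    using square_integrable_lincomb(1)[OF v(1) v(2) v(1) v(2), of 1 m "-1" n] by simp
  have "0 \<le> (\<integral>x. (v 0 x - v 0 x)\<^sup>2 \<partial>M)" by simp
  then have K: "K \<ge> 0" using C[of 0 0] by simp
  define D where "D n x = \<bar>v n x - v (Suc n) x\<bar>" for n x
  have D[measurable]: "D n \<in> borel_measurable M" for n by (simp add: D_def[abs_def])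
  \<comment> \<open>Cauchy--Schwarz against the constant 1 turns the L2 bound into an L1 bound; this
    is where finiteness of \<open>M\<close> enters.\<close>
  define L where "L = sqrt (K * measure M (space M))"
  have DI: "(\<integral>\<^sup>+x. ennreal (D n x) \<partial>M) \<le> ennreal (L * (1/4) ^ n)" for n
  proof -
    have "integrable M (\<lambda>x. v n x - v (Suc n) x)"
      by (rule square_integrable_imp_integrable) (use i2 in auto)
    then have Dn: "integrable M (D n)" unfolding D_def[abs_def] by (rule integrable_abs)
    have "(\<integral>\<^sup>+x. ennreal (D n x) \<partial>M) = ennreal (\<integral>x. D n x \<partial>M)"
      by (rule nn_integral_eq_integral[OF Dn]) (simp add: D_def)
    also have "\<dots> \<le> ennreal (L * (1/4) ^ n)"
    proof (rule ennreal_leI, rule power2_le_imp_le)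
      have D2: "(D n x)\<^sup>2 = (v n x - v (Suc n) x)\<^sup>2" for x by (simp add: D_def)
      have "(\<integral>x. D n x * 1 \<partial>M)\<^sup>2 \<le> (\<integral>x. (D n x)\<^sup>2 \<partial>M) * (\<integral>x. 1\<^sup>2 \<partial>M)"
        by (rule Cauchy_Schwarz_integral) (auto simp: D2 i2)
      also have "\<dots> \<le> (K / 16 ^ n) * measure M (space M)"
        unfolding D2 using mult_right_mono[OF C[of n "Suc n"], of "measure M (space M)"] by simp
      also have "\<dots> = (L * (1/4) ^ n)\<^sup>2"
        using K by (simp add: L_def power_mult_distrib power_divide power_mult[symmetric] mult.commute[of n] power_mult)
      finally show "(\<integral>x. D n x \<partial>M)\<^sup>2 \<le> (L * (1/4) ^ n)\<^sup>2" by simp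
      show "0 \<le> L * (1/4) ^ n" using K by (simp add: L_def)
    qed
    finally show ?thesis .
  qed
  have L0: "L \<ge> 0" using K by (simp add: L_def)
  have "(\<integral>\<^sup>+x. (\<Sum>n. ennreal (D n x)) \<partial>M) = (\<Sum>n. \<integral>\<^sup>+x. ennreal (D n x) \<partial>M)"
    by (rule nn_integral_suminf) simp
  also have "\<dots> \<le> (\<Sum>n. ennreal (L * (1/4) ^ n))" by (intro suminf_le DI) auto
  also have "\<dots> = ennreal (\<Sum>n. L * (1/4) ^ n)"
    using L0 by (intro suminf_ennreal2) (auto intro!: summable_mult summable_geometric)
  finally have "(\<integral>\<^sup>+x. (\<Sum>n. ennreal (D n x)) \<partial>M) \<noteq> \<infinity>" by (auto simp: top_unique)
  then have "AE x in M. (\<Sum>n. ennreal (D n x)) \<noteq> \<infinity>" by (intro nn_integral_PInf_AE) auto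
  then have conv: "AE x in M. convergent (\<lambda>n. v n x)"
  proof eventually_elim
    case (elim x)
    have "summable (\<lambda>n. D n x)"
    proof (rule summable_suminf_not_top)
      show "0 \<le> D n x" for n by (simp add: D_def)
      show "(\<Sum>n. ennreal (D n x)) \<noteq> top" using elim by simp
    qed
    moreover have "D n x = \<bar>v (Suc n) x - v n x\<bar>" for n by (simp add: D_def abs_minus_commute)
    ultimately have "summable (\<lambda>n. \<bar>v (Suc n) x - v n x\<bar>)" by simp
    then have "summable (\<lambda>n. v (Suc n) x - v n x)" by (rule summable_rabs_cancel)
    then have "(\<lambda>n. \<Sum>i<n. v (Suc i) x - v i x) \<longlonglongrightarrow> (\<Sum>n. v (Suc n) x - v n x)"
      by (rule summable_LIMSEQ)
    moreover have "(\<Sum>i<n. v (Suc i) x - v i x) = v n x - v 0 x" for n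
      by (rule sum_lessThan_telescope)
    ultimately have "(\<lambda>n. v n x - v 0 x) \<longlonglongrightarrow> (\<Sum>n. v (Suc n) x - v n x)" by simp
    from tendsto_add[OF this tendsto_const[of "v 0 x"]] show ?case
      by (auto simp: convergent_def)
  qed
  define w where "w x = lim (\<lambda>n. v n x)" for x
  have w[measurable]: "w \<in> borel_measurable M" unfolding w_def[abs_def] by measurable
  have vw: "AE x in M. (\<lambda>n. v n x) \<longlonglongrightarrow> w x"
    using conv by eventually_elim (simp add: w_def convergent_LIMSEQ_iff)
  have le: "(\<integral>\<^sup>+x. ennreal ((v n x - w x)\<^sup>2) \<partial>M) \<le> ennreal (K / 16 ^ n)" for n
  proof -
    have "(\<integral>\<^sup>+x. ennreal ((v n x - w x)\<^sup>2) \<partial>M) = (\<integral>\<^sup>+x. liminf (\<lambda>m. ennreal ((v n x - v m x)\<^sup>2)) \<partial>M)"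
    proof (rule nn_integral_cong_AE, use vw in eventually_elim)
      case (elim x)
      have "(\<lambda>m. ennreal ((v n x - v m x)\<^sup>2)) \<longlonglongrightarrow> ennreal ((v n x - w x)\<^sup>2)"
        by (intro tendsto_ennrealI tendsto_intros elim)
      then show ?case by (simp only: lim_imp_Liminf[OF sequentially_bot])
    qed
    also have "\<dots> \<le> liminf (\<lambda>m. \<integral>\<^sup>+x. ennreal ((v n x - v m x)\<^sup>2) \<partial>M)"
      by (rule nn_integral_liminf) simp
    also have "\<dots> \<le> ennreal (K / 16 ^ n)"
    proof (rule Liminf_le)
      show "\<forall>\<^sub>F m in sequentially. (\<integral>\<^sup>+x. ennreal ((v n x - v m x)\<^sup>2) \<partial>M) \<le> ennreal (K / 16 ^ n)"
        using eventually_ge_at_top[of n]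
      proof eventually_elim
        case (elim m)
        then show ?case using C[OF elim] i2[of n m] by (subst nn_integral_eq_integral) (auto intro: ennreal_leI)
      qed
    qed simp
    finally show ?thesis .
  qed
  have iw: "integrable M (\<lambda>x. (v n x - w x)\<^sup>2)" for n
    by (rule integrableI_nonneg) (use le[of n] in \<open>auto simp: order_le_less_trans\<close>)
  have Kn: "(\<integral>x. (v n x - w x)\<^sup>2 \<partial>M) \<le> K / 16 ^ n" for n
    using le[of n] K by (subst (asm) nn_integral_eq_integral[OF iw]) (auto simp: ennreal_le_iff)
  have "integrable M (\<lambda>x. (1 * v 0 x + (-1) * (v 0 x - w x))\<^sup>2)"
    by (rule square_integrable_lincomb(1)) (use v iw in auto)
  then have "integrable M (\<lambda>x. (w x)\<^sup>2)" by simp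
  then show ?thesis using w iw Kn by blast
qed

text \<open>\<open>V\<close> is not assumed closed in L2; the representer is a limit of elements of
  \<open>V\<close> and represents \<open>T\<close> on \<open>V\<close> itself. Its norm bound
  matters as much as its existence: it gives one half of the formula for the information.\<close>

theorem L2_Riesz_on_subspace:
  fixes V :: "('a \<Rightarrow> real) set" and T :: "('a \<Rightarrow> real) \<Rightarrow> real"
  assumes fin: "finite_measure M"
    and V0: "V \<noteq> {}"
    and V: "\<And>u v a b. u \<in> V \<Longrightarrow> v \<in> V \<Longrightarrow> (\<lambda>x. a * u x + b * v x) \<in> V"
    and meas: "\<And>v. v \<in> V \<Longrightarrow> v \<in> borel_measurable M"
    and sq: "\<And>v. v \<in> V \<Longrightarrow> integrable M (\<lambda>x. (v x)\<^sup>2)"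
    and T: "\<And>u v a b. u \<in> V \<Longrightarrow> v \<in> V \<Longrightarrow> T (\<lambda>x. a * u x + b * v x) = a * T u + b * T v"
    and I0: "I \<ge> 0"
    and bound: "\<And>v. v \<in> V \<Longrightarrow> (T v)\<^sup>2 \<le> I * (\<integral>x. (v x)\<^sup>2 \<partial>M)"
  shows "\<exists>w. w \<in> borel_measurable M \<and> integrable M (\<lambda>x. (w x)\<^sup>2) \<and> (\<integral>x. (w x)\<^sup>2 \<partial>M) \<le> I \<and>
           (\<forall>v\<in>V. T v = (\<integral>x. w x * v x \<partial>M))"
proof -
  define Q where "Q v = (\<integral>x. (v x)\<^sup>2 \<partial>M)" for v :: "'a \<Rightarrow> real"
  define ip where "ip u v = (\<integral>x. u x * v x \<partial>M)" for u v :: "'a \<Rightarrow> real"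
  have Q0: "Q v \<ge> 0" for v by (simp add: Q_def)
  have Qlin: "Q (\<lambda>x. a * u x + b * v x) = a\<^sup>2 * Q u + 2 * a * b * ip u v + b\<^sup>2 * Q v" if "u \<in> V" "v \<in> V" for u v a b
    unfolding Q_def ip_def by (rule square_integrable_lincomb(2)) (use that meas sq in auto)
  text \<open>The representing function is the limit of a maximizing sequence of the concave functional \<open>J\<close>.\<close>
  define J where "J v = 2 * T v - Q v" for v
  have JI: "J v \<le> I" if "v \<in> V" for v
  proof -
    have "(2 * T v)\<^sup>2 \<le> 4 * I * Q v" using bound[OF that] by (simp add: Q_def power_mult_distrib)
    \<comment> \<open>The inequality between the geometric and the arithmetic mean of
      \<open>I\<close> and \<open>Q v\<close>.\<close>
    also have "\<dots> \<le> (I + Q v)\<^sup>2"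
      using zero_le_power2[of "I - Q v"] unfolding power2_sum power2_diff by linarith
    finally have "2 * T v \<le> I + Q v"
      by (rule power2_le_imp_le) (use I0 Q0[of v] in simp)
    then show ?thesis by (simp add: J_def)
  qed
  define s where "s = (SUP v\<in>V. J v)"
  have bdd: "bdd_above (J ` V)" using JI by (intro bdd_aboveI[of _ I]) auto
  have Js: "J v \<le> s" if "v \<in> V" for v unfolding s_def by (rule cSUP_upper[OF that bdd])
  have "\<exists>v. v \<in> V \<and> s - 1 / 16 ^ n < J v" for n :: nat
  proof -
    have "s - 1 / 16 ^ n < (SUP v\<in>V. J v)" by (simp add: s_def)
    then show ?thesis using less_cSUP_iff[OF V0 bdd] by blast
  qed
  then obtain v where v: "\<And>n. v n \<in> V" "\<And>n. s - 1 / 16 ^ n < J (v n)" by metis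
  have C: "(\<integral>x. (v m x - v n x)\<^sup>2 \<partial>M) \<le> 4 / 16 ^ m" if "m \<le> n" for m n
  proof -
    have mid: "(\<lambda>x. 1/2 * v m x + 1/2 * v n x) \<in> V" by (rule V[OF v(1) v(1)])
    have "(\<integral>x. (v m x - v n x)\<^sup>2 \<partial>M) = Q (\<lambda>x. 1 * v m x + (-1) * v n x)" by (simp add: Q_def)
    also have "\<dots> = Q (v m) - 2 * ip (v m) (v n) + Q (v n)" by (subst Qlin[OF v(1) v(1)]) simp
    \<comment> \<open>Parallelogram identity: the linear part \<open>T\<close> cancels between the
      midpoint and the two ends.\<close>
    also have "\<dots> = 4 * J (\<lambda>x. 1/2 * v m x + 1/2 * v n x) - 2 * J (v m) - 2 * J (v n)"
      unfolding J_def T[OF v(1) v(1)] Qlin[OF v(1) v(1)] by (simp add: power2_eq_square algebra_simps)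
    also have "\<dots> \<le> 2 * (1 / 16 ^ m) + 2 * (1 / 16 ^ n)"
      using Js[OF mid] v(2)[of m] v(2)[of n] by linarith
    also have "\<dots> = 2 / 16 ^ m + 2 / 16 ^ n" by simp
    also have "(2::real) / 16 ^ n \<le> 2 / 16 ^ m" using that by (intro divide_left_mono power_increasing) auto
    finally show ?thesis by simp
  qed
  obtain w where w: "w \<in> borel_measurable M" "integrable M (\<lambda>x. (w x)\<^sup>2)"
    "\<And>n. integrable M (\<lambda>x. (v n x - w x)\<^sup>2)" "\<And>n. (\<integral>x. (v n x - w x)\<^sup>2 \<partial>M) \<le> 4 / 16 ^ n"
    using L2_Cauchy_limit[OF fin, of v 4] C v meas sq by blast
  have vm: "v n \<in> borel_measurable M" "integrable M (\<lambda>x. (v n x)\<^sup>2)" for n using v meas sq by auto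
  have Tw: "T u = ip w u" if u: "u \<in> V" for u
  proof -
    have um: "u \<in> borel_measurable M" "integrable M (\<lambda>x. (u x)\<^sup>2)" using u meas sq by auto
    have lim0: "(\<lambda>n. K * (1/4) ^ n) \<longlonglongrightarrow> 0" for K :: real
      using tendsto_mult_right_zero[OF LIMSEQ_power_zero[of "1/4::real"]] by simp
    have lim02: "(\<lambda>n. K * (1/2) ^ n) \<longlonglongrightarrow> 0" for K :: real
      using tendsto_mult_right_zero[OF LIMSEQ_power_zero[of "1/2::real"]] by simp
    have d: "\<bar>T u - ip (v n) u\<bar> \<le> (1 + Q u) / 2 * (1/4) ^ n" for n
    proof -
      let ?d = "T u - ip (v n) u"
      \<comment> \<open>A step \<open>t\<close> along \<open>u\<close> raises \<open>J\<close> by at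
        most the gap \<open>1 / 16 ^ n\<close> to the supremum. Taking \<open>t\<close> as plus or
        minus \<open>(1/4) ^ n\<close> balances the two terms on the right.\<close>
      have *: "2 * t * ?d \<le> 1 / 16 ^ n + t\<^sup>2 * Q u" for t
      proof -
        have "J (\<lambda>x. 1 * v n x + t * u x) \<le> s" by (rule Js[OF V[OF v(1) u]])
        then have "J (v n) + 2 * t * ?d - t\<^sup>2 * Q u \<le> s"
          unfolding J_def T[OF v(1) u] Qlin[OF v(1) u] by (simp add: algebra_simps)
        then show ?thesis using v(2)[of n] by linarith
      qed
      have q: "(1/4::real) ^ n * (1/4) ^ n = 1 / 16 ^ n"
        by (simp add: power_mult_distrib[symmetric] power_one_over)
      have "2 * (1/4) ^ n * ?d \<le> (1/4) ^ n * ((1/4) ^ n * (1 + Q u))"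
        using *[of "(1/4) ^ n"] q by (simp add: power2_eq_square algebra_simps)
      moreover have "2 * (1/4) ^ n * (- ?d) \<le> (1/4) ^ n * ((1/4) ^ n * (1 + Q u))"
        using *[of "- ((1/4) ^ n)"] q by (simp add: power2_eq_square algebra_simps)
      ultimately have "(1/4) ^ n * (2 * \<bar>?d\<bar>) \<le> (1/4) ^ n * ((1/4) ^ n * (1 + Q u))"
        by (auto simp: abs_if)
      then have "2 * \<bar>?d\<bar> \<le> (1/4) ^ n * (1 + Q u)" by (subst (asm) mult_le_cancel_left_pos) auto
      then show ?thesis by (simp add: mult.commute)
    qed
    have "(\<lambda>n. T u - ip (v n) u) \<longlonglongrightarrow> 0"
      by (rule Lim_null_comparison[OF _ lim0[of "(1 + Q u) / 2"]]) (use d in auto)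
    moreover have "(\<lambda>n. ip (v n) u - ip w u) \<longlonglongrightarrow> 0"
    proof (rule Lim_null_comparison[OF _ lim02[of "sqrt (4 * Q u)"]], intro always_eventually allI)
      fix n
      note vw = borel_measurable_diff[OF vm(1)[of n] w(1)]
      have i: "integrable M (\<lambda>x. v n x * u x)" "integrable M (\<lambda>x. w x * u x)"
        using Cauchy_Schwarz_integral(1)[OF vm um] Cauchy_Schwarz_integral(1)[OF w(1,2) um] by auto
      have "ip (v n) u - ip w u = (\<integral>x. (v n x - w x) * u x \<partial>M)"
        unfolding ip_def using i by (subst Bochner_Integration.integral_diff[symmetric]) (auto simp: algebra_simps)
      then have "(ip (v n) u - ip w u)\<^sup>2 \<le> (\<integral>x. (v n x - w x)\<^sup>2 \<partial>M) * Q u"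
        using Cauchy_Schwarz_integral(2)[OF vw w(3) um] by (simp add: Q_def)
      also have "\<dots> \<le> (4 / 16 ^ n) * Q u" using w(4)[of n] Q0 by (intro mult_right_mono) auto
      also have "\<dots> \<le> (4 / 4 ^ n) * Q u"
        using Q0 by (intro mult_right_mono divide_left_mono power_mono) auto
      also have "\<dots> = (sqrt (4 * Q u) * (1/2) ^ n)\<^sup>2"
        using Q0[of u] by (simp add: power_mult_distrib power_divide power_mult[symmetric] mult.commute[of n] power_mult)
      finally have "\<bar>ip (v n) u - ip w u\<bar> \<le> \<bar>sqrt (4 * Q u) * (1/2) ^ n\<bar>" by (simp only: abs_le_square_iff)
      then show "norm (ip (v n) u - ip w u) \<le> sqrt (4 * Q u) * (1/2) ^ n" using Q0[of u] by simp
    qed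
    ultimately have "(\<lambda>n. (T u - ip (v n) u) + (ip (v n) u - ip w u)) \<longlonglongrightarrow> 0 + 0" by (rule tendsto_add)
    then show ?thesis by (simp add: LIMSEQ_const_iff)
  qed
  have Qw: "Q w \<le> I + 4 / 16 ^ n" for n
  proof -
    \<comment> \<open>By \<open>Tw\<close> the cross term is \<open>T (v n)\<close>, so the squared
      distance equals \<open>Q w - J (v n)\<close>, and \<open>J\<close> is bounded by
      \<open>I\<close>.\<close>
    have "(\<integral>x. (v n x - w x)\<^sup>2 \<partial>M) = Q (v n) - 2 * (\<integral>x. v n x * w x \<partial>M) + Q w"
      using square_integrable_lincomb(2)[OF vm(1)[of n] vm(2)[of n] w(1,2), of 1 "-1"] by (simp add: Q_def)
    also have "(\<integral>x. v n x * w x \<partial>M) = T (v n)" using Tw[OF v(1)] by (simp add: ip_def mult.commute)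
    finally have "Q w = J (v n) + (\<integral>x. (v n x - w x)\<^sup>2 \<partial>M)" by (simp add: J_def)
    then show ?thesis using w(4)[of n] JI[OF v(1)[of n]] by linarith
  qed
  have lim: "(\<lambda>n. I + 4 * (1/16) ^ n) \<longlonglongrightarrow> I + 4 * 0"
    by (intro tendsto_intros LIMSEQ_power_zero) auto
  have "Q w \<le> I + 4 * 0"
    by (rule LIMSEQ_le_const[OF lim]) (use Qw in \<open>simp add: power_one_over\<close>)
  then have "Q w \<le> I" by simp
  then show ?thesis using w(1,2) Tw by (auto simp: Q_def ip_def)
qed

section \<open>Test functions and the measure away from zero\<close>

lemma C_c1_D:
  assumes "\<phi> \<in> C_c1"
  shows "(\<phi> has_real_derivative deriv \<phi> x) (at x)" "continuous_on UNIV (deriv \<phi>)"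
    "continuous_on UNIV \<phi>"
proof -
  show d: "(\<phi> has_real_derivative deriv \<phi> x) (at x)" for x
    using assms by (simp add: C_c1_def DERIV_deriv_iff_real_differentiable)
  show "continuous_on UNIV (deriv \<phi>)" using assms by (simp add: C_c1_def)
  show "continuous_on UNIV \<phi>"
    using d by (auto simp: continuous_on_eq_continuous_at intro: DERIV_isCont)
qed

lemma C_c1_measurable:
  assumes "\<phi> \<in> C_c1"
  shows "\<phi> \<in> borel_measurable borel" "deriv \<phi> \<in> borel_measurable borel"
  using C_c1_D[OF assms] by (auto intro: borel_measurable_continuous_onI)

text \<open>The constants on the far left and on the far right may differ, so \<phi> is bounded but
  need not vanish at infinity.\<close>

lemma C_c1_support:
  assumes "\<phi> \<in> C_c1"
  obtains R where "R > 0" "\<And>x. R \<le> \<bar>x\<bar> \<Longrightarrow> deriv \<phi> x = 0"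
    "\<And>x. x \<le> - R \<Longrightarrow> \<phi> x = \<phi> (- R)" "\<And>x. R \<le> x \<Longrightarrow> \<phi> x = \<phi> R"
proof -
  have "bounded (closure {x. deriv \<phi> x \<noteq> 0})"
    using assms by (simp add: C_c1_def compact_imp_bounded)
  then have "bounded {x. deriv \<phi> x \<noteq> 0}" by (rule bounded_subset) (rule closure_subset)
  then obtain B where B: "B > 0" "\<And>x. deriv \<phi> x \<noteq> 0 \<Longrightarrow> \<bar>x\<bar> \<le> B"
    unfolding bounded_pos by auto
  have z: "deriv \<phi> x = 0" if "B + 1 \<le> \<bar>x\<bar>" for x using B(2)[of x] that by fastforce
  have const: "\<phi> b = \<phi> a" if "a \<le> b" "\<And>x. a \<le> x \<Longrightarrow> x \<le> b \<Longrightarrow> B + 1 \<le> \<bar>x\<bar>" for a b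
  proof (cases "a < b")
    case True
    then obtain y where "a < y" "y < b" "\<phi> b - \<phi> a = (b - a) * deriv \<phi> y"
      using MVT2[OF True, of \<phi> "deriv \<phi>"] C_c1_D(1)[OF assms] by blast
    then show ?thesis using z[of y] that(2)[of y] by simp
  qed (use that in simp)
  show ?thesis
  proof
    show "B + 1 > 0" using B by simp
    show "\<phi> x = \<phi> (- (B + 1))" if "x \<le> - (B + 1)" for x
      using const[of x "- (B + 1)"] that B by simp
    show "\<phi> x = \<phi> (B + 1)" if "B + 1 \<le> x" for x
      using const[of "B + 1" x] that by simp
  qed (rule z)
qed

lemma C_c1_bounded:
  assumes "\<phi> \<in> C_c1"
  obtains K where "\<And>x. \<bar>\<phi> x\<bar> \<le> K" "\<And>x. \<bar>deriv \<phi> x\<bar> \<le> K" "\<And>x. \<bar>x * deriv \<phi> x\<bar> \<le> K"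
proof -
  obtain R where R: "R > 0" "\<And>x. R \<le> \<bar>x\<bar> \<Longrightarrow> deriv \<phi> x = 0"
    "\<And>x. x \<le> - R \<Longrightarrow> \<phi> x = \<phi> (- R)" "\<And>x. R \<le> x \<Longrightarrow> \<phi> x = \<phi> R"
    using C_c1_support[OF assms] by blast
  have bd: "\<exists>K. \<forall>x\<in>{-R..R}. \<bar>f x\<bar> \<le> K" if "continuous_on UNIV f" for f :: "real \<Rightarrow> real"
  proof -
    have "compact (f ` {-R..R})"
      using that by (intro compact_continuous_image continuous_on_subset[OF that]) auto
    then show ?thesis using compact_imp_bounded by (fastforce simp: bounded_iff)
  qed
  obtain K1 where K1: "\<And>x. x \<in> {-R..R} \<Longrightarrow> \<bar>\<phi> x\<bar> \<le> K1" using bd[OF C_c1_D(3)[OF assms]] by blast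
  obtain K2 where K2: "\<And>x. x \<in> {-R..R} \<Longrightarrow> \<bar>deriv \<phi> x\<bar> \<le> K2" using bd[OF C_c1_D(2)[OF assms]] by blast
  have "continuous_on UNIV (\<lambda>x. x * deriv \<phi> x)" by (intro continuous_intros C_c1_D(2)[OF assms])
  from bd[OF this] obtain K3 where K3: "\<And>x. x \<in> {-R..R} \<Longrightarrow> \<bar>x * deriv \<phi> x\<bar> \<le> K3" by blast
  define K where "K = max K1 (max K2 (max K3 0))"
  have K: "K1 \<le> K" "K2 \<le> K" "K3 \<le> K" "0 \<le> K" by (auto simp: K_def)
  show ?thesis
  proof
    fix x
    have out: "x \<le> - R \<or> R \<le> x" "R \<le> \<bar>x\<bar>" if "x \<notin> {-R..R}" using that by auto
    have ends: "\<bar>\<phi> R\<bar> \<le> K1" "\<bar>\<phi> (- R)\<bar> \<le> K1" using K1[of R] K1[of "- R"] R(1) by simp_all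
    show "\<bar>\<phi> x\<bar> \<le> K"
    proof (cases "x \<in> {-R..R}")
      case True
      then show ?thesis using K1[OF True] K(1) by linarith
    next
      case False
      then have "\<phi> x = \<phi> R \<or> \<phi> x = \<phi> (- R)" using out(1)[OF False] R(3)[of x] R(4)[of x] by blast
      then show ?thesis using ends K(1) by (elim disjE) simp_all
    qed
    show "\<bar>deriv \<phi> x\<bar> \<le> K"
      using K2[of x] R(2)[OF out(2)] K by (cases "x \<in> {-R..R}") simp_all
    show "\<bar>x * deriv \<phi> x\<bar> \<le> K"
      using K3[of x] R(2)[OF out(2)] K by (cases "x \<in> {-R..R}") simp_all
  qed
qed

lemma C_c1_lincomb:
  assumes "\<phi> \<in> C_c1" "\<psi> \<in> C_c1"
  shows "(\<lambda>x. a * \<phi> x + b * \<psi> x) \<in> C_c1"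
    and "deriv (\<lambda>x. a * \<phi> x + b * \<psi> x) = (\<lambda>x. a * deriv \<phi> x + b * deriv \<psi> x)"
proof -
  have d: "((\<lambda>x. a * \<phi> x + b * \<psi> x) has_real_derivative (a * deriv \<phi> x + b * deriv \<psi> x)) (at x)" for x
    using C_c1_D(1)[OF assms(1)] C_c1_D(1)[OF assms(2)] by (auto intro!: derivative_eq_intros)
  show eq: "deriv (\<lambda>x. a * \<phi> x + b * \<psi> x) = (\<lambda>x. a * deriv \<phi> x + b * deriv \<psi> x)"
    using d by (auto intro: DERIV_imp_deriv)
  have "bounded ({x. deriv \<phi> x \<noteq> 0} \<union> {x. deriv \<psi> x \<noteq> 0})"
    using assms by (simp add: C_c1_def)
  then have "bounded {x. a * deriv \<phi> x + b * deriv \<psi> x \<noteq> 0}" by (rule bounded_subset) auto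
  then show "(\<lambda>x. a * \<phi> x + b * \<psi> x) \<in> C_c1"
    unfolding C_c1_def mem_Collect_eq eq
    using d C_c1_D(2)[OF assms(1)] C_c1_D(2)[OF assms(2)]
    by (auto simp: real_differentiable_def intro!: continuous_intros)
qed

lemma C_c1_I:
  assumes "\<And>x. (\<phi> has_real_derivative \<psi> x) (at x)" "continuous_on UNIV \<psi>" "\<And>x. x \<notin> {a..b} \<Longrightarrow> \<psi> x = 0"
  shows "\<phi> \<in> C_c1" "deriv \<phi> = \<psi>"
proof -
  show eq: "deriv \<phi> = \<psi>" using assms(1) by (auto intro: DERIV_imp_deriv)
  have "{x. \<psi> x \<noteq> 0} \<subseteq> {a..b}" using assms(3) by blast
  then have "bounded {x. \<psi> x \<noteq> 0}" by (rule bounded_subset[rotated]) simp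
  then show "\<phi> \<in> C_c1" unfolding C_c1_def mem_Collect_eq eq
    using assms by (auto simp: real_differentiable_def)
qed

lemma one_in_C_c1: "(\<lambda>x. 1) \<in> C_c1"
  by (rule C_c1_I[where \<psi> = "\<lambda>x. 0" and a = 0 and b = 0]) auto

section \<open>The measure off zero, and exchange of integrals\<close>

lemma remove_zero_mass_eq:
  assumes "real_distribution F"
  shows "remove_zero_mass F = density F (indicator (- {0}))"
proof -
  interpret real_distribution F by fact
  let ?D = "scale_measure (emeasure F {0}) (return borel (0::real))"
  have D: "emeasure ?D A = emeasure F {0} * indicator A 0" if "A \<in> sets borel" for A
    using that by simp
  have fD: "finite_measure ?D"
  proof (rule finite_measureI)
    have "emeasure ?D (space ?D) = emeasure ?D UNIV" by (simp add: space_scale_measure)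
    also have "\<dots> \<noteq> \<infinity>" by (subst D) simp_all
    finally show "emeasure ?D (space ?D) \<noteq> \<infinity>" .
  qed
  have le: "emeasure ?D A \<le> emeasure F A" if "A \<in> sets F" for A
  proof (cases "0 \<in> A")
    case True
    then show ?thesis using that by (subst D) (auto intro!: emeasure_mono)
  next
    case False
    then show ?thesis using that by (subst D) auto
  qed
  show ?thesis
  proof (rule measure_eqI)
    show "sets (remove_zero_mass F) = sets (density F (indicator (- {0})))"
      by (simp add: remove_zero_mass_def)
    fix A assume "A \<in> sets (remove_zero_mass F)"
    then have A: "A \<in> sets F" "A \<in> sets borel" by (auto simp: remove_zero_mass_def)
    have "emeasure (remove_zero_mass F) A = emeasure F A - emeasure ?D A"
      unfolding remove_zero_mass_def
      by (rule emeasure_diff_measure[OF _ fD _ le A(1)]) (auto simp: finite_measure_axioms)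
    also have "\<dots> = emeasure F (A - {0})"
    proof (cases "0 \<in> A")
      case True
      have "emeasure F (A - {0}) = emeasure F A - emeasure F {0}"
        using True A by (intro emeasure_Diff) auto
      then show ?thesis using True A by (subst D) auto
    next
      case False
      then have "A - {0} = A" by auto
      then show ?thesis using False A by (subst D) auto
    qed
    also have "\<dots> = emeasure (density F (indicator (- {0}))) A"
    proof -
      have "emeasure (density F (indicator (- {0}))) A = (\<integral>\<^sup>+x. indicator (- {0}) x * indicator A x \<partial>F)"
        using A by (intro emeasure_density) auto
      also have "\<dots> = (\<integral>\<^sup>+x. indicator (A - {0}) x \<partial>F)"
        by (intro nn_integral_cong) (auto simp: indicator_def)
      also have "\<dots> = emeasure F (A - {0})" using A by simp
      finally show ?thesis by simp
    qed
    finally show "emeasure (remove_zero_mass F) A = emeasure (density F (indicator (- {0}))) A" .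
  qed
qed

lemma real_distribution_sets: "real_distribution F \<Longrightarrow> sets F = sets borel"
  using real_distribution.events_eq_borel by blast

lemma
  fixes g :: "real \<Rightarrow> real"
  assumes "real_distribution F" and g[measurable]: "g \<in> borel_measurable borel"
  shows integral_remove_zero_mass: "(\<integral>x. g x \<partial>remove_zero_mass F) = (\<integral>x. indicator (- {0}) x * g x \<partial>F)"
    and integrable_remove_zero_mass: "integrable (remove_zero_mass F) g \<longleftrightarrow> integrable F (\<lambda>x. indicator (- {0}) x * g x)"
proof -
  note [measurable_cong] = real_distribution_sets[OF assms(1)]
  have eq: "remove_zero_mass F = density F (\<lambda>x. ennreal (indicator (- {0}) x))"
    unfolding remove_zero_mass_eq[OF assms(1)] by (simp add: ennreal_indicator[abs_def])
  show "(\<integral>x. g x \<partial>remove_zero_mass F) = (\<integral>x. indicator (- {0}) x * g x \<partial>F)"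
    unfolding eq by (subst integral_density) auto
  show "integrable (remove_zero_mass F) g \<longleftrightarrow> integrable F (\<lambda>x. indicator (- {0}) x * g x)"
    unfolding eq by (subst integrable_density) auto
qed

lemma finite_measure_remove_zero_mass:
  assumes "real_distribution F"
  shows "finite_measure (remove_zero_mass F)" "sets (remove_zero_mass F) = sets borel"
proof -
  interpret real_distribution F by fact
  show "finite_measure (remove_zero_mass F)"
    unfolding remove_zero_mass_eq[OF assms]
    by (rule finite_measureI) (simp add: emeasure_density)
  show "sets (remove_zero_mass F) = sets borel"
    unfolding remove_zero_mass_eq[OF assms] by simp
qed

text \<open>This is integration by parts without smoothness. With an interval indicator for \<psi>
  it produces the density; with the derivative of a test function it leads back to the score. Both
  half-lines are open because both encode \<open>y < x\<close>, which keeps atoms of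
  \<open>M\<close> consistent.\<close>

lemma Fubini_tail:
  fixes w \<psi> :: "real \<Rightarrow> real"
  assumes fin: "finite_measure M" and sets[measurable_cong]: "sets M = sets borel"
    and w: "integrable M w" and \<psi>: "integrable lborel \<psi>"
  shows "(\<integral>y. \<psi> y * (\<integral>x. indicator {y<..} x * w x \<partial>M) \<partial>lborel) =
         (\<integral>x. w x * (\<integral>y. indicator {..<x} y * \<psi> y \<partial>lborel) \<partial>M)"
proof -
  interpret M: finite_measure M by fact
  interpret P: pair_sigma_finite M "lborel :: real measure" ..
  have wm[measurable]: "w \<in> borel_measurable borel" 
    using borel_measurable_integrable[OF w] by (simp add: measurable_cong_sets[OF sets refl])
  have \<psi>m[measurable]: "\<psi> \<in> borel_measurable borel" using \<psi> by auto
  let ?f = "\<lambda>x y. (if y < x then 1 else 0) * (w x * \<psi> y)"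
  have int: "integrable (M \<Otimes>\<^sub>M lborel) (case_prod ?f)"
  proof (rule Bochner_Integration.integrable_bound)
    show "integrable (M \<Otimes>\<^sub>M lborel) (\<lambda>(x, y). w x * \<psi> y)"
    proof (rule P.Fubini_integrable)
      show "integrable M (\<lambda>x. \<integral>y. norm (case (x, y) of (x, y) \<Rightarrow> w x * \<psi> y) \<partial>lborel)"
        using w by (simp add: abs_mult)
      show "AE x in M. integrable lborel (\<lambda>y. case (x, y) of (x, y) \<Rightarrow> w x * \<psi> y)"
        using \<psi> by simp
    qed measurable
  qed (measurable, auto)
  have "(\<integral>y. (\<integral>x. ?f x y \<partial>M) \<partial>lborel) = (\<integral>x. (\<integral>y. ?f x y \<partial>lborel) \<partial>M)"
    by (rule P.Fubini_integral[OF int])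
  moreover have "(\<integral>x. ?f x y \<partial>M) = \<psi> y * (\<integral>x. indicator {y<..} x * w x \<partial>M)" for y
  proof -
    have "(\<lambda>x. ?f x y) = (\<lambda>x. \<psi> y * (indicator {y<..} x * w x))" by (auto simp: indicator_def)
    then show ?thesis by simp
  qed
  moreover have "(\<integral>y. ?f x y \<partial>lborel) = w x * (\<integral>y. indicator {..<x} y * \<psi> y \<partial>lborel)" for x
  proof -
    have "(\<lambda>y. ?f x y) = (\<lambda>y. w x * (indicator {..<x} y * \<psi> y))" by (auto simp: indicator_def)
    then show ?thesis by simp
  qed
  ultimately show ?thesis by simp
qed

text \<open>Split at height \<open>n\<close>: the part of \<bar>h\<bar> above it has integral below
  \<epsilon> / 2, and the rest contributes at most \<open>n\<close> times the total length.\<close>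

lemma abs_continuous_fun_indefinite_integral:
  fixes h G :: "real \<Rightarrow> real"
  assumes h: "integrable lborel h"
    and G: "\<And>a b. a \<le> b \<Longrightarrow> G b - G a = (LINT x:{a<..b}|lborel. h x)"
  shows "abs_continuous_fun G"
proof (rule abs_continuous_funI)
  fix \<epsilon> :: real assume \<epsilon>: "\<epsilon> > 0"
  have [measurable]: "h \<in> borel_measurable borel" using h by auto
  let ?k = "\<lambda>n x. (if \<bar>h x\<bar> > real n then \<bar>h x\<bar> else 0)"
  have "(\<lambda>n. \<integral>x. ?k n x \<partial>lborel) \<longlonglongrightarrow> (\<integral>x. 0 \<partial>(lborel :: real measure))"
  proof (rule integral_dominated_convergence[where w = "\<lambda>x. \<bar>h x\<bar>"])
    show "AE x in lborel. (\<lambda>n. ?k n x) \<longlonglongrightarrow> 0"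
    proof (rule AE_I2)
      fix x
      obtain N :: nat where "\<bar>h x\<bar> < real N" using reals_Archimedean2 by blast
      then have "\<forall>\<^sub>F n in sequentially. ?k n x = 0"
        unfolding eventually_sequentially by (intro exI[of _ N]) auto
      then show "(\<lambda>n. ?k n x) \<longlonglongrightarrow> 0" by (rule tendsto_eventually)
    qed
  qed (use h in auto)
  then have "\<forall>\<^sub>F n in sequentially. (\<integral>x. ?k n x \<partial>lborel) < \<epsilon> / 2"
    using \<epsilon> by (intro order_tendstoD) auto
  then obtain n where n: "(\<integral>x. ?k n x \<partial>lborel) < \<epsilon> / 2" by (auto simp: eventually_sequentially)
  have ki: "integrable lborel (?k n)"
    by (rule Bochner_Integration.integrable_bound[OF integrable_abs[OF h]]) auto
  \<comment> \<open>Chosen so that \<open>real n * \<delta>\<close> is at most \<epsilon> / 2; the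
    added 1 covers \<open>n = 0\<close>.\<close>
  define \<delta> where "\<delta> = \<epsilon> / (2 * (real n + 1))"
  have \<delta>: "\<delta> > 0" using \<epsilon> by (simp add: \<delta>_def)
  have main: "(\<Sum>(a, b)\<in>S. \<bar>G b - G a\<bar>) < \<epsilon>" if S: "segments S" "(\<Sum>(a, b)\<in>S. b - a) < \<delta>" for S
  proof -
    let ?I = "\<lambda>p. case p of (a, b) \<Rightarrow> {a<..b::real}"
    have piece: "\<bar>G b - G a\<bar> \<le> (\<integral>x. indicator {a<..b} x * ?k n x \<partial>lborel) + real n * (b - a)" if "a \<le> b" for a b
    proof -
      have i1: "integrable lborel (\<lambda>x. indicator {a<..b} x * ?k n x)"
        using integrable_mult_indicator[OF _ ki, of "{a<..b}"] by simp
      have i2: "integrable lborel (\<lambda>x. real n * indicator {a<..b} x)"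
        by (intro integrable_mult_right integrable_real_indicator) (use that in \<open>auto simp: emeasure_lborel_Ioc\<close>)
      have "\<bar>G b - G a\<bar> = \<bar>\<integral>x. indicator {a<..b} x * h x \<partial>lborel\<bar>"
        using G[OF that] by (simp add: set_lebesgue_integral_def)
      also have "\<dots> \<le> (\<integral>x. \<bar>indicator {a<..b} x * h x\<bar> \<partial>lborel)" by (rule integral_abs_bound)
      also have "\<dots> \<le> (\<integral>x. indicator {a<..b} x * ?k n x + real n * indicator {a<..b} x \<partial>lborel)"
      proof (rule integral_mono)
        show "integrable lborel (\<lambda>x. \<bar>indicator {a<..b} x * h x\<bar>)"
          using integrable_abs[OF integrable_mult_indicator[OF _ h, of "{a<..b}"]] by simp
      qed (use i1 i2 in \<open>auto simp: indicator_def\<close>)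
      also have "\<dots> = (\<integral>x. indicator {a<..b} x * ?k n x \<partial>lborel) + real n * (b - a)"
        using i1 i2 that by simp
      finally show ?thesis .
    qed
    have "(\<Sum>(a, b)\<in>S. \<bar>G b - G a\<bar>) \<le> (\<Sum>p\<in>S. (\<integral>x. indicator (?I p) x * ?k n x \<partial>lborel) + real n * (snd p - fst p))"
    proof (rule sum_mono)
      fix p assume "p \<in> S"
      then show "(case p of (a, b) \<Rightarrow> \<bar>G b - G a\<bar>) \<le> (\<integral>x. indicator (?I p) x * ?k n x \<partial>lborel) + real n * (snd p - fst p)"
        using piece[of "fst p" "snd p"] segments_le[OF S(1), of "fst p" "snd p"] by (cases p) simp
    qed
    also have "\<dots> = (\<integral>x. (\<Sum>p\<in>S. indicator (?I p) x * ?k n x) \<partial>lborel) + real n * (\<Sum>p\<in>S. snd p - fst p)"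
    proof -
      have "(\<integral>x. (\<Sum>p\<in>S. indicator (?I p) x * ?k n x) \<partial>lborel) = (\<Sum>p\<in>S. \<integral>x. indicator (?I p) x * ?k n x \<partial>lborel)"
      proof (rule Bochner_Integration.integral_sum)
        fix p
        have "?I p \<in> sets lborel" by (cases p) simp
        then show "integrable lborel (\<lambda>x. indicator (?I p) x * ?k n x)"
          using integrable_mult_indicator[OF _ ki, of "?I p"] by simp
      qed
      then show ?thesis by (simp add: sum.distrib sum_distrib_left)
    qed
    also have "(\<integral>x. (\<Sum>p\<in>S. indicator (?I p) x * ?k n x) \<partial>lborel) = (\<integral>x. indicator (\<Union>p\<in>S. ?I p) x * ?k n x \<partial>lborel)"
    proof (rule Bochner_Integration.integral_cong[OF refl])
      fix x
      have "indicator (\<Union>p\<in>S. ?I p) x = (\<Sum>p\<in>S. indicator (?I p) x :: real)"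
        using S(1) by (intro indicator_UN_disjoint) (auto simp: segments_def)
      then show "(\<Sum>p\<in>S. indicator (?I p) x * ?k n x) = indicator (\<Union>p\<in>S. ?I p) x * ?k n x"
        by (simp add: sum_distrib_right)
    qed
    also have "\<dots> \<le> (\<integral>x. ?k n x \<partial>lborel)"
    proof (rule integral_mono[OF _ ki])
      have "(\<Union>p\<in>S. ?I p) \<in> sets lborel"
        by (rule sets.finite_UN[OF segments_finite[OF S(1)]]) (auto simp: case_prod_unfold)
      then show "integrable lborel (\<lambda>x. indicator (\<Union>p\<in>S. ?I p) x * ?k n x)"
        using integrable_mult_indicator[OF _ ki, of "\<Union>p\<in>S. ?I p"] by simp
    qed (auto simp: indicator_def)
    also have "real n * (\<Sum>p\<in>S. snd p - fst p) \<le> real n * \<delta>"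
      using S(2) by (intro mult_left_mono) (auto simp: case_prod_unfold)
    also have "real n * \<delta> \<le> \<epsilon> / 2" using \<epsilon> by (simp add: \<delta>_def field_simps)
    finally show ?thesis using n by simp
  qed
  show "\<exists>\<delta>>0. \<forall>S. segments S \<longrightarrow> (\<Sum>(a, b)\<in>S. b - a) < \<delta> \<longrightarrow> (\<Sum>(a, b)\<in>S. \<bar>G b - G a\<bar>) < \<epsilon>"
    by (intro exI[of _ \<delta>] conjI allI impI main \<delta>)
qed

section \<open>Finite information yields a regular density\<close>

text \<open>\<open>ramp n\<close> is a \<open>C\<^sup>1\<close> approximation of the positive part, with derivative \<open>ramp' n\<close> rising
  linearly from \<open>0\<close> to \<open>1\<close> on an interval of length \<open>1 / (n + 1)\<close>.\<close>

definition ramp :: "nat \<Rightarrow> real \<Rightarrow> real" where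
  "ramp n x = (real n + 1) / 2 * ((max 0 x)\<^sup>2 - (max 0 (x - inverse (real n + 1)))\<^sup>2)"

definition ramp' :: "nat \<Rightarrow> real \<Rightarrow> real" where
  "ramp' n x = (real n + 1) * (max 0 x - max 0 (x - inverse (real n + 1)))"

lemma DERIV_pos_part_square: "((\<lambda>x. (max 0 x)\<^sup>2 / 2) has_real_derivative max 0 x) (at x)" for x :: real
proof (cases x "0 :: real" rule: linorder_cases)
  case less
  have "((\<lambda>x. 0) has_real_derivative 0) (at x)" by simp
  then have "((\<lambda>x. (max 0 x)\<^sup>2 / 2) has_real_derivative 0) (at x)"
    by (rule has_field_derivative_transform_within_open[of _ _ _ "{..<0}"]) (use less in auto)
  then show ?thesis using less by simp
next
  case greater
  have "((\<lambda>x. x\<^sup>2 / 2) has_real_derivative x) (at x)" by (auto intro!: derivative_eq_intros)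
  then have "((\<lambda>x. (max 0 x)\<^sup>2 / 2) has_real_derivative x) (at x)"
    by (rule has_field_derivative_transform_within_open[of _ _ _ "{0<..}"]) (use greater in auto)
  then show ?thesis using greater by simp
next
  case equal
  have "((\<lambda>h. (max 0 h)\<^sup>2 / 2 / h) \<longlongrightarrow> 0) (at (0::real))"
  proof (rule Lim_null_comparison)
    show "\<forall>\<^sub>F h in at (0::real). norm ((max 0 h)\<^sup>2 / 2 / h) \<le> \<bar>h\<bar>"
      by (rule always_eventually) (auto simp: max_def power2_eq_square abs_mult)
    show "((\<lambda>h. \<bar>h\<bar>) \<longlongrightarrow> 0) (at (0::real))" using tendsto_rabs_zero[OF tendsto_ident_at] by simp
  qed
  then show ?thesis using equal by (simp add: DERIV_def)
qed

lemma DERIV_ramp: "(ramp n has_real_derivative ramp' n x) (at x)"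
proof -
  let ?c = "inverse (real n + 1)"
  have 1: "((\<lambda>x. (max 0 (x - ?c))\<^sup>2 / 2) has_real_derivative max 0 (x - ?c)) (at x)"
    using DERIV_shift[of "\<lambda>x. (max 0 x)\<^sup>2 / 2" "max 0 (x - ?c)" x "- ?c"] DERIV_pos_part_square[of "x - ?c"]
    by simp
  have "((\<lambda>x. (real n + 1) * ((max 0 x)\<^sup>2 / 2 - (max 0 (x - ?c))\<^sup>2 / 2)) has_real_derivative
      (real n + 1) * (max 0 x - max 0 (x - ?c))) (at x)"
    by (intro DERIV_cmult DERIV_diff DERIV_pos_part_square 1)
  moreover have "(\<lambda>x. (real n + 1) * ((max 0 x)\<^sup>2 / 2 - (max 0 (x - ?c))\<^sup>2 / 2)) = ramp n"
    by (auto simp: ramp_def diff_divide_distrib right_diff_distrib)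
  ultimately show ?thesis by (simp add: ramp'_def)
qed

lemma continuous_ramp': "continuous_on A (\<lambda>x. ramp' n (f x))" if "continuous_on A f"
  unfolding ramp'_def using that by (intro continuous_intros)

lemma ramp'_bounds: "0 \<le> ramp' n x" "ramp' n x \<le> 1" "x \<le> 0 \<Longrightarrow> ramp' n x = 0" "x \<ge> inverse (real n + 1) \<Longrightarrow> ramp' n x = 1"
proof -
  define c where "c = inverse (real n + 1)"
  have c: "c > 0" and cn: "real n + 1 = 1 / c" by (auto simp: c_def field_simps)
  have r: "ramp' n x = (max 0 x - max 0 (x - c)) / c"
    unfolding ramp'_def c_def[symmetric] unfolding cn by simp
  show "0 \<le> ramp' n x" "ramp' n x \<le> 1" "x \<le> 0 \<Longrightarrow> ramp' n x = 0" "x \<ge> inverse (real n + 1) \<Longrightarrow> ramp' n x = 1"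
    unfolding c_def[symmetric] using c by (auto simp: r max_def divide_le_eq)
qed

lemma ramp'_limit: "(\<lambda>n. ramp' n x) \<longlonglongrightarrow> (if x > 0 then 1 else 0)"
proof (rule tendsto_eventually)
  show "\<forall>\<^sub>F n in sequentially. ramp' n x = (if x > 0 then 1 else 0)"
  proof (cases "x > 0")
    case True
    have "\<forall>\<^sub>F n in sequentially. inverse (real (Suc n)) < x"
      using LIMSEQ_inverse_real_of_nat True by (rule order_tendstoD)
    then show ?thesis
    proof eventually_elim
      case (elim n)
      then show ?case using ramp'_bounds(4)[of n x] True by (simp add: add.commute)
    qed
  qed (simp add: ramp'_bounds(3))
qed

lemma ramp_approx: "\<bar>ramp n x - max 0 x\<bar> \<le> inverse (real n + 1)"
proof -
  define c where "c = inverse (real n + 1)"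
  have c: "c > 0" and cn: "real n + 1 = 1 / c" by (auto simp: c_def field_simps)
  have r: "ramp n x = ((max 0 x)\<^sup>2 - (max 0 (x - c))\<^sup>2) / (2 * c)"
    unfolding ramp_def c_def[symmetric] unfolding cn by (simp add: field_simps)
  consider "x \<le> 0" | "0 < x" "x \<le> c" | "c < x" by linarith
  then have "\<bar>ramp n x - max 0 x\<bar> \<le> c"
  proof cases
    case 1 then show ?thesis using c by (simp add: r)
  next
    case 2
    have "ramp n x - max 0 x = x * (x / (2 * c) - 1)"
      using 2 c by (simp add: r power2_eq_square field_simps)
    also have "\<bar>\<dots>\<bar> = x * \<bar>x / (2 * c) - 1\<bar>" using 2 by (simp add: abs_mult)
    also have "\<dots> \<le> c * 1"
      using 2 c by (intro mult_mono) (auto simp: abs_le_iff field_simps)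
    finally show ?thesis by simp
  next
    case 3
    have "ramp n x - max 0 x = - c / 2"
      using 3 c by (simp add: r power2_eq_square field_simps)
    then show ?thesis using c by simp
  qed
  then show ?thesis by (simp add: c_def)
qed

text \<open>The derivatives of the test functions tend to the indicator of the half-open interval at
  every point, so atoms of F at the endpoints cause no error. The test functions themselves converge
  uniformly to the clipped ramp \<open>r\<close>.\<close>

lemma score_identity_interval:
  fixes F :: "real measure" and w :: "real \<Rightarrow> real"
  assumes F: "real_distribution F" and w: "integrable F w"
    and T: "\<And>\<phi>. \<phi> \<in> C_c1 \<Longrightarrow> (\<integral>x. x * deriv \<phi> x \<partial>F) = (\<integral>x. w x * \<phi> x \<partial>F)"
    and ab: "a \<le> b"
  shows "(\<integral>x. x * indicator {a<..b} x \<partial>F) = (\<integral>y. indicator {a<..b} y * (\<integral>x. indicator {y<..} x * w x \<partial>F) \<partial>lborel)"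
proof -
  interpret real_distribution F by fact
  note [measurable_cong] = events_eq_borel
  have wm[measurable]: "w \<in> borel_measurable borel"
    using borel_measurable_integrable[OF w] by (simp add: measurable_cong_sets[OF events_eq_borel refl])
  define \<phi> where "\<phi> n x = ramp n (x - a) - ramp n (x - b)" for n x
  define \<psi> where "\<psi> n x = ramp' n (x - a) - ramp' n (x - b)" for n x
  have d: "(\<phi> n has_real_derivative \<psi> n x) (at x)" for n x
  proof -
    have "((\<lambda>x. ramp n (x - c)) has_real_derivative ramp' n (x - c)) (at x)" for c
      using DERIV_shift[of "ramp n" "ramp' n (x - c)" x "- c"] DERIV_ramp[of n "x - c"] by simp
    then show ?thesis unfolding \<phi>_def[abs_def] \<psi>_def by (intro DERIV_diff)
  qed
  have cont: "continuous_on UNIV (\<psi> n)" for n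
    unfolding \<psi>_def[abs_def] by (intro continuous_intros continuous_ramp')
  \<comment> \<open>Each rise takes length at most 1, so \<open>b + 1\<close> bounds the supports
    for all \<open>n\<close>.\<close>
  have supp: "\<psi> n x = 0" if "x \<notin> {a..b + 1}" for n x
  proof -
    have "inverse (real n + 1) \<le> 1" by (simp add: field_simps)
    then show ?thesis
      using that ab ramp'_bounds(3)[of "x - a" n] ramp'_bounds(3)[of "x - b" n]
        ramp'_bounds(4)[of n "x - a"] ramp'_bounds(4)[of n "x - b"]
      by (cases "x < a") (auto simp: \<psi>_def)
  qed
  have C: "\<phi> n \<in> C_c1" "deriv (\<phi> n) = \<psi> n" for n
    using C_c1_I[OF d cont supp] by auto
  note [measurable] = C_c1_measurable(1)[OF C(1)]
  have [measurable]: "\<psi> n \<in> borel_measurable borel" for n using cont by (rule borel_measurable_continuous_onI)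
  define r where "r x = max 0 (x - a) - max 0 (x - b)" for x :: real
  have [measurable]: "r \<in> borel_measurable borel" by (simp add: r_def[abs_def])
  have r_bound: "\<bar>r x\<bar> \<le> b - a" for x using ab by (auto simp: r_def max_def)
  have \<phi>r: "\<bar>\<phi> n x - r x\<bar> \<le> 2 * inverse (real n + 1)" for n x
    using ramp_approx[of n "x - a"] ramp_approx[of n "x - b"] by (simp add: \<phi>_def r_def)
  have lim1: "(\<lambda>n. \<integral>x. x * \<psi> n x \<partial>F) \<longlonglongrightarrow> (\<integral>x. x * indicator {a<..b} x \<partial>F)"
  proof (rule integral_dominated_convergence[where w = "\<lambda>x. \<bar>a\<bar> + \<bar>b\<bar> + 1"])
    show "AE x in F. (\<lambda>n. x * \<psi> n x) \<longlonglongrightarrow> x * indicator {a<..b} x"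
    proof (rule AE_I2)
      fix x
      have "(\<lambda>n. x * \<psi> n x) \<longlonglongrightarrow> x * ((if x - a > 0 then 1 else 0) - (if x - b > 0 then 1 else 0))"
        unfolding \<psi>_def by (intro tendsto_intros ramp'_limit)
      also have "x * ((if x - a > 0 then 1 else 0) - (if x - b > 0 then 1 else 0)) = x * indicator {a<..b} x"
        using ab by (auto simp: indicator_def)
      finally show "(\<lambda>n. x * \<psi> n x) \<longlonglongrightarrow> x * indicator {a<..b} x" .
    qed
    show "AE x in F. norm (x * \<psi> n x) \<le> \<bar>a\<bar> + \<bar>b\<bar> + 1" for n
    proof (rule AE_I2)
      fix x
      show "norm (x * \<psi> n x) \<le> \<bar>a\<bar> + \<bar>b\<bar> + 1"
      proof (cases "x \<in> {a..b + 1}")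
        case True
        have "\<bar>x * \<psi> n x\<bar> = \<bar>x\<bar> * \<bar>\<psi> n x\<bar>" by (rule abs_mult)
        also have "\<dots> \<le> (\<bar>a\<bar> + \<bar>b\<bar> + 1) * 1"
          using True ramp'_bounds(1,2)[of n "x - a"] ramp'_bounds(1,2)[of n "x - b"]
          by (intro mult_mono) (auto simp: \<psi>_def)
        finally show ?thesis by simp
      qed (simp add: supp)
    qed
  qed auto
  have lim2: "(\<lambda>n. \<integral>x. w x * \<phi> n x \<partial>F) \<longlonglongrightarrow> (\<integral>x. w x * r x \<partial>F)"
  proof (rule integral_dominated_convergence[where w = "\<lambda>x. \<bar>w x\<bar> * (b - a + 2)"])
    show "AE x in F. (\<lambda>n. w x * \<phi> n x) \<longlonglongrightarrow> w x * r x"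
    proof (rule AE_I2)
      fix x
      have "(\<lambda>n. \<phi> n x - r x) \<longlonglongrightarrow> 0"
      proof (rule Lim_null_comparison)
        show "\<forall>\<^sub>F n in sequentially. norm (\<phi> n x - r x) \<le> 2 * inverse (real (Suc n))"
          using \<phi>r by (simp add: add.commute)
        show "(\<lambda>n. 2 * inverse (real (Suc n))) \<longlonglongrightarrow> 0"
          using tendsto_mult_right_zero[OF LIMSEQ_inverse_real_of_nat] by simp
      qed
      then have "(\<lambda>n. \<phi> n x) \<longlonglongrightarrow> r x" by (simp add: LIM_zero_iff)
      then show "(\<lambda>n. w x * \<phi> n x) \<longlonglongrightarrow> w x * r x" by (intro tendsto_intros)
    qed
    show "AE x in F. norm (w x * \<phi> n x) \<le> \<bar>w x\<bar> * (b - a + 2)" for n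
    proof (rule AE_I2)
      fix x
      have "2 * inverse (real n + 1) \<le> 2" by (simp add: field_simps)
      then have "\<bar>\<phi> n x\<bar> \<le> b - a + 2" using \<phi>r[of n x] r_bound[of x] by linarith
      then show "norm (w x * \<phi> n x) \<le> \<bar>w x\<bar> * (b - a + 2)" by (simp add: abs_mult mult_left_mono)
    qed
  qed (use w in auto)
  have "(\<lambda>n. \<integral>x. x * \<psi> n x \<partial>F) = (\<lambda>n. \<integral>x. w x * \<phi> n x \<partial>F)"
    using T[OF C(1)] C(2) by simp
  with lim1 lim2 have "(\<integral>x. x * indicator {a<..b} x \<partial>F) = (\<integral>x. w x * r x \<partial>F)"
    by (metis LIMSEQ_unique)
  \<comment> \<open>\<open>r x\<close> is the length of the part of \<open>{a<..b}\<close> to the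
    left of \<open>x\<close>; in this form the integrals can be exchanged.\<close>
  also have "\<dots> = (\<integral>x. w x * (\<integral>y. indicator {..<x} y * indicator {a<..b} y \<partial>lborel) \<partial>F)"
  proof -
    have "(\<integral>y. indicator {..<x} y * indicator {a<..b} y \<partial>lborel) = r x" for x :: real
    proof -
      consider "x \<le> a" | "a < x" "x \<le> b" | "b < x" by linarith
      then show ?thesis
      proof cases
        case 1
        then have "(\<lambda>y. indicator {..<x} y * indicator {a<..b} y) = (\<lambda>y. 0 :: real)"
          by (auto simp: indicator_def)
        then show ?thesis using 1 ab by (simp add: r_def)
      next
        case 2
        then have "(\<lambda>y. indicator {..<x} y * indicator {a<..b} y) = (indicator {a<..<x} :: real \<Rightarrow> real)"
          by (auto simp: indicator_def)
        then show ?thesis using 2 by (simp add: r_def)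
      next
        case 3
        then have "(\<lambda>y. indicator {..<x} y * indicator {a<..b} y) = (indicator {a<..b} :: real \<Rightarrow> real)"
          by (auto simp: indicator_def)
        then show ?thesis using 3 ab by (simp add: r_def)
      qed
    qed
    then show ?thesis by simp
  qed
  also have "\<dots> = (\<integral>y. indicator {a<..b} y * (\<integral>x. indicator {y<..} x * w x \<partial>F) \<partial>lborel)"
    by (rule Fubini_tail[symmetric])
       (use w ab in \<open>auto simp: finite_measure_axioms emeasure_lborel_Ioc intro!: integrable_real_indicator\<close>)
  finally show ?thesis .
qed

section \<open>Limits of masses, averages and tail integrals\<close>

lemma finite_measure_shrinking:
  fixes \<nu> :: "real measure"
  assumes "finite_measure \<nu>" "sets \<nu> = sets borel"
  shows "(\<lambda>n. measure \<nu> {y<..y + inverse (real (Suc n))}) \<longlonglongrightarrow> 0"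
    and "(\<lambda>n. measure \<nu> {y - inverse (real (Suc n))..<y}) \<longlonglongrightarrow> 0"
    and "(\<lambda>n. measure \<nu> {real n<..}) \<longlonglongrightarrow> 0"
    and "(\<lambda>n. measure \<nu> {..- real n}) \<longlonglongrightarrow> 0"
proof -
  interpret finite_measure \<nu> by fact
  have *: "(\<lambda>n. measure \<nu> (A n)) \<longlonglongrightarrow> 0"
    if "\<And>n. A n \<in> sets borel" "decseq A" "\<And>x. \<exists>n. x \<notin> A n" for A :: "nat \<Rightarrow> real set"
  proof -
    have "range A \<subseteq> sets \<nu>" using that(1) assms(2) by auto
    from finite_Lim_measure_decseq[OF this that(2)] have "(\<lambda>n. measure \<nu> (A n)) \<longlonglongrightarrow> measure \<nu> (\<Inter>n. A n)" .
    moreover have "(\<Inter>n. A n) = {}" using that(3) by blast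
    ultimately show ?thesis by simp
  qed
  have dec: "inverse (real (Suc n)) \<le> inverse (real (Suc m))" if "m \<le> n" for m n
    using that by (intro le_imp_inverse_le) auto
  show "(\<lambda>n. measure \<nu> {y<..y + inverse (real (Suc n))}) \<longlonglongrightarrow> 0"
  proof (rule *)
    show "decseq (\<lambda>n. {y<..y + inverse (real (Suc n))})"
    proof (unfold decseq_def, intro allI impI subsetI)
      fix m n :: nat and x assume "m \<le> n" "x \<in> {y<..y + inverse (real (Suc n))}"
      then show "x \<in> {y<..y + inverse (real (Suc m))}" using dec[of m n] unfolding greaterThanAtMost_iff by linarith
    qed
    show "\<exists>n. x \<notin> {y<..y + inverse (real (Suc n))}" for x
    proof (cases "x > y")
      case True
      then obtain n where "inverse (real (Suc n)) < x - y" using reals_Archimedean[of "x - y"] by auto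
      then show ?thesis by (intro exI[of _ n]) auto
    qed auto
  qed auto
  show "(\<lambda>n. measure \<nu> {y - inverse (real (Suc n))..<y}) \<longlonglongrightarrow> 0"
  proof (rule *)
    show "decseq (\<lambda>n. {y - inverse (real (Suc n))..<y})"
    proof (unfold decseq_def, intro allI impI subsetI)
      fix m n :: nat and x assume "m \<le> n" "x \<in> {y - inverse (real (Suc n))..<y}"
      then show "x \<in> {y - inverse (real (Suc m))..<y}" using dec[of m n] unfolding atLeastLessThan_iff by linarith
    qed
    show "\<exists>n. x \<notin> {y - inverse (real (Suc n))..<y}" for x
    proof (cases "x < y")
      case True
      then obtain n where "inverse (real (Suc n)) < y - x" using reals_Archimedean[of "y - x"] by auto
      then show ?thesis by (intro exI[of _ n]) auto
    qed auto
  qed auto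
  have ex: "\<exists>n. \<bar>x\<bar> < real n" for x :: real using reals_Archimedean2 by blast
  show "(\<lambda>n. measure \<nu> {real n<..}) \<longlonglongrightarrow> 0"
  proof (rule *)
    show "\<exists>n. x \<notin> {real n<..}" for x using ex[of x] by (rule ex_forward) simp
  qed (auto simp: decseq_def)
  show "(\<lambda>n. measure \<nu> {..- real n}) \<longlonglongrightarrow> 0"
  proof (rule *)
    show "\<exists>n. x \<notin> {..- real n}" for x using ex[of x] by (rule ex_forward) simp
  qed (auto simp: decseq_def)
qed

text \<open>Serves to read off a limit of \<open>g\<close> from its integrals over
  intervals.\<close>

lemma average_bound:
  fixes g :: "real \<Rightarrow> real"
  assumes g: "integrable lborel (\<lambda>y. indicator {p<..q} y * g y)" and pq: "p \<le> q"
    and e: "\<And>y. p < y \<Longrightarrow> y \<le> q \<Longrightarrow> \<bar>g y - c\<bar> \<le> e"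
  shows "\<bar>(\<integral>y. indicator {p<..q} y * g y \<partial>lborel) - c * (q - p)\<bar> \<le> e * (q - p)"
proof -
  have i: "integrable lborel (\<lambda>y. k * indicator {p<..q} y)" for k :: real
    by (intro integrable_mult_right integrable_real_indicator) (use pq in \<open>auto simp: emeasure_lborel_Ioc\<close>)
  have "(\<integral>y. indicator {p<..q} y * g y \<partial>lborel) - c * (q - p)
      = (\<integral>y. indicator {p<..q} y * g y - c * indicator {p<..q} y \<partial>lborel)"
    using g i[of c] pq by simp
  also have "\<bar>\<dots>\<bar> \<le> (\<integral>y. \<bar>indicator {p<..q} y * g y - c * indicator {p<..q} y\<bar> \<partial>lborel)"
    by (rule integral_abs_bound)
  also have "\<dots> \<le> (\<integral>y. e * indicator {p<..q} y \<partial>lborel)"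
    by (rule integral_mono) (use g i e in \<open>auto simp: indicator_def\<close>)
  also have "\<dots> = e * (q - p)" using pq by simp
  finally show ?thesis .
qed

lemma borel_measurable_tail_integral:
  fixes w :: "real \<Rightarrow> real"
  assumes "finite_measure M" and [measurable_cong]: "sets M = sets borel" and w[measurable]: "w \<in> borel_measurable borel"
  shows "(\<lambda>y. \<integral>x. indicator {y<..} x * w x \<partial>M) \<in> borel_measurable borel"
proof -
  interpret finite_measure M by fact
  have "(\<lambda>y. \<integral>x. (if y < x then w x else 0) \<partial>M) \<in> borel_measurable borel" by measurable
  moreover have "(\<lambda>x. indicator {y<..} x * w x) = (\<lambda>x. if y < x then w x else 0)" for y
    by (auto simp: indicator_def)
  ultimately show ?thesis by simp
qed

lemma tail_integral_diff:
  fixes w :: "real \<Rightarrow> real"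
  assumes sets: "sets M = sets borel" and w: "integrable M w" and ab: "a \<le> b"
  shows "(\<integral>x. indicator {a<..} x * w x \<partial>M) - (\<integral>x. indicator {b<..} x * w x \<partial>M)
      = (\<integral>x. indicator {a<..b} x * w x \<partial>M)"
proof -
  have i: "integrable M (\<lambda>x. indicator A x * w x)" if "A \<in> sets borel" for A
    using integrable_mult_indicator[OF _ w, of A] that sets by simp
  have "(\<integral>x. indicator {a<..} x * w x \<partial>M) - (\<integral>x. indicator {b<..} x * w x \<partial>M)
      = (\<integral>x. indicator {a<..} x * w x - indicator {b<..} x * w x \<partial>M)"
    using i by simp
  also have "\<dots> = (\<integral>x. indicator {a<..b} x * w x \<partial>M)"
    by (rule Bochner_Integration.integral_cong) (use ab in \<open>auto simp: indicator_def\<close>)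
  finally show ?thesis .
qed

text \<open>The identity \<open>id\<close> compares signed measures. Since \<open>H y\<close> has
  the sign of \<open>y\<close>, it becomes on each half-line an identity of positive measures, up to
  a common sign; intervals across 0 are split there.\<close>

lemma measure_eqI_abs_weights:
  fixes H :: "real \<Rightarrow> real"
  assumes F: "finite_measure F" and sets[measurable_cong]: "sets F = sets borel"
    and Hm[measurable]: "H \<in> borel_measurable borel"
    and Hi: "\<And>a b. a \<le> b \<Longrightarrow> integrable lborel (\<lambda>y. indicator {a<..b} y * H y)"
    and pos: "\<And>y. 0 < y \<Longrightarrow> 0 \<le> H y" and neg: "\<And>y. y \<le> 0 \<Longrightarrow> H y \<le> 0"
    and id: "\<And>a b. a \<le> b \<Longrightarrow> (\<integral>x. x * indicator {a<..b} x \<partial>F) = (\<integral>y. indicator {a<..b} y * H y \<partial>lborel)"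
  shows "density F (\<lambda>x. ennreal \<bar>x\<bar>) = density lborel (\<lambda>y. ennreal \<bar>H y\<bar>)"
proof -
  interpret finite_measure F by fact
  let ?M = "density F (\<lambda>x. ennreal \<bar>x\<bar>)" and ?N = "density lborel (\<lambda>y. ennreal \<bar>H y\<bar>)"
  have iF: "integrable F (\<lambda>x. x * indicator {a<..b} x)" for a b
  proof (rule integrable_const_bound[where B = "\<bar>a\<bar> + \<bar>b\<bar>"])
    show "AE x in F. norm (x * indicator {a<..b} x) \<le> \<bar>a\<bar> + \<bar>b\<bar>"
      by (rule AE_I2) (auto simp: indicator_def)
  qed simp
  have M: "emeasure ?M {a<..b} = ennreal (\<integral>x. \<bar>x * indicator {a<..b} x\<bar> \<partial>F)" for a b
  proof -
    have "emeasure ?M {a<..b} = (\<integral>\<^sup>+x. ennreal \<bar>x * indicator {a<..b} x\<bar> \<partial>F)"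
      by (subst emeasure_density) (auto simp: sets indicator_def intro!: nn_integral_cong)
    then show ?thesis using integrable_abs[OF iF] by (simp add: nn_integral_eq_integral)
  qed
  have N: "emeasure ?N {a<..b} = ennreal (\<integral>y. \<bar>indicator {a<..b} y * H y\<bar> \<partial>lborel)" if "a \<le> b" for a b
  proof -
    have "emeasure ?N {a<..b} = (\<integral>\<^sup>+y. ennreal \<bar>indicator {a<..b} y * H y\<bar> \<partial>lborel)"
      by (subst emeasure_density) (auto simp: indicator_def intro!: nn_integral_cong)
    then show ?thesis using integrable_abs[OF Hi[OF that]] by (simp add: nn_integral_eq_integral)
  qed
  have P: "emeasure ?M {a<..b} = emeasure ?N {a<..b}" if "0 \<le> a" "a \<le> b" for a b
  proof -
    have "(\<lambda>x. \<bar>x * indicator {a<..b} x\<bar>) = (\<lambda>x. x * indicator {a<..b} x)"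
      "(\<lambda>y. \<bar>indicator {a<..b} y * H y\<bar>) = (\<lambda>y. indicator {a<..b} y * H y)"
      using that pos by (auto simp: indicator_def)
    then show ?thesis using id[OF that(2)] M N[OF that(2)] by simp
  qed
  have Q: "emeasure ?M {a<..b} = emeasure ?N {a<..b}" if "b \<le> 0" "a \<le> b" for a b
  proof -
    have "(\<lambda>x. \<bar>x * indicator {a<..b} x\<bar>) = (\<lambda>x. - (x * indicator {a<..b} x))"
      "(\<lambda>y. \<bar>indicator {a<..b} y * H y\<bar>) = (\<lambda>y. - (indicator {a<..b} y * H y))"
      using that neg by (auto simp: indicator_def)
    then show ?thesis using id[OF that(2)] M N[OF that(2)] by simp
  qed
  have E: "emeasure ?M {a<..b} = emeasure ?N {a<..b}" for a b
  proof -
    consider "b < a" | "0 \<le> a" "a \<le> b" | "b \<le> 0" "a \<le> b" | "a < 0" "0 < b" by linarith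
    then show ?thesis
    proof cases
      case 4
      then have "{a<..b} = {a<..0} \<union> {0<..b}" by auto
      moreover have "{a<..0} \<inter> {0<..b} = {}" by auto
      ultimately have "emeasure K {a<..b} = emeasure K {a<..0} + emeasure K {0<..b}"
        if "Sigma_Algebra.sets K = Sigma_Algebra.sets borel" for K :: "real measure"
        using plus_emeasure[of "{a<..0}" K "{0<..b}"] that by simp
      then show ?thesis using 4 P[of 0 b] Q[of 0 a] sets by simp
    qed (use P Q in auto)
  qed
  show ?thesis
  proof (rule measure_eqI_generator_eq[where \<Omega> = UNIV and E = "range (\<lambda>(a, b). {a<..b})" and A = "\<lambda>n. {- real n<..real n}"])
    show "Int_stable (range (\<lambda>(a, b). {a<..b::real}))"
    proof (rule Int_stableI)
      fix A B assume "A \<in> range (\<lambda>(a, b). {a<..b::real})" "B \<in> range (\<lambda>(a, b). {a<..b::real})"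
      then obtain a b c d where "A = {a<..b}" "B = {c<..d}" by auto
      then have "A \<inter> B = (\<lambda>(a, b). {a<..b}) (max a c, min b d)" by auto
      then show "A \<inter> B \<in> range (\<lambda>(a, b). {a<..b})" by blast
    qed
    show "(\<Union>n. {- real n<..real n}) = UNIV"
    proof -
      have "x \<in> (\<Union>n. {- real n<..real n})" for x
      proof -
        obtain n where "\<bar>x\<bar> < real n" using reals_Archimedean2 by blast
        then show ?thesis by (auto intro!: exI[of _ n])
      qed
      then show ?thesis by blast
    qed
    show "emeasure ?M {- real n<..real n} \<noteq> \<infinity>" for n by (simp add: M)
  qed (auto simp: E sets borel_sigma_sets_Ioc)
qed

text \<open>The measure with density \<bar>w\<bar> controls the oscillation of tail integrals, so
  that their limits reduce to continuity from above of a finite measure.\<close>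

lemma integral_indicator_dominated:
  fixes w :: "real \<Rightarrow> real"
  assumes sets: "sets M = sets borel" and w: "integrable M w"
  shows "\<exists>\<nu>. finite_measure \<nu> \<and> sets \<nu> = sets borel \<and>
    (\<forall>A\<in>sets borel. \<bar>\<integral>x. indicator A x * w x \<partial>M\<bar> \<le> measure \<nu> A)"
proof -
  define \<nu> where "\<nu> = density M (\<lambda>x. ennreal \<bar>w x\<bar>)"
  have [measurable]: "w \<in> borel_measurable M" using w by auto
  have \<nu>s: "sets \<nu> = sets borel" by (simp add: \<nu>_def sets)
  have \<nu>e: "emeasure \<nu> A = ennreal (\<integral>x. \<bar>indicator A x * w x\<bar> \<partial>M)" if A: "A \<in> sets borel" for A
  proof -
    have "integrable M (\<lambda>x. indicator A x * w x)"
      using integrable_mult_indicator[OF _ w, of A] A sets by simp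
    moreover have "emeasure \<nu> A = (\<integral>\<^sup>+x. ennreal \<bar>indicator A x * w x\<bar> \<partial>M)"
      unfolding \<nu>_def using A by (subst emeasure_density) (auto simp: sets indicator_def intro!: nn_integral_cong)
    ultimately show ?thesis by (simp add: nn_integral_eq_integral)
  qed
  have "space \<nu> = UNIV" using sets_eq_imp_space_eq[OF \<nu>s] by simp
  then have "finite_measure \<nu>" by (intro finite_measureI) (use \<nu>e[of UNIV] in simp)
  moreover have "\<bar>\<integral>x. indicator A x * w x \<partial>M\<bar> \<le> measure \<nu> A" if "A \<in> sets borel" for A
    using \<nu>e[OF that] integral_abs_bound[of M "\<lambda>x. indicator A x * w x"] by (simp add: measure_def)
  ultimately show ?thesis using \<nu>s by blast
qed

lemma (in finite_measure) abs_integral_le_measure: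
  fixes g :: "'a \<Rightarrow> real"
  assumes A: "A \<in> sets M" and g: "\<And>x. \<bar>g x\<bar> \<le> k * indicator A x"
  shows "\<bar>\<integral>x. g x \<partial>M\<bar> \<le> k * measure M A"
proof -
  have i: "integrable M (\<lambda>x. k * indicator A x)"
    by (intro integrable_mult_right integrable_real_indicator) (use A in \<open>auto simp: less_top[symmetric]\<close>)
  have "\<bar>\<integral>x. g x \<partial>M\<bar> \<le> (\<integral>x. \<bar>g x\<bar> \<partial>M)" by (rule integral_abs_bound)
  also have "\<dots> \<le> (\<integral>x. k * indicator A x \<partial>M)" by (rule integral_mono_AE'[OF i])
       (use g in \<open>auto intro!: AE_I2 intro: order_trans[OF abs_ge_zero]\<close>)
  finally show ?thesis using A by simp
qed

theorem score_representation:
  fixes F :: "real measure" and w :: "real \<Rightarrow> real"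
  assumes F: "real_distribution F" and wm[measurable]: "w \<in> borel_measurable borel"
    and w2: "integrable F (\<lambda>x. (w x)\<^sup>2)"
    and T: "\<And>\<phi>. \<phi> \<in> C_c1 \<Longrightarrow> (\<integral>x. x * deriv \<phi> x \<partial>F) = (\<integral>x. w x * \<phi> x \<partial>F)"
  shows "\<exists>f. scale_regular_density F f \<and> (AE x in remove_zero_mass F. Lambda f x = w x) \<and> w 0 * measure F {0} = 0"
proof -
  interpret real_distribution F by fact
  note [measurable_cong] = events_eq_borel
  have wF[measurable]: "w \<in> borel_measurable F" by (simp add: measurable_cong_sets[OF events_eq_borel refl] wm)
  have w: "integrable F w" by (rule square_integrable_imp_integrable[OF wF w2])
  have iA: "integrable F (\<lambda>x. indicator A x * w x)" if "A \<in> sets borel" for A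
    using integrable_mult_indicator[OF _ w, of A] that by simp
  define H where "H y = (\<integral>x. indicator {y<..} x * w x \<partial>F)" for y
  have Hm[measurable]: "H \<in> borel_measurable borel"
    unfolding H_def[abs_def] by (rule borel_measurable_tail_integral) (auto simp: finite_measure_axioms)
  obtain \<nu> where \<nu>fin: "finite_measure \<nu>" and \<nu>s: "sets \<nu> = sets borel"
    and \<nu>m: "\<And>A. A \<in> sets borel \<Longrightarrow> \<bar>\<integral>x. indicator A x * w x \<partial>F\<bar> \<le> measure \<nu> A"
    using integral_indicator_dominated[OF events_eq_borel w] by blast
  interpret \<nu>: finite_measure \<nu> by fact
  have Hdiff: "H a - H b = (\<integral>x. indicator {a<..b} x * w x \<partial>F)" if "a \<le> b" for a b
    unfolding H_def by (rule tail_integral_diff[OF events_eq_borel w that])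
  have Hd: "\<bar>H b - H a\<bar> \<le> measure \<nu> {a<..b}" if "a \<le> b" for a b
    using Hdiff[OF that] \<nu>m[of "{a<..b}"] by simp
  have HB: "\<bar>H y\<bar> \<le> measure \<nu> UNIV" for y
  proof -
    have "\<bar>H y\<bar> \<le> measure \<nu> {y<..}" unfolding H_def by (rule \<nu>m) simp
    also have "\<dots> \<le> measure \<nu> UNIV" by (rule \<nu>.finite_measure_mono) (auto simp: \<nu>s)
    finally show ?thesis .
  qed
  have Hi: "integrable lborel (\<lambda>y. indicator {a<..b} y * H y)" if "a \<le> b" for a b
  proof (rule Bochner_Integration.integrable_bound)
    show "integrable lborel (\<lambda>y. measure \<nu> UNIV * indicator {a<..b} y)"
      by (intro integrable_mult_right integrable_real_indicator) (use that in \<open>auto simp: emeasure_lborel_Ioc\<close>)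
  qed (use HB in \<open>auto simp: indicator_def\<close>)
  have id: "(\<integral>x. x * indicator {a<..b} x \<partial>F) = (\<integral>y. indicator {a<..b} y * H y \<partial>lborel)" if "a \<le> b" for a b
    unfolding H_def by (rule score_identity_interval[OF F w T that])
  have avg: "\<bar>(\<integral>x. x * indicator {a<..b} x \<partial>F) - c * (b - a)\<bar> \<le> e * (b - a)"
    if "a \<le> b" "\<And>y. a < y \<Longrightarrow> y \<le> b \<Longrightarrow> \<bar>H y - c\<bar> \<le> e" for a b c e
    unfolding id[OF that(1)] by (rule average_bound[OF Hi[OF that(1)] that])
  let ?d = "\<lambda>n. inverse (real (Suc n))"
  \<comment> \<open>\<open>H\<close> is right-continuous with modulus given by \<nu>, so
    \<open>H y\<close> is the limit of averages of x F(dx) just to the right of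
    \<open>y\<close>.\<close>
  have avgR: "\<bar>(\<integral>x. x * indicator {y<..y + ?d n} x \<partial>F) - H y * ?d n\<bar> \<le> measure \<nu> {y<..y + ?d n} * ?d n" for y n
  proof -
    have "\<bar>H z - H y\<bar> \<le> measure \<nu> {y<..y + ?d n}" if "y < z" "z \<le> y + ?d n" for z
    proof -
      have "\<bar>H z - H y\<bar> \<le> measure \<nu> {y<..z}" using Hd that by simp
      also have "\<dots> \<le> measure \<nu> {y<..y + ?d n}"
        using that by (intro \<nu>.finite_measure_mono) (auto simp: \<nu>s)
      finally show ?thesis .
    qed
    from avg[of y "y + ?d n", OF _ this] show ?thesis by simp
  qed
  have pos: "0 \<le> H y" if "0 < y" for y
  proof -
    have "0 - measure \<nu> {y<..y + ?d n} \<le> H y" for n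
    proof -
      have "0 \<le> (\<integral>x. x * indicator {y<..y + ?d n} x \<partial>F)"
        by (rule Bochner_Integration.integral_nonneg) (use that in \<open>auto simp: indicator_def\<close>)
      then have "(0 - measure \<nu> {y<..y + ?d n}) * ?d n \<le> H y * ?d n"
        using avgR[of y n] unfolding abs_le_iff left_diff_distrib mult_zero_left by linarith
      then show ?thesis by (rule mult_right_le_imp_le) simp
    qed
    moreover have "(\<lambda>n. 0 - measure \<nu> {y<..y + ?d n}) \<longlonglongrightarrow> 0 - 0"
      by (intro tendsto_intros finite_measure_shrinking(1) \<nu>fin \<nu>s)
    ultimately show ?thesis using LIMSEQ_le_const2[of _ "0 - 0" "H y"] by auto
  qed
  have neg: "H y \<le> 0" if y0: "y < 0" for y
  proof -
    \<comment> \<open>The interval to the right of \<open>y\<close> must not reach positive numbers,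
      hence the restriction to \<open>n \<ge> N\<close>.\<close>
    obtain N where N: "?d N < - y" using reals_Archimedean[of "- y"] y0 by auto
    have "H y \<le> measure \<nu> {y<..y + ?d n}" if "n \<ge> N" for n
    proof -
      have "?d n \<le> ?d N" using that by (intro le_imp_inverse_le) auto
      then have "y + ?d n \<le> 0" using N by linarith
      then have "0 \<le> (\<integral>x. - (x * indicator {y<..y + ?d n} x) \<partial>F)"
        by (intro Bochner_Integration.integral_nonneg) (auto simp: indicator_def)
      then have "(\<integral>x. x * indicator {y<..y + ?d n} x \<partial>F) \<le> 0" by simp
      then have "H y * ?d n \<le> measure \<nu> {y<..y + ?d n} * ?d n"
        using avgR[of y n] unfolding abs_le_iff left_diff_distrib mult_zero_left by linarith
      then show ?thesis by (rule mult_right_le_imp_le) simp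
    qed
    then show ?thesis
      by (intro LIMSEQ_le_const[OF finite_measure_shrinking(1)[OF \<nu>fin \<nu>s, of y]]) blast
  qed
  have H0: "H 0 = 0"
  proof -
    have "\<bar>H 0\<bar> \<le> measure \<nu> {0<..0 + ?d n} + measure F {0<..0 + ?d n}" for n
    proof -
      \<comment> \<open>Here x is at most the length of the interval, so the average is bounded by a
        vanishing mass of F.\<close>
      have "\<bar>\<integral>x. x * indicator {0<..0 + ?d n} x \<partial>F\<bar> \<le> ?d n * measure F {0<..0 + ?d n}"
        by (rule abs_integral_le_measure) (auto simp: indicator_def)
      then have "\<bar>H 0\<bar> * ?d n \<le> (measure \<nu> {0<..0 + ?d n} + measure F {0<..0 + ?d n}) * ?d n"
        using avgR[of 0 n] abs_mult[of "H 0" "?d n"] unfolding distrib_right by (simp add: mult.commute)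
      then show ?thesis by (rule mult_right_le_imp_le) simp
    qed
    moreover have "(\<lambda>n. measure \<nu> {0<..0 + ?d n} + measure F {0<..0 + ?d n}) \<longlonglongrightarrow> 0 + 0"
      by (intro tendsto_add finite_measure_shrinking(1) \<nu>fin \<nu>s finite_measure_axioms events_eq_borel)
    ultimately have "\<bar>H 0\<bar> \<le> 0 + 0" by (intro LIMSEQ_le_const) auto
    then show ?thesis by simp
  qed
  have point: "(\<integral>x. indicator {0} x * w x \<partial>F) = w 0 * measure F {0}"
  proof -
    have "(\<lambda>x. indicator {0} x * w x) = (\<lambda>x. w 0 * indicator {0} x)" by (auto simp: indicator_def)
    then show ?thesis by simp
  qed
  have jump: "w 0 * measure F {0} = 0"
  proof -
    \<comment> \<open>Since \<open>H 0 = 0\<close>, this is the left limit of \<open>H\<close> at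
      0.\<close>
    define c where "c = w 0 * measure F {0}"
    have "\<bar>c\<bar> \<le> measure \<nu> {0 - ?d n..<0} + 2 * measure F {0 - ?d n..<0}" for n
    proof -
      have near: "\<bar>H y - c\<bar> \<le> measure \<nu> {0 - ?d n..<0}" if "- ?d n < y" "y \<le> - ?d n / 2" for y
      proof -
        have y0: "y < 0" using that(2) by (simp add: order_le_less_trans)
        have "H y - c = (\<integral>x. indicator {y<..0} x * w x \<partial>F) - (\<integral>x. indicator {0} x * w x \<partial>F)"
          using Hdiff[of y 0] y0 H0 point by (simp add: c_def)
        also have "\<dots> = (\<integral>x. indicator {y<..0} x * w x - indicator {0} x * w x \<partial>F)"
          using iA by simp
        also have "\<dots> = (\<integral>x. indicator {y<..<0} x * w x \<partial>F)"
          by (rule Bochner_Integration.integral_cong) (use y0 in \<open>auto simp: indicator_def\<close>)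
        finally have "\<bar>H y - c\<bar> \<le> measure \<nu> {y<..<0}" using \<nu>m[of "{y<..<0}"] by simp
        also have "\<dots> \<le> measure \<nu> {0 - ?d n..<0}"
          using that by (intro \<nu>.finite_measure_mono) (auto simp: \<nu>s)
        finally show ?thesis .
      qed
      have len: "- ?d n \<le> - ?d n / 2" by simp
      \<comment> \<open>The interval stops at half the distance because \<open>H\<close> is close to
        \<open>c\<close> only strictly to the left of 0; its length \<open>?d n / 2\<close> is the
        source of the factor 2.\<close>
      let ?I = "{- ?d n<..- ?d n / 2}"
      have A: "\<bar>(\<integral>x. x * indicator ?I x \<partial>F) - c * (?d n / 2)\<bar> \<le> measure \<nu> {0 - ?d n..<0} * (?d n / 2)"
        using avg[OF len near] by (simp add: field_simps)
      have "\<bar>\<integral>x. x * indicator ?I x \<partial>F\<bar> \<le> ?d n * measure F {0 - ?d n..<0}"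
      proof (rule abs_integral_le_measure)
        fix x
        have "x < 0" if "x \<le> - ?d n / 2" using that by (simp add: order_le_less_trans)
        then show "\<bar>x * indicator ?I x\<bar> \<le> ?d n * indicator {0 - ?d n..<0} x"
          by (auto simp: indicator_def)
      qed simp
      also have "\<dots> = 2 * measure F {0 - ?d n..<0} * (?d n / 2)" by simp
      finally have "\<bar>c * (?d n / 2)\<bar> \<le> (measure \<nu> {0 - ?d n..<0} + 2 * measure F {0 - ?d n..<0}) * (?d n / 2)"
        using A unfolding distrib_right by linarith
      then have "\<bar>c\<bar> * (?d n / 2) \<le> (measure \<nu> {0 - ?d n..<0} + 2 * measure F {0 - ?d n..<0}) * (?d n / 2)"
        by (simp add: abs_mult)
      then show ?thesis by (rule mult_right_le_imp_le) simp
    qed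
    moreover have "(\<lambda>n. measure \<nu> {0 - ?d n..<0} + 2 * measure F {0 - ?d n..<0}) \<longlonglongrightarrow> 0 + 2 * 0"
      by (intro tendsto_add tendsto_mult tendsto_const finite_measure_shrinking(2) \<nu>fin \<nu>s finite_measure_axioms events_eq_borel)
    ultimately have "\<bar>c\<bar> \<le> 0 + 2 * 0" by (intro LIMSEQ_le_const) auto
    then show ?thesis by (simp add: c_def)
  qed
  \<comment> \<open>At 0 this is \<open>H 0 / 0 = 0\<close>; the identity
    \<open>y * f y = H y\<close> survives there because \<open>H 0 = 0\<close>.\<close>
  define f where "f y = H y / y" for y
  have fm[measurable]: "f \<in> borel_measurable borel" by (simp add: f_def[abs_def])
  have f0: "0 \<le> f y" for y
    using pos[of y] neg[of y] H0 by (cases y "0 :: real" rule: linorder_cases) (auto simp: f_def divide_nonpos_neg)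
  have yf: "(\<lambda>y. y * f y) = H" using H0 by (auto simp: f_def)
  have dens: "remove_zero_mass F = density lborel f"
  proof -
    have neg': "H y \<le> 0" if "y \<le> 0" for y using neg[of y] H0 that by (cases "y = 0") auto
    have eq: "density F (\<lambda>x. ennreal \<bar>x\<bar>) = density lborel (\<lambda>y. ennreal \<bar>H y\<bar>)"
      by (rule measure_eqI_abs_weights[OF finite_measure_axioms events_eq_borel Hm Hi pos neg' id])
    \<comment> \<open>The weight \<open>1 / \<bar>x\<bar>\<close> is 0 at 0 by division by zero, so
      undoing the weight \<bar>x\<bar> deletes exactly the atom.\<close>
    have "remove_zero_mass F = density (density F (\<lambda>x. ennreal \<bar>x\<bar>)) (\<lambda>x. ennreal (1 / \<bar>x\<bar>))"
      unfolding remove_zero_mass_eq[OF F]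
      by (subst density_density_eq) (auto intro!: density_cong simp: ennreal_mult'[symmetric] indicator_def)
    also have "\<dots> = density lborel (\<lambda>y. ennreal \<bar>H y\<bar> * ennreal (1 / \<bar>y\<bar>))"
      unfolding eq by (subst density_density_eq) auto
    also have "(\<lambda>y. ennreal \<bar>H y\<bar> * ennreal (1 / \<bar>y\<bar>)) = (\<lambda>y. ennreal (f y))"
    proof
      fix y
      have "\<bar>H y\<bar> * (1 / \<bar>y\<bar>) = \<bar>f y\<bar>" by (simp add: f_def)
      then show "ennreal \<bar>H y\<bar> * ennreal (1 / \<bar>y\<bar>) = ennreal (f y)"
        using f0[of y] by (simp add: ennreal_mult'[symmetric])
    qed
    finally show ?thesis .
  qed
  \<comment> \<open>By \<open>jump\<close>, either \<open>w\<close> vanishes at 0 or 0 is not an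
    atom; integrals against \<open>w\<close> may thus be taken over the measure off 0.\<close>
  have AE0: "AE x in F. x \<noteq> 0 \<or> w x = 0"
  proof (cases "w 0 = 0")
    case True
    then show ?thesis by (intro AE_I2) auto
  next
    case False
    then have "{0} \<in> null_sets F" using jump by (auto intro!: null_setsI simp: emeasure_eq_measure)
    from AE_not_in[OF this] show ?thesis by eventually_elim auto
  qed
  have toN: "(\<integral>x. g x * w x \<partial>F) = (\<integral>x. g x * w x \<partial>remove_zero_mass F)" if [measurable]: "g \<in> borel_measurable borel" for g
  proof -
    have "AE x in F. g x * w x = indicator (- {0}) x * (g x * w x)"
      using AE0 by eventually_elim (auto simp: indicator_def)
    then have "(\<integral>x. g x * w x \<partial>F) = (\<integral>x. indicator (- {0}) x * (g x * w x) \<partial>F)"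
      by (intro integral_cong_AE) auto
    also have "\<dots> = (\<integral>x. g x * w x \<partial>remove_zero_mass F)"
      by (rule integral_remove_zero_mass[OF F, symmetric]) simp
    finally show ?thesis .
  qed
  have wN: "integrable (remove_zero_mass F) w"
    unfolding integrable_remove_zero_mass[OF F wm] by (rule iA) auto
  have wf: "integrable lborel (\<lambda>x. f x * w x)"
    using wN unfolding dens by (subst (asm) integrable_density) (auto simp: f0)
  have Hint: "H b - H a = (LINT x:{a<..b}|lborel. - (f x * w x))" if "a \<le> b" for a b
  proof -
    have "H a - H b = (\<integral>x. indicator {a<..b} x * w x \<partial>density lborel f)"
      unfolding Hdiff[OF that] dens[symmetric] by (rule toN) simp
    also have "\<dots> = (\<integral>x. f x * (indicator {a<..b} x * w x) \<partial>lborel)"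
      by (subst integral_density) (auto simp: f0)
    also have "\<dots> = - (LINT x:{a<..b}|lborel. - (f x * w x))"
      by (simp add: set_lebesgue_integral_def mult.left_commute)
    finally show ?thesis by simp
  qed
  have wf': "integrable lborel (\<lambda>x. - (f x * w x))" using wf by simp
  have ac: "abs_continuous_fun H"
    by (rule abs_continuous_fun_indefinite_integral[OF wf' Hint])
  \<comment> \<open>The differentiation theorem is stated on bounded intervals; countably many of
    them exhaust the line.\<close>
  have "AE x in lborel. \<forall>n::nat. - real n < x \<and> x < real n \<longrightarrow> (H has_real_derivative - (f x * w x)) (at x)"
    unfolding AE_all_countable
  proof
    fix n :: nat
    show "AE x in lborel. - real n < x \<and> x < real n \<longrightarrow> (H has_real_derivative - (f x * w x)) (at x)"
      by (rule AE_has_derivative_of_integral[OF wf' Hint])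
  qed
  then have AE: "AE x in lborel. 0 < f x \<longrightarrow> Lambda f x = w x"
  proof eventually_elim
    case (elim x)
    obtain n :: nat where "\<bar>x\<bar> < real n" using reals_Archimedean2 by blast
    then have "- real n < x \<and> x < real n" by linarith
    then have "(H has_real_derivative - (f x * w x)) (at x)" by (rule elim[rule_format, of n])
    then have "deriv H x = - (f x * w x)" by (rule DERIV_imp_deriv)
    then show ?case by (simp add: Lambda_def yf)
  qed
  have AEN: "AE x in remove_zero_mass F. Lambda f x = w x"
    unfolding dens by (subst AE_density) (use AE in \<open>auto elim!: eventually_mono\<close>)
  have Lm[measurable]: "Lambda f \<in> borel_measurable borel"
    unfolding Lambda_def[abs_def] yf
    using borel_measurable_deriv_of_continuous[OF abs_continuous_fun_imp_continuous[OF ac]] by measurable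
  have sN: "sets (remove_zero_mass F) = sets borel" by (rule finite_measure_remove_zero_mass[OF F])
  have LmN: "Lambda f \<in> borel_measurable (remove_zero_mass F)"
    by (simp add: measurable_cong_sets[OF sN refl] Lm)
  have w2N: "integrable (remove_zero_mass F) (\<lambda>x. (w x)\<^sup>2)"
  proof (subst integrable_remove_zero_mass[OF F])
    show "integrable F (\<lambda>x. indicator (- {0}) x * (w x)\<^sup>2)"
      using integrable_mult_indicator[OF _ w2, of "- {0}"] by simp
  qed measurable
  have "integrable (remove_zero_mass F) (\<lambda>x. (Lambda f x)\<^sup>2)"
    by (rule integrable_cong_AE_imp[OF w2N]) (use LmN AEN in \<open>auto elim!: eventually_mono\<close>)
  then have "scale_regular_density F f"
    using LmN ac dens f0 fm by (simp add: scale_regular_density_def is_lebesgue_density_def in_L2_def yf)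
  then show ?thesis using AEN jump by blast
qed

section \<open>A regular density yields finite information\<close>

lemma C_c1_integral_deriv:
  assumes \<phi>: "\<phi> \<in> C_c1"
  shows "integrable lborel (deriv \<phi>)"
    and "\<exists>k. \<forall>x. (\<integral>y. indicator {..<x} y * deriv \<phi> y \<partial>lborel) = \<phi> x - k"
proof -
  obtain R where R: "R > 0" "\<And>x. R \<le> \<bar>x\<bar> \<Longrightarrow> deriv \<phi> x = 0"
    "\<And>x. x \<le> - R \<Longrightarrow> \<phi> x = \<phi> (- R)" "\<And>x. R \<le> x \<Longrightarrow> \<phi> x = \<phi> R"
    by (rule C_c1_support[OF \<phi>], rule that)
  obtain K where K: "\<And>x. \<bar>\<phi> x\<bar> \<le> K" "\<And>x. \<bar>deriv \<phi> x\<bar> \<le> K" "\<And>x. \<bar>x * deriv \<phi> x\<bar> \<le> K"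
    by (rule C_c1_bounded[OF \<phi>], rule that)
  note [measurable] = C_c1_measurable[OF \<phi>]
  show i: "integrable lborel (deriv \<phi>)"
  proof (rule Bochner_Integration.integrable_bound)
    show "integrable lborel (\<lambda>y. K * indicator {- R..R} y)"
      by (intro integrable_mult_right integrable_real_indicator) (use R(1) in auto)
    have "\<bar>deriv \<phi> y\<bar> \<le> K * indicator {- R..R} y" for y
    proof (cases "y \<in> {- R..R}")
      case False
      then have "R \<le> \<bar>y\<bar>" by auto
      then show ?thesis using R(2) False by simp
    qed (use K(2) in simp)
    then show "AE y in lborel. norm (deriv \<phi> y) \<le> norm (K * indicator {- R..R} y)"
      by (intro AE_I2) (simp only: real_norm_def, rule order_trans[OF _ abs_ge_self], simp)
  qed simp
  have "(\<integral>y. indicator {..<x} y * deriv \<phi> y \<partial>lborel) = \<phi> x - \<phi> (- R)" for x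
  proof (cases "x \<le> - R")
    case True
    have "(\<lambda>y. indicator {..<x} y * deriv \<phi> y) = (\<lambda>y. 0)"
    proof
      fix y show "indicator {..<x} y * deriv \<phi> y = 0" using R(2)[of y] True by (cases "y < x") auto
    qed
    then show ?thesis using R(3)[OF True] by simp
  next
    case False
    have "(\<integral>y. indicator {..<x} y * deriv \<phi> y \<partial>lborel) = (\<integral>y. deriv \<phi> y * indicator {- R..x} y \<partial>lborel)"
    proof (rule integral_cong_AE)
      show "AE y in lborel. indicator {..<x} y * deriv \<phi> y = deriv \<phi> y * indicator {- R..x} y"
        using AE_lborel_singleton[of x]
      proof eventually_elim
        case (elim y)
        then show ?case using R(2)[of y] by (cases "y < - R") (auto simp: indicator_def)
      qed
    qed auto
    also have "\<dots> = \<phi> x - \<phi> (- R)"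
    proof (rule integral_FTC_Icc_real)
      show "isCont (deriv \<phi>) y" for y
        using C_c1_D(2)[OF \<phi>] by (simp add: continuous_on_eq_continuous_at)
    qed (use False C_c1_D(1)[OF \<phi>] in auto)
    finally show ?thesis .
  qed
  then show "\<exists>k. \<forall>x. (\<integral>y. indicator {..<x} y * deriv \<phi> y \<partial>lborel) = \<phi> x - k" by blast
qed

text \<open>Where \<open>f\<close> is positive, \<open>f x * Lambda f x\<close> is minus the
  derivative by definition. Where \<open>f\<close> vanishes this product is 0, so the derivative
  itself has to be shown to vanish.\<close>

lemma regular_density_increment:
  assumes f0: "\<And>x. 0 \<le> f x" and fm[measurable]: "f \<in> borel_measurable borel"
    and Lm[measurable]: "Lambda f \<in> borel_measurable borel"
    and ac: "abs_continuous_fun (\<lambda>x. x * f x)" and ab: "a \<le> b"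
  shows "b * f b - a * f a = - (\<integral>x. indicator {a<..b} x * (f x * Lambda f x) \<partial>lborel)"
proof -
  let ?g = "\<lambda>x. x * f x"
  \<comment> \<open>The added 1 makes every point of \<open>{a<..b}\<close> interior, as the
    differentiation theorem requires.\<close>
  define N where "N = \<bar>a\<bar> + \<bar>b\<bar> + 1"
  have N: "- N \<le> N" "- N \<le> a" "b \<le> N" "- N < a" "b < N" by (auto simp: N_def)
  obtain h where h: "integrable lborel h"
    "\<And>a b. - N \<le> a \<Longrightarrow> a \<le> b \<Longrightarrow> b \<le> N \<Longrightarrow> ?g b - ?g a = (LINT x:{a<..b}|lborel. h x)"
    using abs_continuous_fun_integral[OF ac N(1)] by blast
  have [measurable]: "h \<in> borel_measurable borel" using h(1) by auto
  have "AE x in lborel. - N < x \<and> x < N \<longrightarrow> (?g has_real_derivative h x) (at x)"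
    by (rule AE_has_derivative_of_integral[OF h])
  then have AE: "AE x in lborel. indicator {a<..b} x * h x = indicator {a<..b} x * - (f x * Lambda f x)"
    using AE_lborel_singleton[of 0]
  proof eventually_elim
    case (elim x)
    show ?case
    proof (cases "x \<in> {a<..b}")
      case True
      then have D: "(?g has_real_derivative h x) (at x)" using elim(1) N by auto
      have "h x = - (f x * Lambda f x)"
      proof (cases "f x = 0")
        case False
        then show ?thesis using DERIV_imp_deriv[OF D] by (simp add: Lambda_def)
      next
        \<comment> \<open>\<open>x * f x\<close> has the sign of \<open>x\<close>, so its zeros off the origin are local extrema.\<close>
        case zero: True
        have "h x = 0"
        proof (cases "x > 0")
          case True
          show ?thesis
            by (rule DERIV_local_min[OF D True]) (use zero f0 in \<open>auto intro!: mult_nonneg_nonneg\<close>)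
        next
          case False
          then have "- x > 0" using elim(2) by simp
          show ?thesis
            by (rule DERIV_local_max[OF D \<open>- x > 0\<close>]) (use zero f0 in \<open>auto intro!: mult_nonpos_nonneg\<close>)
        qed
        then show ?thesis using zero by simp
      qed
      then show ?thesis by simp
    qed simp
  qed
  have "?g b - ?g a = (\<integral>x. indicator {a<..b} x * h x \<partial>lborel)"
    using h(2)[OF N(2) ab N(3)] by (simp add: set_lebesgue_integral_def)
  also have "\<dots> = (\<integral>x. indicator {a<..b} x * - (f x * Lambda f x) \<partial>lborel)"
    by (rule integral_cong_AE) (use AE in auto)
  finally show ?thesis by simp
qed

theorem regular_density_score:
  assumes F: "real_distribution F" and R: "scale_regular_density F f" and \<phi>: "\<phi> \<in> C_c1"
  shows "(\<integral>x. x * deriv \<phi> x \<partial>F) = (\<integral>x. Lambda f x * \<phi> x \<partial>remove_zero_mass F)"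
proof -
  define M where "M = remove_zero_mass F"
  define w where "w = Lambda f"
  interpret M: finite_measure M unfolding M_def by (rule finite_measure_remove_zero_mass[OF F])
  have Ms[measurable_cong]: "sets M = sets borel" unfolding M_def by (rule finite_measure_remove_zero_mass[OF F])
  have dens: "M = density lborel f" and fm[measurable]: "f \<in> borel_measurable borel" and f0: "\<And>x. 0 \<le> f x"
    and ac: "abs_continuous_fun (\<lambda>x. x * f x)" and wM: "w \<in> borel_measurable M"
    and w2: "integrable M (\<lambda>x. (w x)\<^sup>2)"
    using R by (auto simp: scale_regular_density_def is_lebesgue_density_def in_L2_def M_def w_def)
  have wm[measurable]: "w \<in> borel_measurable borel"
    using wM by (simp add: measurable_cong_sets[OF Ms refl])
  have w: "integrable M w" by (rule M.square_integrable_imp_integrable[OF wM w2])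
  define g where "g x = x * f x" for x
  have toM: "(\<integral>x. k x \<partial>M) = (\<integral>x. f x * k x \<partial>lborel)" if [measurable]: "k \<in> borel_measurable borel" for k :: "real \<Rightarrow> real"
    unfolding dens by (subst integral_density) (auto simp: f0)
  have iM: "integrable M k \<longleftrightarrow> integrable lborel (\<lambda>x. f x * k x)" if [measurable]: "k \<in> borel_measurable borel" for k :: "real \<Rightarrow> real"
    unfolding dens by (subst integrable_density) (auto simp: f0)
  define H where "H y = (\<integral>x. indicator {y<..} x * w x \<partial>M)" for y
  have gH: "g b - g a = H b - H a" if "a \<le> b" for a b
  proof -
    have "H a - H b = (\<integral>x. indicator {a<..b} x * w x \<partial>M)"
      unfolding H_def by (rule tail_integral_diff[OF Ms w that])
    also have "\<dots> = (\<integral>x. indicator {a<..b} x * (f x * w x) \<partial>lborel)"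
      by (subst toM) (auto simp: mult.left_commute)
    also have "\<dots> = - (g b - g a)"
      using regular_density_increment[OF f0 fm wm[unfolded w_def] ac that] by (simp add: g_def w_def)
    finally show ?thesis by simp
  qed
  \<comment> \<open>\<open>g\<close> and \<open>H\<close> have the same increments and
    \<open>H\<close> vanishes at plus infinity, so \<open>c\<close> is the limit of \<open>g\<close>
    there.\<close>
  define c where "c = g 0 - H 0"
  have gc: "g y = H y + c" for y
    using gH[of 0 y] gH[of y 0] by (cases "0 \<le> y") (auto simp: c_def)
  define m where "m = (\<integral>x. w x \<partial>M)"
  obtain \<nu> where \<nu>fin: "finite_measure \<nu>" and \<nu>s: "sets \<nu> = sets borel"
    and \<nu>m: "\<And>A. A \<in> sets borel \<Longrightarrow> \<bar>\<integral>x. indicator A x * w x \<partial>M\<bar> \<le> measure \<nu> A"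
    using integral_indicator_dominated[OF Ms w] by blast
  interpret \<nu>: finite_measure \<nu> by fact
  have i\<nu>: "integrable M (\<lambda>x. indicator A x * w x)" if "A \<in> sets borel" for A
    using integrable_mult_indicator[OF _ w, of A] that Ms by simp
  have xI: "integrable M (\<lambda>x. x * indicator {p<..q} x)" for p q
  proof (rule M.integrable_const_bound[where B = "\<bar>p\<bar> + \<bar>q\<bar>"])
    show "AE x in M. norm (x * indicator {p<..q} x) \<le> \<bar>p\<bar> + \<bar>q\<bar>"
      by (rule AE_I2) (auto simp: indicator_def)
  qed simp
  have gi: "integrable lborel (\<lambda>y. indicator {p<..q} y * g y)"
    "(\<integral>y. indicator {p<..q} y * g y \<partial>lborel) = (\<integral>x. x * indicator {p<..q} x \<partial>M)" for p q
    using xI[of p q] by (auto simp: toM iM g_def mult_ac)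
  have right: "c = 0"
  proof -
    have "\<bar>c\<bar> \<le> measure \<nu> {real n<..} + 2 * measure M {real n<..}" if n: "n \<ge> 1" for n
    proof -
      \<comment> \<open>On a doubling interval the length \<open>n\<close> is comparable to the
        largest x, so dividing by \<open>n\<close> leaves only tail masses.\<close>
      let ?I = "{real n<..2 * real n}"
      have "\<bar>g y - c\<bar> \<le> measure \<nu> {real n<..}" if "real n < y" for y
      proof -
        have "\<bar>g y - c\<bar> \<le> measure \<nu> {y<..}" unfolding gc H_def using \<nu>m[of "{y<..}"] by simp
        also have "\<dots> \<le> measure \<nu> {real n<..}"
          using that by (intro \<nu>.finite_measure_mono) (auto simp: \<nu>s)
        finally show ?thesis .
      qed
      then have "\<bar>(\<integral>x. x * indicator ?I x \<partial>M) - c * (2 * real n - real n)\<bar> \<le> measure \<nu> {real n<..} * (2 * real n - real n)"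
        unfolding gi(2)[symmetric] by (intro average_bound gi(1)) auto
      moreover have "\<bar>\<integral>x. x * indicator ?I x \<partial>M\<bar> \<le> (2 * real n) * measure M {real n<..}"
        by (rule M.abs_integral_le_measure) (auto simp: indicator_def Ms)
      ultimately have "\<bar>c * real n\<bar> \<le> (measure \<nu> {real n<..} + 2 * measure M {real n<..}) * real n"
        unfolding distrib_right by (simp add: mult.commute mult.left_commute)
      then have "\<bar>c\<bar> * real n \<le> (measure \<nu> {real n<..} + 2 * measure M {real n<..}) * real n"
        by (simp add: abs_mult)
      then show ?thesis by (rule mult_right_le_imp_le) (use n in simp)
    qed
    moreover have "(\<lambda>n. measure \<nu> {real n<..} + 2 * measure M {real n<..}) \<longlonglongrightarrow> 0 + 2 * 0"
      by (intro tendsto_add tendsto_mult tendsto_const finite_measure_shrinking(3) \<nu>fin \<nu>s M.finite_measure_axioms Ms)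
    ultimately have "\<bar>c\<bar> \<le> 0 + 2 * 0" by (intro LIMSEQ_le_const) auto
    then show ?thesis by simp
  qed
  \<comment> \<open>The mirror image: at minus infinity \<open>H\<close>, and by
    \<open>c = 0\<close> also \<open>g\<close>, tends to the total integral
    \<open>m\<close>.\<close>
  have left: "m = 0"
  proof -
    have "\<bar>m\<bar> \<le> measure \<nu> {..- real n} + 2 * measure M {..- real n}" if n: "n \<ge> 1" for n
    proof -
      let ?I = "{- (2 * real n)<..- real n}"
      have "\<bar>g y - m\<bar> \<le> measure \<nu> {..- real n}" if "y \<le> - real n" for y
      proof -
        have "m - H y = (\<integral>x. w x - indicator {y<..} x * w x \<partial>M)"
          unfolding m_def H_def using w i\<nu> by simp
        also have "\<dots> = (\<integral>x. indicator {..y} x * w x \<partial>M)"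
          by (rule Bochner_Integration.integral_cong) (auto simp: indicator_def)
        finally have "\<bar>g y - m\<bar> \<le> measure \<nu> {..y}"
          using \<nu>m[of "{..y}"] right by (simp add: gc abs_minus_commute)
        also have "\<dots> \<le> measure \<nu> {..- real n}"
          using that by (intro \<nu>.finite_measure_mono) (auto simp: \<nu>s)
        finally show ?thesis .
      qed
      then have "\<bar>(\<integral>x. x * indicator ?I x \<partial>M) - m * (- real n - (- (2 * real n)))\<bar>
          \<le> measure \<nu> {..- real n} * (- real n - (- (2 * real n)))"
        unfolding gi(2)[symmetric] by (intro average_bound gi(1)) auto
      moreover have "\<bar>\<integral>x. x * indicator ?I x \<partial>M\<bar> \<le> (2 * real n) * measure M {..- real n}"
        by (rule M.abs_integral_le_measure) (auto simp: indicator_def Ms)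
      ultimately have "\<bar>m * real n\<bar> \<le> (measure \<nu> {..- real n} + 2 * measure M {..- real n}) * real n"
        unfolding distrib_right by (simp add: mult.commute mult.left_commute)
      then have "\<bar>m\<bar> * real n \<le> (measure \<nu> {..- real n} + 2 * measure M {..- real n}) * real n"
        by (simp add: abs_mult)
      then show ?thesis by (rule mult_right_le_imp_le) (use n in simp)
    qed
    moreover have "(\<lambda>n. measure \<nu> {..- real n} + 2 * measure M {..- real n}) \<longlonglongrightarrow> 0 + 2 * 0"
      by (intro tendsto_add tendsto_mult tendsto_const finite_measure_shrinking(4) \<nu>fin \<nu>s M.finite_measure_axioms Ms)
    ultimately have "\<bar>m\<bar> \<le> 0 + 2 * 0" by (intro LIMSEQ_le_const) auto
    then show ?thesis by simp
  qed
  note [measurable] = C_c1_measurable[OF \<phi>]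
  obtain k where k: "\<And>x. (\<integral>y. indicator {..<x} y * deriv \<phi> y \<partial>lborel) = \<phi> x - k"
    using C_c1_integral_deriv(2)[OF \<phi>] by blast
  obtain K where K: "\<And>x. \<bar>\<phi> x\<bar> \<le> K" "\<And>x. \<bar>deriv \<phi> x\<bar> \<le> K" "\<And>x. \<bar>x * deriv \<phi> x\<bar> \<le> K"
    by (rule C_c1_bounded[OF \<phi>], rule that)
  have w\<phi>: "integrable M (\<lambda>x. w x * \<phi> x)"
  proof (rule Bochner_Integration.integrable_bound)
    show "integrable M (\<lambda>x. K * w x)" using w by simp
    have "\<bar>w x * \<phi> x\<bar> \<le> \<bar>K * w x\<bar>" for x
      using mult_right_mono[of "\<bar>\<phi> x\<bar>" "\<bar>K\<bar>" "\<bar>w x\<bar>"] K(1)[of x]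
      by (simp add: abs_mult mult.commute)
    then show "AE x in M. norm (w x * \<phi> x) \<le> norm (K * w x)" by simp
  qed simp
  \<comment> \<open>The integrand vanishes at 0, so the atom drops out.\<close>
  have "(\<integral>x. x * deriv \<phi> x \<partial>F) = (\<integral>x. indicator (- {0}) x * (x * deriv \<phi> x) \<partial>F)"
    by (rule Bochner_Integration.integral_cong) (auto simp: indicator_def)
  also have "\<dots> = (\<integral>x. x * deriv \<phi> x \<partial>M)"
    unfolding M_def by (rule integral_remove_zero_mass[OF F, symmetric]) simp
  also have "\<dots> = (\<integral>y. deriv \<phi> y * (\<integral>x. indicator {y<..} x * w x \<partial>M) \<partial>lborel)"
  proof -
    have e: "f y * (y * deriv \<phi> y) = deriv \<phi> y * H y" for y
    proof -
      have "f y * (y * deriv \<phi> y) = deriv \<phi> y * (y * f y)" by simp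
      also have "y * f y = H y" using gc[of y] right by (simp add: g_def)
      finally show ?thesis .
    qed
    have "(\<integral>x. x * deriv \<phi> x \<partial>M) = (\<integral>x. f x * (x * deriv \<phi> x) \<partial>lborel)" by (rule toM) simp
    then show ?thesis by (simp only: e H_def)
  qed
  also have "\<dots> = (\<integral>x. w x * (\<integral>y. indicator {..<x} y * deriv \<phi> y \<partial>lborel) \<partial>M)"
    by (rule Fubini_tail[OF M.finite_measure_axioms Ms w C_c1_integral_deriv(1)[OF \<phi>]])
  also have "\<dots> = (\<integral>x. w x * \<phi> x - k * w x \<partial>M)"
    by (simp only: k right_diff_distrib mult.commute[of _ k])
  \<comment> \<open>The constant \<open>k\<close> disappears because the integral \<open>m\<close>
    of \<open>w\<close> is 0.\<close>
  also have "\<dots> = (\<integral>x. w x * \<phi> x \<partial>M)" using w\<phi> w left by (simp add: m_def)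
  finally show ?thesis by (simp add: w_def M_def)
qed

section \<open>Identification of the information\<close>

lemma C_c1_square_integrable:
  assumes F: "real_distribution F" and \<phi>: "\<phi> \<in> C_c1"
  shows "integrable F (\<lambda>x. (\<phi> x)\<^sup>2)"
proof -
  interpret real_distribution F by fact
  note [measurable_cong] = events_eq_borel
  note [measurable] = C_c1_measurable[OF \<phi>]
  obtain K where K: "\<And>x. \<bar>\<phi> x\<bar> \<le> K" "\<And>x. \<bar>deriv \<phi> x\<bar> \<le> K" "\<And>x. \<bar>x * deriv \<phi> x\<bar> \<le> K"
    by (rule C_c1_bounded[OF \<phi>], rule that)
  have "\<bar>(\<phi> x)\<^sup>2\<bar> \<le> K\<^sup>2" for x
    using power_mono[OF K(1)[of x], of 2] by simp
  then show ?thesis by (intro integrable_const_bound[where B = "K\<^sup>2"]) auto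
qed

lemma fisher_scale_le:
  assumes F: "real_distribution F" and wm[measurable]: "w \<in> borel_measurable borel"
    and w2: "integrable F (\<lambda>x. (w x)\<^sup>2)"
    and T: "\<And>\<phi>. \<phi> \<in> C_c1 \<Longrightarrow> (\<integral>x. x * deriv \<phi> x \<partial>F) = (\<integral>x. w x * \<phi> x \<partial>F)"
  shows "fisher_scale F \<le> ennreal (\<integral>x. (w x)\<^sup>2 \<partial>F)"
  unfolding fisher_scale_def
proof (rule SUP_least)
  interpret real_distribution F by fact
  note [measurable_cong] = events_eq_borel
  fix \<phi> assume \<phi>: "\<phi> \<in> C_c1"
  note [measurable] = C_c1_measurable[OF \<phi>]
  let ?Q = "\<integral>x. (\<phi> x)\<^sup>2 \<partial>F" and ?T = "\<integral>x. x * deriv \<phi> x \<partial>F" and ?W = "\<integral>x. (w x)\<^sup>2 \<partial>F"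
  have "?T\<^sup>2 \<le> ?W * ?Q"
    unfolding T[OF \<phi>] by (rule Cauchy_Schwarz_integral(2)) (use w2 C_c1_square_integrable[OF F \<phi>] in auto)
  moreover have "0 \<le> ?Q" "0 \<le> ?W" by simp_all
  ultimately show "ennreal (?T\<^sup>2) / ennreal ?Q \<le> ennreal ?W"
  proof (cases "?Q = 0")
    \<comment> \<open>A zero denominator forces a zero numerator, and the quotient is then 0 / 0 =
      0.\<close>
    case True
    then have "?T\<^sup>2 \<le> 0" using \<open>?T\<^sup>2 \<le> ?W * ?Q\<close> by simp
    then have "?T\<^sup>2 = 0" using zero_le_power2[of ?T] by (rule antisym)
    then show ?thesis by simp
  next
    case False
    then have Q: "?Q > 0" using \<open>0 \<le> ?Q\<close> by linarith
    then have "ennreal (?T\<^sup>2) / ennreal ?Q = ennreal (?T\<^sup>2 / ?Q)" by (intro divide_ennreal) auto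
    also have "\<dots> \<le> ennreal ?W"
      using Q \<open>?T\<^sup>2 \<le> ?W * ?Q\<close> by (intro ennreal_leI) (simp add: divide_le_eq)
    finally show ?thesis .
  qed
qed

lemma score_square_le_fisher_scale:
  assumes fin: "fisher_scale F < \<infinity>" and \<phi>: "\<phi> \<in> C_c1"
  shows "(\<integral>x. x * deriv \<phi> x \<partial>F)\<^sup>2 \<le> enn2real (fisher_scale F) * (\<integral>x. (\<phi> x)\<^sup>2 \<partial>F)"
proof -
  let ?Q = "\<integral>x. (\<phi> x)\<^sup>2 \<partial>F" and ?T = "\<integral>x. x * deriv \<phi> x \<partial>F"
  have le: "ennreal (?T\<^sup>2) / ennreal ?Q \<le> fisher_scale F"
    unfolding fisher_scale_def by (rule SUP_upper[OF \<phi>])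
  show ?thesis
  proof (cases "?Q = 0")
    case True
    \<comment> \<open>A positive numerator over 0 would be \<infinity>, against the finiteness of
      the information.\<close>
    then have "?T\<^sup>2 = 0"
      using le fin by (cases "?T = 0") (auto simp: ennreal_divide_eq_top_iff divide_ennreal_def top_unique ennreal_mult_eq_top_iff ennreal_top_mult)
    then show ?thesis using True by simp
  next
    case False
    moreover have "0 \<le> ?Q" by simp
    ultimately have Q: "?Q > 0" by linarith
    then have "ennreal (?T\<^sup>2 / ?Q) \<le> fisher_scale F" using le by (subst (asm) divide_ennreal) auto
    also have "fisher_scale F = ennreal (enn2real (fisher_scale F))" using fin by (simp add: ennreal_enn2real)
    finally have "?T\<^sup>2 / ?Q \<le> enn2real (fisher_scale F)" by (subst (asm) ennreal_le_iff) auto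
    then show ?thesis using Q by (simp add: divide_le_eq)
  qed
qed

text \<open>The Riesz bound gives one inequality between the squared norm of \<open>w\<close> and
  the information, Cauchy--Schwarz the other.\<close>

lemma fisher_scale_finite_score:
  assumes F: "real_distribution F" and fin: "fisher_scale F < \<infinity>"
  shows "\<exists>w. w \<in> borel_measurable borel \<and> integrable F (\<lambda>x. (w x)\<^sup>2) \<and>
    fisher_scale F = ennreal (\<integral>x. (w x)\<^sup>2 \<partial>F) \<and>
    (\<forall>\<phi>\<in>C_c1. (\<integral>x. x * deriv \<phi> x \<partial>F) = (\<integral>x. w x * \<phi> x \<partial>F))"
proof -
  interpret real_distribution F by fact
  note [measurable_cong] = events_eq_borel
  have I: "integrable F (\<lambda>x. x * deriv \<phi> x)" if \<phi>: "\<phi> \<in> C_c1" for \<phi>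
  proof -
    note [measurable] = C_c1_measurable[OF \<phi>]
    obtain K where K: "\<And>x. \<bar>\<phi> x\<bar> \<le> K" "\<And>x. \<bar>deriv \<phi> x\<bar> \<le> K" "\<And>x. \<bar>x * deriv \<phi> x\<bar> \<le> K"
      by (rule C_c1_bounded[OF \<phi>], rule that)
    show ?thesis by (rule integrable_const_bound[where B = K]) (use K(3) in auto)
  qed
  have "\<exists>w. w \<in> borel_measurable F \<and> integrable F (\<lambda>x. (w x)\<^sup>2) \<and> (\<integral>x. (w x)\<^sup>2 \<partial>F) \<le> enn2real (fisher_scale F) \<and>
      (\<forall>v\<in>C_c1. (\<integral>x. x * deriv v x \<partial>F) = (\<integral>x. w x * v x \<partial>F))"
  proof (rule L2_Riesz_on_subspace[OF finite_measure_axioms])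
    show "C_c1 \<noteq> {}" using one_in_C_c1 by blast
    show "v \<in> borel_measurable F" if "v \<in> C_c1" for v
      using C_c1_measurable(1)[OF that] by (simp add: measurable_cong_sets[OF events_eq_borel refl])
    show "(\<integral>x. x * deriv (\<lambda>x. a * u x + b * v x) x \<partial>F) = a * (\<integral>x. x * deriv u x \<partial>F) + b * (\<integral>x. x * deriv v x \<partial>F)"
      if "u \<in> C_c1" "v \<in> C_c1" for u v a b
    proof -
      have "(\<lambda>x. x * deriv (\<lambda>x. a * u x + b * v x) x) = (\<lambda>x. a * (x * deriv u x) + b * (x * deriv v x))"
        unfolding C_c1_lincomb(2)[OF that] by (auto simp: algebra_simps)
      then show ?thesis using I[OF that(1)] I[OF that(2)] by simp
    qed
  qed (use C_c1_lincomb(1) C_c1_square_integrable[OF F] score_square_le_fisher_scale[OF fin] in auto)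
  then obtain w where w: "w \<in> borel_measurable F" "integrable F (\<lambda>x. (w x)\<^sup>2)"
    "(\<integral>x. (w x)\<^sup>2 \<partial>F) \<le> enn2real (fisher_scale F)"
    "\<And>v. v \<in> C_c1 \<Longrightarrow> (\<integral>x. x * deriv v x \<partial>F) = (\<integral>x. w x * v x \<partial>F)" by blast
  have wm: "w \<in> borel_measurable borel" using w(1) by (simp add: measurable_cong_sets[OF events_eq_borel refl])
  have "ennreal (\<integral>x. (w x)\<^sup>2 \<partial>F) \<le> fisher_scale F"
    using ennreal_leI[OF w(3)] unfolding ennreal_enn2real[OF fin[unfolded infinity_ennreal_def]] .
  then have "fisher_scale F = ennreal (\<integral>x. (w x)\<^sup>2 \<partial>F)"
    using fisher_scale_le[OF F wm w(2) w(4)] by simp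
  then show ?thesis using wm w(2,4) by blast
qed

text \<open>Densities are determined only almost everywhere, but the products are continuous and a
  nonempty open set is not null. The values of \<open>f\<close> and \<open>g\<close> at 0 may still
  differ.\<close>

lemma regular_density_unique:
  assumes f: "scale_regular_density F f" and g: "scale_regular_density F g"
  shows "(\<lambda>x. x * f x) = (\<lambda>x. x * g x)"
proof -
  have fg: "density lborel f = density lborel g" and m[measurable]: "f \<in> borel_measurable borel" "g \<in> borel_measurable borel"
    and nn: "\<And>x. 0 \<le> f x" "\<And>x. 0 \<le> g x"
    and ac: "abs_continuous_fun (\<lambda>x. x * f x)" "abs_continuous_fun (\<lambda>x. x * g x)"
    using f g by (auto simp: scale_regular_density_def is_lebesgue_density_def)
  have "AE x in lborel. ennreal (f x) = ennreal (g x)"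
    by (rule sigma_finite_measure.density_unique[OF sigma_finite_lborel _ _ fg]) auto
  then have "AE x in lborel. x * f x = x * g x"
    by eventually_elim (simp add: nn)
  moreover have op: "open {x. x * f x \<noteq> x * g x}"
    using abs_continuous_fun_imp_continuous[OF ac(1)] abs_continuous_fun_imp_continuous[OF ac(2)]
    by (rule open_Collect_neq)
  ultimately have "{x. x * f x \<noteq> x * g x} \<in> null_sets lborel"
    by (subst AE_iff_null_sets) auto
  then have "negligible {x. x * f x \<noteq> x * g x}"
    by (simp add: negligible_iff_null_sets null_sets_completionI)
  then have "{x. x * f x \<noteq> x * g x} = {}" using op open_not_negligible by blast
  then show ?thesis by auto
qed

lemma AE_remove_zero_mass_nonzero:
  assumes "real_distribution F"
  shows "AE x in remove_zero_mass F. x \<noteq> 0"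
proof -
  interpret real_distribution F by fact
  note [measurable_cong] = events_eq_borel
  show ?thesis
    unfolding remove_zero_mass_eq[OF assms] by (subst AE_density) (auto simp: indicator_def)
qed

lemma fisher_scale_finite_imp:
  assumes F: "real_distribution F" and fin: "fisher_scale F < \<infinity>"
  shows "\<exists>f. scale_regular_density F f \<and>
    fisher_scale F = (\<integral>\<^sup>+x. ennreal ((Lambda f x)\<^sup>2) \<partial>remove_zero_mass F)"
proof -
  interpret real_distribution F by fact
  obtain w where w[measurable]: "w \<in> borel_measurable borel" and w2: "integrable F (\<lambda>x. (w x)\<^sup>2)"
    and eq: "fisher_scale F = ennreal (\<integral>x. (w x)\<^sup>2 \<partial>F)"
    and T: "\<And>\<phi>. \<phi> \<in> C_c1 \<Longrightarrow> (\<integral>x. x * deriv \<phi> x \<partial>F) = (\<integral>x. w x * \<phi> x \<partial>F)"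
    using fisher_scale_finite_score[OF F fin] by blast
  obtain f where f: "scale_regular_density F f" "AE x in remove_zero_mass F. Lambda f x = w x" "w 0 * measure F {0} = 0"
    using score_representation[OF F w w2 T] by blast
  note Ms = finite_measure_remove_zero_mass(2)[OF F]
  have "integrable F (\<lambda>x. indicator (- {0}) x * (w x)\<^sup>2)"
    using integrable_mult_indicator[OF _ w2, of "- {0}"] by simp
  then have iN: "integrable (remove_zero_mass F) (\<lambda>x. (w x)\<^sup>2)"
    by (subst integrable_remove_zero_mass[OF F]) auto
  have "(\<integral>x. (w x)\<^sup>2 \<partial>F) = (\<integral>x. indicator (- {0}) x * (w x)\<^sup>2 + (w 0)\<^sup>2 * indicator {0} x \<partial>F)"
    by (rule Bochner_Integration.integral_cong) (auto simp: indicator_def)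
  also have "\<dots> = (\<integral>x. indicator (- {0}) x * (w x)\<^sup>2 \<partial>F) + (w 0)\<^sup>2 * measure F {0}"
  proof -
    have "integrable F (\<lambda>x. (w 0)\<^sup>2 * indicator {0} x)"
      by (intro integrable_mult_right integrable_real_indicator) (auto simp: less_top[symmetric])
    then show ?thesis using integrable_mult_indicator[OF _ w2, of "- {0}"] by simp
  qed
  \<comment> \<open>The atom carries no part of the norm: by \<open>f(3)\<close> one of the two
    factors is zero.\<close>
  also have "(w 0)\<^sup>2 * measure F {0} = 0" using f(3) by auto
  also have "(\<integral>x. indicator (- {0}) x * (w x)\<^sup>2 \<partial>F) = (\<integral>x. (w x)\<^sup>2 \<partial>remove_zero_mass F)"
    by (rule integral_remove_zero_mass[OF F, symmetric]) simp
  finally have "fisher_scale F = ennreal (\<integral>x. (w x)\<^sup>2 \<partial>remove_zero_mass F)" using eq by simp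
  also have "\<dots> = (\<integral>\<^sup>+x. ennreal ((w x)\<^sup>2) \<partial>remove_zero_mass F)"
    by (rule nn_integral_eq_integral[symmetric, OF iN]) simp
  also have "\<dots> = (\<integral>\<^sup>+x. ennreal ((Lambda f x)\<^sup>2) \<partial>remove_zero_mass F)"
    by (rule nn_integral_cong_AE) (use f(2) in eventually_elim, simp)
  finally show ?thesis using f(1) by blast
qed

lemma regular_density_imp_finite:
  assumes F: "real_distribution F" and f: "scale_regular_density F f"
  shows "fisher_scale F < \<infinity>"
proof -
  note Ms = finite_measure_remove_zero_mass(2)[OF F]
  have L[measurable]: "Lambda f \<in> borel_measurable borel"
    and L2: "integrable (remove_zero_mass F) (\<lambda>x. (Lambda f x)\<^sup>2)"
    using f by (auto simp: scale_regular_density_def in_L2_def measurable_cong_sets[OF Ms refl])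
  \<comment> \<open>Setting the score to 0 at the atom turns it into a representer in L2(F).\<close>
  let ?w = "\<lambda>x. indicator (- {0}) x * Lambda f x"
  have "fisher_scale F \<le> ennreal (\<integral>x. (?w x)\<^sup>2 \<partial>F)"
  proof (rule fisher_scale_le[OF F])
    have "integrable F (\<lambda>x. indicator (- {0}) x * (Lambda f x)\<^sup>2)"
      using L2 by (subst (asm) integrable_remove_zero_mass[OF F]) auto
    moreover have "(\<lambda>x. indicator (- {0}) x * (Lambda f x)\<^sup>2) = (\<lambda>x. (?w x)\<^sup>2)"
      by (auto simp: indicator_def fun_eq_iff)
    ultimately show "integrable F (\<lambda>x. (?w x)\<^sup>2)" by simp
    fix \<phi> assume \<phi>: "\<phi> \<in> C_c1"
    note [measurable] = C_c1_measurable[OF \<phi>]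
    show "(\<integral>x. x * deriv \<phi> x \<partial>F) = (\<integral>x. ?w x * \<phi> x \<partial>F)"
      unfolding regular_density_score[OF F f \<phi>]
      by (subst integral_remove_zero_mass[OF F]) (auto simp: mult.assoc)
  qed measurable
  then show ?thesis by (simp add: order_le_less_trans)
qed

text \<open>Off 0 the density inherits differentiability from \<open>x * f x\<close> by the quotient
  rule, and the product rule then gives the bracket as minus \<open>Lambda f\<close>; the square
  removes the sign.\<close>

lemma regular_density_deriv:
  assumes f: "scale_regular_density F f" and F: "real_distribution F"
  shows "AE x in remove_zero_mass F. (1 + x * deriv f x / f x)\<^sup>2 = (Lambda f x)\<^sup>2"
proof -
  have dens: "remove_zero_mass F = density lborel f" and fm[measurable]: "f \<in> borel_measurable borel"
    and f0: "\<And>x. 0 \<le> f x" and ac: "abs_continuous_fun (\<lambda>x. x * f x)"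
    using f by (auto simp: scale_regular_density_def is_lebesgue_density_def)
  let ?g = "\<lambda>x. x * f x"
  have "AE x in lborel. \<forall>n::nat. - real n < x \<and> x < real n \<longrightarrow> ?g differentiable (at x)"
    unfolding AE_all_countable
  proof
    fix n :: nat
    obtain h where h: "integrable lborel h"
      "\<And>a b. - real n \<le> a \<Longrightarrow> a \<le> b \<Longrightarrow> b \<le> real n \<Longrightarrow> ?g b - ?g a = (LINT x:{a<..b}|lborel. h x)"
      using abs_continuous_fun_integral[OF ac, of "- real n" "real n"] by auto
    have "AE x in lborel. - real n < x \<and> x < real n \<longrightarrow> (?g has_real_derivative h x) (at x)"
      by (rule AE_has_derivative_of_integral[OF h])
    then show "AE x in lborel. - real n < x \<and> x < real n \<longrightarrow> ?g differentiable (at x)"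
      by eventually_elim (auto simp: real_differentiable_def)
  qed
  then have "AE x in lborel. 0 < f x \<longrightarrow> (1 + x * deriv f x / f x)\<^sup>2 = (Lambda f x)\<^sup>2"
    using AE_lborel_singleton[of 0]
  proof eventually_elim
    case (elim x)
    obtain n :: nat where "\<bar>x\<bar> < real n" using reals_Archimedean2 by blast
    then have "- real n < x \<and> x < real n" by linarith
    then have "?g differentiable (at x)" by (rule elim(1)[rule_format])
    then have D: "(?g has_real_derivative deriv ?g x) (at x)"
      by (simp add: DERIV_deriv_iff_real_differentiable)
    have "((\<lambda>y. ?g y / y) has_real_derivative (deriv ?g x * x - ?g x * 1) / (x * x)) (at x)"
      using elim(2) by (intro DERIV_divide D DERIV_ident)
    then have "(f has_real_derivative (deriv ?g x * x - ?g x * 1) / (x * x)) (at x)"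
      by (rule has_field_derivative_transform_within_open[of _ _ _ "- {0}"]) (use elim(2) in auto)
    then have df: "deriv f x = (deriv ?g x * x - ?g x) / (x * x)" by (simp add: DERIV_imp_deriv)
    show ?case
    proof
      assume fx: "0 < f x"
      have "x * deriv f x = deriv ?g x - f x"
        unfolding df using elim(2) by (simp add: field_simps)
      then have "1 + x * deriv f x / f x = - Lambda f x"
        using fx by (simp add: Lambda_def field_simps)
      then show "(1 + x * deriv f x / f x)\<^sup>2 = (Lambda f x)\<^sup>2" by simp
    qed
  qed
  then show ?thesis
    unfolding dens by (subst AE_density) (auto elim!: eventually_mono)
qed

theorem theorem2p2:
  fixes F :: "real measure"
  assumes "real_distribution F"
  shows "(fisher_scale F < \<infinity> \<longleftrightarrow>
            absolutely_continuous lborel (remove_zero_mass F) \<and>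
            (\<exists>f. scale_regular_density F f)) \<and>
         (\<forall>f. scale_regular_density F f \<longrightarrow>
            fisher_scale F = (\<integral>\<^sup>+x. ennreal ((Lambda f x)\<^sup>2) \<partial>(remove_zero_mass F)) \<and>
            fisher_scale F = (\<integral>\<^sup>+x\<in>{x. x \<noteq> 0}. ennreal ((1 + x * deriv f x / f x)\<^sup>2) \<partial>F))"
proof (intro conjI iffI allI impI)
  interpret real_distribution F by fact
  note F = assms and [measurable_cong] = events_eq_borel
  show "\<exists>f. scale_regular_density F f" if "fisher_scale F < \<infinity>"
    using fisher_scale_finite_imp[OF F that] by blast
  show "absolutely_continuous lborel (remove_zero_mass F)" if fin: "fisher_scale F < \<infinity>"
  proof -
    obtain f where "remove_zero_mass F = density lborel f" "f \<in> borel_measurable borel"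
      using fisher_scale_finite_imp[OF F fin] by (auto simp: scale_regular_density_def is_lebesgue_density_def)
    then show ?thesis by (simp add: absolutely_continuousI_density)
  qed
  show "fisher_scale F < \<infinity>" if "absolutely_continuous lborel (remove_zero_mass F) \<and> (\<exists>f. scale_regular_density F f)"
    using regular_density_imp_finite[OF F] that by blast
  fix f assume f: "scale_regular_density F f"
  let ?N = "remove_zero_mass F"
  \<comment> \<open>Finiteness supplies the formula for one density \<open>g\<close> only, and it
    must be carried over to the given \<open>f\<close>. Off 0 both have the same
    \<open>Lambda\<close>, and 0 has no mass under \<open>?N\<close>.\<close>
  obtain g where g: "scale_regular_density F g" and eq: "fisher_scale F = (\<integral>\<^sup>+x. ennreal ((Lambda g x)\<^sup>2) \<partial>?N)"
    using fisher_scale_finite_imp[OF F regular_density_imp_finite[OF F f]] by blast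
  note fg = regular_density_unique[OF f g]
  have "Lambda f x = Lambda g x" if "x \<noteq> 0" for x
    using fun_cong[OF fg, of x] that by (simp add: Lambda_def fg)
  then have "(\<integral>\<^sup>+x. ennreal ((Lambda f x)\<^sup>2) \<partial>?N) = (\<integral>\<^sup>+x. ennreal ((Lambda g x)\<^sup>2) \<partial>?N)"
    by (intro nn_integral_cong_AE) (use AE_remove_zero_mass_nonzero[OF F] in eventually_elim, simp)
  then show main: "fisher_scale F = (\<integral>\<^sup>+x. ennreal ((Lambda f x)\<^sup>2) \<partial>?N)" using eq by simp
  have L[measurable]: "Lambda f \<in> borel_measurable borel"
    using f by (auto simp: scale_regular_density_def in_L2_def measurable_cong_sets[OF finite_measure_remove_zero_mass(2)[OF F] refl])
  have "(\<integral>\<^sup>+x. ennreal ((Lambda f x)\<^sup>2) \<partial>?N) = (\<integral>\<^sup>+x. indicator (- {0}) x * ennreal ((Lambda f x)\<^sup>2) \<partial>F)"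
    unfolding remove_zero_mass_eq[OF F] by (subst nn_integral_density) auto
  also have "\<dots> = (\<integral>\<^sup>+x\<in>{x. x \<noteq> 0}. ennreal ((1 + x * deriv f x / f x)\<^sup>2) \<partial>F)"
  proof (rule nn_integral_cong_AE)
    have "AE x in F. x \<noteq> 0 \<longrightarrow> (1 + x * deriv f x / f x)\<^sup>2 = (Lambda f x)\<^sup>2"
      using regular_density_deriv[OF f F] unfolding remove_zero_mass_eq[OF F]
      by (subst (asm) AE_density) (auto simp: indicator_def)
    then show "AE x in F. indicator (- {0}) x * ennreal ((Lambda f x)\<^sup>2) = ennreal ((1 + x * deriv f x / f x)\<^sup>2) * indicator {x. x \<noteq> 0} x"
      by eventually_elim (auto simp: indicator_def)
  qed
  finally show "fisher_scale F = (\<integral>\<^sup>+x\<in>{x. x \<noteq> 0}. ennreal ((1 + x * deriv f x / f x)\<^sup>2) \<partial>F)"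
    using main by simp
qed

end
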